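(* Let $X$ be an acyclic simple polyhedron whose singular set $Sing(X)$ is a disjoint union of circles. Then $X$ collapses onto a disk $D^2$.
   Context: Let $Y$ denote the cone over three points. A simple polyhedron is a compact (PL) space $X$ in which every point has a regular neighborhood of one of five types: (i) a disk, the point being interior; (ii) $Y\times(-1,1)$, the point being (cone point, $0$); (iii) the cone over the complete graph $K_4$, the point being the cone point (a true vertex); (iv) a half-disk, the point lying on the boundary diameter; (v) $Y\times[0,1)$, the point being (cone point, $0$). The singular set $Sing(X)$ is the set of points of type (ii), (iii) or (v). Acyclic means having the integral homology of a point. $X$ collapses onto a subpolyhedron $X_0$ if there are a triangulation $(K,K_0)$ of the pair $(X,X_0)$ and a sequence of elementary simplicial collapses from $K$ onto $K_0$; "$X$ collapses onto $D^2$" means that $X$ collapses onto a subpolyhedron homeomorphic to the closed disk $D^2$. *)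

theory Defs
  imports "HOL-Analysis.Analysis" "HOL-Homology.Homology"
begin

section \<open>Compact polyhedra, PL homeomorphisms, regular neighbourhoods of points\<close>

text \<open>Compact PL spaces are represented by compact polyhedra in a Euclidean space.
  The library's simplicial complexes contain the empty simplex.\<close>

definition polyhedral_space :: "'a::euclidean_space set \<Rightarrow> bool" where
  "polyhedral_space X \<longleftrightarrow> (\<exists>K. simplicial_complex K \<and> \<Union>K = X)"

definition affine_map_on :: "'a::euclidean_space set \<Rightarrow> ('a \<Rightarrow> 'b::euclidean_space) \<Rightarrow> bool" where
  "affine_map_on S h \<longleftrightarrow> (\<exists>f c. linear f \<and> (\<forall>x\<in>S. h x = f x + c))"

text \<open>For a compact polyhedron \<open>S\<close> the image \<open>T\<close> is then a compact polyhedron and the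
  inverse is piecewise linear as well.\<close>

definition pl_homeomorphism ::
    "'a::euclidean_space set \<Rightarrow> 'b::euclidean_space set \<Rightarrow> ('a \<Rightarrow> 'b) \<Rightarrow> bool" where
  "pl_homeomorphism S T h \<longleftrightarrow>
     (\<exists>g. homeomorphism S T h g) \<and>
     (\<exists>K. simplicial_complex K \<and> \<Union>K = S \<and> (\<forall>\<sigma>\<in>K. affine_map_on \<sigma> h))"

text \<open>A regular neighbourhood of a point is its closed star in a triangulation having
  that point as a vertex.\<close>

definition regular_nbhd :: "'a::euclidean_space set \<Rightarrow> 'a \<Rightarrow> 'a set \<Rightarrow> bool" where
  "regular_nbhd X x N \<longleftrightarrow>
     (\<exists>K. simplicial_complex K \<and> \<Union>K = X \<and> {x} \<in> K \<and> N = \<Union>{\<sigma>\<in>K. x \<in> \<sigma>})"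

section \<open>Simple polyhedra\<close>

text \<open>This is the abstract cone when each ray from \<open>a\<close> meets \<open>L\<close> at most once
  and \<open>a \<notin> L\<close>, as in the two uses below.\<close>

definition cone_from :: "'a::euclidean_space \<Rightarrow> 'a set \<Rightarrow> 'a set" where
  "cone_from a L = (\<Union>y\<in>L. closed_segment a y)"

definition Y_graph :: "(real^3) set" where
  "Y_graph = cone_from 0 Basis"

definition K4_graph :: "(real^4) set" where
  "K4_graph = (\<Union>u\<in>Basis. \<Union>v\<in>Basis. closed_segment u v)"

text \<open>Some regular neighbourhood of \<open>x\<close> in \<open>X\<close> is PL homeomorphic to \<open>M\<close>, with \<open>x\<close>
  corresponding to a point of \<open>B\<close>.\<close>

definition modelled_on ::
    "'a::euclidean_space set \<Rightarrow> 'a \<Rightarrow> 'b::euclidean_space set \<Rightarrow> 'b set \<Rightarrow> bool" where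
  "modelled_on X x M B \<longleftrightarrow>
     (\<exists>N h. regular_nbhd X x N \<and> pl_homeomorphism N M h \<and> h x \<in> B)"

text \<open>Regular neighbourhoods are compact, so the interval factors \<open>(-1,1)\<close> and \<open>[0,1)\<close> of
  the usual local models are replaced by their closures.\<close>

definition surface_point :: "'a::euclidean_space set \<Rightarrow> 'a \<Rightarrow> bool" where
  "surface_point X x \<longleftrightarrow>
     modelled_on X x ({-1..1} \<times> {-1..1} :: (real \<times> real) set) ({-1<..<1} \<times> {-1<..<1})"

definition triple_point :: "'a::euclidean_space set \<Rightarrow> 'a \<Rightarrow> bool" where
  "triple_point X x \<longleftrightarrow>
     modelled_on X x (Y_graph \<times> ({-1..1} :: real set)) {(0, 0)}"

definition true_vertex :: "'a::euclidean_space set \<Rightarrow> 'a \<Rightarrow> bool" where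
  "true_vertex X x \<longleftrightarrow> modelled_on X x (cone_from 0 K4_graph) {0}"

definition boundary_surface_point :: "'a::euclidean_space set \<Rightarrow> 'a \<Rightarrow> bool" where
  "boundary_surface_point X x \<longleftrightarrow>
     modelled_on X x ({-1..1} \<times> {0..1} :: (real \<times> real) set) ({-1..1} \<times> {0})"

definition boundary_triple_point :: "'a::euclidean_space set \<Rightarrow> 'a \<Rightarrow> bool" where
  "boundary_triple_point X x \<longleftrightarrow>
     modelled_on X x (Y_graph \<times> ({0..1} :: real set)) {(0, 0)}"

definition simple_polyhedron :: "'a::euclidean_space set \<Rightarrow> bool" where
  "simple_polyhedron X \<longleftrightarrow> polyhedral_space X \<and>
     (\<forall>x\<in>X. surface_point X x \<or> triple_point X x \<or> true_vertex X x \<or>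
            boundary_surface_point X x \<or> boundary_triple_point X x)"

definition Sing :: "'a::euclidean_space set \<Rightarrow> 'a set" where
  "Sing X = {x\<in>X. triple_point X x \<or> true_vertex X x \<or> boundary_triple_point X x}"

text \<open>Finiteness makes the union a topological disjoint union; it is no restriction for
  compact sets. The union may be empty.\<close>

definition disjoint_union_of_circles :: "'a::euclidean_space set \<Rightarrow> bool" where
  "disjoint_union_of_circles S \<longleftrightarrow>
     (\<exists>\<C>. finite \<C> \<and> pairwise disjnt \<C> \<and> \<Union>\<C> = S \<and>
          (\<forall>C\<in>\<C>. C homeomorphic sphere (0::real^2) 1))"

section \<open>Acyclicity\<close>

definition acyclic_space :: "'a::topological_space set \<Rightarrow> bool" where
  "acyclic_space X \<longleftrightarrow>
     (\<forall>p. homology_group p (top_of_set X) \<cong> homology_group p (discrete_topology {()}))"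

section \<open>Collapses\<close>

text \<open>Since \<open>facet_of\<close> excludes the empty face, the empty simplex is never removed.\<close>

definition elementary_collapse ::
    "'a::euclidean_space set set \<Rightarrow> 'a set set \<Rightarrow> bool" where
  "elementary_collapse K L \<longleftrightarrow>
     (\<exists>\<sigma>\<in>K. \<exists>\<tau>\<in>K. \<tau> facet_of \<sigma> \<and>
        (\<forall>\<rho>\<in>K. \<tau> face_of \<rho> \<longrightarrow> \<rho> = \<sigma> \<or> \<rho> = \<tau>) \<and> L = K - {\<sigma>, \<tau>})"

definition collapses_onto :: "'a::euclidean_space set \<Rightarrow> 'a set \<Rightarrow> bool" where
  "collapses_onto X X\<^sub>0 \<longleftrightarrow>
     (\<exists>K K\<^sub>0. simplicial_complex K \<and> \<Union>K = X \<and>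
        simplicial_complex K\<^sub>0 \<and> K\<^sub>0 \<subseteq> K \<and> \<Union>K\<^sub>0 = X\<^sub>0 \<and>
        elementary_collapse\<^sup>*\<^sup>* K K\<^sub>0)"

end

theory Submission
  imports "HOL-Homology.Homology" "HOL-Library.Function_Algebras" Defs
begin

text \<open>Collapse a triangulation of \<open>X\<close> greedily through free edges. If only one triangle is left, the
  remaining graph is connected of Euler characteristic 1, and its leaves collapse onto that triangle.

  Suppose that the collapse gets stuck earlier. In the residual complex every edge lies in two or three
  triangles, and the triple edges form \<open>m\<close> circles. Cut along them into \<open>n\<close> sheets, and
  call the boundary circles of the sheets ends: the three flaps at a circle give one, two or three ends, according
  to the monodromy. Let \<open>g\<close> be the number of circles with more than one end. As there is no 2-cycle modulo 2,
  \<open>n \<le> m\<close>. A 2-chain modulo 3 whose boundary lives on the triple edges is determined by its boundary, which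
  vanishes on the circles with a single end because \<open>3 = 0\<close>; so these chains have dimension at most \<open>g\<close>.
  There are at least \<open>m + g\<close> ends. The Euler characteristic of the cut surface, with its boundary circles collapsed
  to points, then gives \<open>ends + 1 \<le> n + g \<le> m + g \<le> ends\<close>, a contradiction.

  The local properties of the triangulation which are used here follow from the charts of \<open>X\<close> by invariance
  of domain: three pages of a book do not embed in the plane, and two of them do not embed in a half-plane with
  their axis on the boundary. The charts at true vertices are excluded since the singular set contains no triod.\<close>

section \<open>Chains of a 2-complex\<close>

text \<open>Both primes matter. Modulo 2 alone, every sheet of the cut surface is a 2-cycle and the
  count reads ends + 1 \<le> 2n \<le> 2m; a circle along which the three flaps form a single end
  then spoils the contradiction. Modulo 3 such a circle is harmless, since its end runs along it
  three times. Modulo 2 is still used for n \<le> m, because a sheet need not be orientable.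

  Acyclicity itself does not pass to the triangles left by a stuck collapse. What passes is the
  absence of 2-cycles over both fields, because a 2-cycle of a subcomplex is one of the whole
  complex, and one inequality for the Euler characteristic: collapses keep it equal to 1 and keep
  the graph connected, and the part of a connected graph outside the triangles has at least as many
  edges as vertices.

  It is replaced by chi \<le> h_0 + h_2, proved by counting the elements of finite chain
  groups.\<close>

lemma cases_mod_3: "(x::3) = 0 \<or> x = 1 \<or> x = 2"
proof -
  have "card {0,1,2::3} = 3" by simp
  moreover have "card (UNIV::3 set) = 3" by simp
  ultimately have "{0,1,2::3} = UNIV"
    by (intro card_subset_eq) auto
  then show ?thesis by auto
qed

lemma square_eq_0_mod_3: "(x::3) * x = 0 \<Longrightarrow> x = 0" using cases_mod_3[of x] by auto

lemma triple_eq_0_mod_3: "3 * (x::3) = 0" using cases_mod_3[of x] by auto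

text \<open>Rank and nullity in multiplicative form: dimensions over a finite field are compared by
  counting elements. The domain is a set closed under subtraction, since chains with prescribed
  support do not form a type.\<close>

lemma card_eq_card_ker_times_card_image:
  fixes f :: "'a::ab_group_add \<Rightarrow> 'b::ab_group_add"
  assumes "finite A" and diff: "\<And>x y. x \<in> A \<Longrightarrow> y \<in> A \<Longrightarrow> x - y \<in> A"
    and hom: "\<And>x y. x \<in> A \<Longrightarrow> y \<in> A \<Longrightarrow> f (x - y) = f x - f y"
  shows "card A = card {x \<in> A. f x = 0} * card (f ` A)"
proof -
  let ?K = "{x \<in> A. f x = 0}"
  have neg: "- y \<in> A" if "y \<in> A" for y using diff[OF diff[OF that that] that] by simp
  have add: "x + y \<in> A" "f (x + y) = f x + f y" if "x \<in> A" "y \<in> A" for x y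
    using diff[OF that(1) neg[OF that(2)]] hom[OF that(1) neg[OF that(2)]]
      hom[OF diff[OF that(2) that(2)] that(2)] hom[OF that(2,2)] by simp_all
  have fib: "card {x \<in> A. f x = y} = card ?K" if y: "y \<in> f ` A" for y
  proof -
    from y obtain a where a: "a \<in> A" "y = f a" by blast
    have "bij_betw (\<lambda>k. k + a) ?K {x \<in> A. f x = y}"
      by (rule bij_betw_byWitness[where f' = "\<lambda>x. x - a"]) (auto simp: a add diff hom)
    then show ?thesis by (simp add: bij_betw_same_card)
  qed
  have "card A = (\<Sum>y\<in>f ` A. card {x \<in> A. f x = y})"
    using sum.image_gen[OF \<open>finite A\<close>, of "\<lambda>_. 1::nat" f] by simp
  then show ?thesis using fib by simp
qed

text \<open>Chains are total functions that vanish off the cells, so that pointwise subtraction of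
  functions makes them a group and the counting lemma applies.\<close>

definition supp_funs :: "'x set \<Rightarrow> ('x \<Rightarrow> 'f::zero) set" where
  "supp_funs A = {f. \<forall>x. x \<notin> A \<longrightarrow> f x = 0}"

lemma card_supp_funs:
  assumes "finite A"
  shows "card (supp_funs A :: ('x \<Rightarrow> 'f::{finite,zero}) set) = CARD('f) ^ card A"
proof -
  have "bij_betw (\<lambda>f. restrict f A) (supp_funs A :: ('x \<Rightarrow> 'f) set) (PiE A (\<lambda>_. UNIV))"
    by (rule bij_betw_byWitness[where f' = "\<lambda>f x. if x \<in> A then f x else 0"])
       (auto simp: supp_funs_def fun_eq_iff PiE_def extensional_def)
  then show ?thesis using assms by (simp add: bij_betw_same_card card_PiE)
qed

lemma finite_supp_funs:
  assumes "finite A"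
  shows "finite (supp_funs A :: ('x \<Rightarrow> 'f::{finite,zero}) set)"
proof -
  have "card (supp_funs A :: ('x \<Rightarrow> 'f) set) > 0" by (simp add: card_supp_funs assms)
  then show ?thesis by (rule card_ge_0_finite)
qed

section \<open>Edges, triangles and incidence numbers\<close>

definition edges_of :: "'v set set \<Rightarrow> 'v set set" where
  "edges_of T = {e. card e = 2 \<and> (\<exists>t\<in>T. e \<subseteq> t)}"

definition tri_at :: "'v set set \<Rightarrow> 'v set \<Rightarrow> 'v set set" where
  "tri_at T e = {t\<in>T. e \<subseteq> t}"

lemma card_2_subsets_triple:
  assumes "card {a,b,c} = 3"
  shows "{e. card e = 2 \<and> e \<subseteq> {a,b,c}} = {{a,b},{b,c},{a,c}}"
proof -
  have "a \<noteq> b" "b \<noteq> c" "a \<noteq> c" using assms by (auto simp: card_insert_if split: if_splits)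
  then show ?thesis by (auto simp: card_2_iff subset_iff)
qed

lemma edges_through_vertex_triple:
  assumes "a \<noteq> b" "b \<noteq> c" "a \<noteq> c"
  shows "{e. card e = 2 \<and> a \<in> e \<and> e \<subseteq> {a,b,c}} = {{a,b},{a,c}}"
proof -
  have "card {a,b,c} = 3" using assms by simp
  from card_2_subsets_triple[OF this] have
   "{e. card e = 2 \<and> a \<in> e \<and> e \<subseteq> {a,b,c}} = {{a,b},{b,c},{a,c}} \<inter> {e. a \<in> e}" by blast
  then show ?thesis using assms by auto
qed

lemma triple_through:
  assumes "card t = 3" "v \<in> t"
  obtains x y where "t = {v,x,y}" "v \<noteq> x" "x \<noteq> y" "v \<noteq> y"
proof -
  have "card (t - {v}) = 2" using assms by simp
  then obtain x y where "t - {v} = {x,y}" "x \<noteq> y" by (auto simp: card_2_iff)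
  then have "t = {v,x,y}" "v \<noteq> x" "v \<noteq> y" using assms(2) by auto
  with \<open>x \<noteq> y\<close> that show ?thesis by blast
qed

definition sg :: "('v \<Rightarrow> nat) \<Rightarrow> 'v \<Rightarrow> 'v \<Rightarrow> 'f::comm_ring_1" where
  "sg num x y = (if num x < num y then 1 else if num y < num x then -1 else 0)"

text \<open>\<open>inc num t e\<close> is the incidence number of the edge \<open>e\<close> in the triangle \<open>t\<close>, and
  \<open>sp num e v\<close> that of the vertex \<open>v\<close> in the edge \<open>e\<close>, for the orientations given by the
  numbering \<open>num\<close> of the vertices.\<close>

definition inc :: "('v \<Rightarrow> nat) \<Rightarrow> 'v set \<Rightarrow> 'v set \<Rightarrow> 'f::comm_ring_1" where
  "inc num t e = (\<Prod>a\<in>e. \<Prod>x\<in>t - e. sg num a x)"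

definition sp :: "('v \<Rightarrow> nat) \<Rightarrow> 'v set \<Rightarrow> 'v \<Rightarrow> 'f::comm_ring_1" where
  "sp num e v = (\<Prod>a\<in>e - {v}. sg num a v)"

definition bnd :: "('v \<Rightarrow> nat) \<Rightarrow> 'v set set \<Rightarrow> ('v set \<Rightarrow> 'f::comm_ring_1) \<Rightarrow> 'v set \<Rightarrow> 'f" where
  "bnd num T c e = (\<Sum>t\<in>tri_at T e. inc num t e * c t)"

definition bnd1 :: "('v \<Rightarrow> nat) \<Rightarrow> 'v set set \<Rightarrow> ('v set \<Rightarrow> 'f::comm_ring_1) \<Rightarrow> 'v \<Rightarrow> 'f" where
  "bnd1 num E z v = (\<Sum>e\<in>{e\<in>E. v \<in> e}. sp num e v * z e)"

lemma sg_square: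
  assumes "num x \<noteq> num y" shows "sg num x y * sg num x y = 1"
  using assms by (auto simp: sg_def)

lemma sg_antisym: "sg num y x = - sg num x y"
  by (auto simp: sg_def)

lemma inc_triple:
  assumes "a \<noteq> b" "b \<noteq> c" "a \<noteq> c"
  shows "inc num {a,b,c} {a,b} = sg num a c * sg num b c"
proof -
  have "{a,b,c} - {a,b} = {c}" using assms by auto
  then show ?thesis using assms by (simp add: inc_def)
qed

lemma sp_pair:
  assumes "a \<noteq> b"
  shows "sp num {a,b} a = sg num b a"
proof -
  have "{a,b} - {a} = {b}" using assms by auto
  then show ?thesis by (simp add: sp_def)
qed

text \<open>One triangle's share of the vanishing of the double boundary: at the corner
  \<open>v\<close> its two edges cancel, because \<open>sg\<close> is antisymmetric.\<close>

lemma sp_inc_cancel: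
  assumes "v \<noteq> x" "x \<noteq> y" "v \<noteq> y"
  shows "sp num {v,x} v * inc num {v,x,y} {v,x} + sp num {v,y} v * inc num {v,x,y} {v,y} = (0::'f::comm_ring_1)"
proof -
  have 1: "inc num {v,x,y} {v,x} = sg num v y * (sg num x y :: 'f)" using assms by (simp add: inc_triple)
  have 2: "inc num {v,x,y} {v,y} = sg num v x * (sg num y x :: 'f)"
    using inc_triple[of v y x num] assms by (auto simp: insert_commute)
  have 3: "sp num {v,x} v = (sg num x v :: 'f)" "sp num {v,y} v = (sg num y v :: 'f)"
    using assms by (auto simp: sp_pair)
  show ?thesis unfolding 1 2 3 sg_antisym[of num y x] sg_antisym[of num x v] sg_antisym[of num y v]
    by (simp add: algebra_simps)
qed

text \<open>Each triangle cancels on its own at \<open>v\<close>, so any set \<open>A\<close> of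
  triangles through \<open>v\<close> may be taken. Later \<open>A\<close> is a whole star or a
  single fan; the latter carries coefficients from one triple edge to the next.\<close>

lemma vertex_balance:
  fixes c :: "'v set \<Rightarrow> 'f::comm_ring_1"
  assumes "finite A" "\<And>t. t \<in> A \<Longrightarrow> card t = 3 \<and> v \<in> t" "finite E" "\<And>t e. t \<in> A \<Longrightarrow> card e = 2 \<Longrightarrow> v \<in> e \<Longrightarrow> e \<subseteq> t \<Longrightarrow> e \<in> E"
     "\<And>e. e \<in> E \<Longrightarrow> card e = 2"
  shows "(\<Sum>e | e \<in> E \<and> v \<in> e. sp num e v * (\<Sum>t\<in>tri_at A e. inc num t e * c t)) = 0"
proof -
  have "(\<Sum>e | e \<in> E \<and> v \<in> e. sp num e v * (\<Sum>t\<in>tri_at A e. inc num t e * c t))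
     = (\<Sum>e | e \<in> E \<and> v \<in> e. \<Sum>t | t \<in> A \<and> e \<subseteq> t. sp num e v * inc num t e * c t)"
    by (simp add: tri_at_def sum_distrib_left mult.assoc)
  also have "\<dots> = (\<Sum>t\<in>A. \<Sum>e | e \<in> {e. e \<in> E \<and> v \<in> e} \<and> e \<subseteq> t. sp num e v * inc num t e * c t)"
    by (rule sum.swap_restrict) (use assms in auto)
  also have "\<dots> = (\<Sum>t\<in>A. 0)"
  proof (rule sum.cong[OF refl])
    fix t assume t: "t \<in> A"
    obtain x y where xy: "t = {v,x,y}" "v \<noteq> x" "x \<noteq> y" "v \<noteq> y" using triple_through assms(2)[OF t] by metis
    have "{e. e \<in> {e. e \<in> E \<and> v \<in> e} \<and> e \<subseteq> t} = {e. card e = 2 \<and> v \<in> e \<and> e \<subseteq> t}"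
      using assms(4)[OF t] assms(5) by auto
    also have "\<dots> = {{v,x},{v,y}}" unfolding xy(1) by (rule edges_through_vertex_triple) (use xy in auto)
    finally have s: "{e. e \<in> {e. e \<in> E \<and> v \<in> e} \<and> e \<subseteq> t} = {{v,x},{v,y}}" .
    have ne: "{v,x} \<noteq> {v,y}" using xy by (auto simp: doubleton_eq_iff)
    have "(\<Sum>e | e \<in> {e. e \<in> E \<and> v \<in> e} \<and> e \<subseteq> t. sp num e v * inc num t e * c t)
        = (sp num {v,x} v * inc num t {v,x} + sp num {v,y} v * inc num t {v,y}) * c t"
      unfolding s using ne by (simp add: distrib_right)
    then show "(\<Sum>e | e \<in> {e. e \<in> E \<and> v \<in> e} \<and> e \<subseteq> t. sp num e v * inc num t e * c t) = 0"
      by (simp only: xy(1) sp_inc_cancel[OF xy(2-4)] mult_zero_left)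
  qed
  finally show ?thesis by simp
qed

text \<open>Each triangle through \<open>v\<close> has exactly two edges through \<open>v\<close>.
  This is the unsigned counterpart of \<open>vertex_balance\<close>, used for parities.\<close>

lemma vertex_parity:
  assumes "finite A" "\<And>t. t \<in> A \<Longrightarrow> card t = 3 \<and> v \<in> t" "finite E" "\<And>t e. t \<in> A \<Longrightarrow> card e = 2 \<Longrightarrow> v \<in> e \<Longrightarrow> e \<subseteq> t \<Longrightarrow> e \<in> E"
     "\<And>e. e \<in> E \<Longrightarrow> card e = 2"
  shows "(\<Sum>e | e \<in> E \<and> v \<in> e. card (tri_at A e)) = 2 * card A"
proof -
  have "(\<Sum>e | e \<in> E \<and> v \<in> e. card (tri_at A e))
     = (\<Sum>e | e \<in> E \<and> v \<in> e. \<Sum>t | t \<in> A \<and> e \<subseteq> t. 1)"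
    by (simp add: tri_at_def)
  also have "\<dots> = (\<Sum>t\<in>A. \<Sum>e | e \<in> {e. e \<in> E \<and> v \<in> e} \<and> e \<subseteq> t. 1)"
    by (rule sum.swap_restrict) (use assms in auto)
  also have "\<dots> = (\<Sum>t\<in>A. 2)"
  proof (rule sum.cong[OF refl])
    fix t assume t: "t \<in> A"
    obtain x y where xy: "t = {v,x,y}" "v \<noteq> x" "x \<noteq> y" "v \<noteq> y" using triple_through assms(2)[OF t] by metis
    have "{e. e \<in> {e. e \<in> E \<and> v \<in> e} \<and> e \<subseteq> t} = {e. card e = 2 \<and> v \<in> e \<and> e \<subseteq> t}"
      using assms(4)[OF t] assms(5) by auto
    also have "\<dots> = {{v,x},{v,y}}" unfolding xy(1) by (rule edges_through_vertex_triple) (use xy in auto)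
    finally show "(\<Sum>e | e \<in> {e. e \<in> E \<and> v \<in> e} \<and> e \<subseteq> t. 1) = (2::nat)"
      using xy by (simp add: doubleton_eq_iff)
  qed
  finally show ?thesis by simp
qed

section \<open>Acyclic 2-complexes have free edges\<close>

lemma card_2_other:
  assumes "card A = 2" "a \<in> A"
  obtains b where "A = {a,b}" "b \<noteq> a"
proof -
  obtain x y where "A = {x,y}" "x \<noteq> y" using assms(1) by (auto simp: card_2_iff)
  then show thesis using assms(2) that[of x] that[of y] by (auto simp: insert_commute)
qed

text \<open>Adjacency in the dual graph. With the double edges through \<open>v\<close> for
  \<open>E\<close>, its components among the triangles at \<open>v\<close> are the pieces of the
  link of \<open>v\<close> after cutting at the triple edges: the fans below.\<close>

definition adj_across :: "'v set set \<Rightarrow> 'v set set \<Rightarrow> 'v set rel" where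
  "adj_across T E = {(t,t'). t \<in> T \<and> t' \<in> T \<and> (\<exists>e\<in>E. e \<subseteq> t \<and> e \<subseteq> t')}"

lemma sym_adj_across: "sym (adj_across T E)"
  by (auto simp: adj_across_def sym_def)

lemma adj_across_rtrancl_vertex:
  "(t,t') \<in> (adj_across T {e\<in>E. v \<in> e})\<^sup>* \<Longrightarrow> v \<in> t \<Longrightarrow> v \<in> t'"
  by (induction rule: rtrancl_induct) (auto simp: adj_across_def)

lemma equiv_rtrancl_sym:
  assumes "sym r" "\<And>x y. (x,y) \<in> r \<Longrightarrow> x \<in> A \<Longrightarrow> y \<in> A"
  shows "equiv A (r\<^sup>* \<inter> A \<times> A)"
proof (rule equivI)
  show "r\<^sup>* \<inter> A \<times> A \<subseteq> A \<times> A" by (rule Int_lower2)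
  show "refl_on A (r\<^sup>* \<inter> A \<times> A)" by (simp add: refl_on_def)
  show "sym (r\<^sup>* \<inter> A \<times> A)"
    by (rule sym_Int[OF sym_rtrancl[OF assms(1)]]) (simp add: sym_def)
  show "trans (r\<^sup>* \<inter> A \<times> A)"
    by (rule trans_Int[OF trans_rtrancl]) (simp add: trans_def)
qed

text \<open>This is what remains when a collapse gets stuck: no edge is free. The acyclicity
  of the original complex survives as the last three assumptions.\<close>

locale residual =
  fixes T :: "'v set set" and num :: "'v \<Rightarrow> nat"
  assumes finite_T: "finite T" and T_ne: "T \<noteq> {}" and card_T: "t \<in> T \<Longrightarrow> card t = 3"
    and inj_num: "inj_on num (\<Union>T)"
    and deg: "e \<in> edges_of T \<Longrightarrow> card (tri_at T e) = 2 \<or> card (tri_at T e) = 3"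
    and deg3: "card {e \<in> edges_of T. v \<in> e \<and> card (tri_at T e) = 3} \<in> {0,2}"
    and separated: "\<lbrakk>e \<in> edges_of T; card (tri_at T e) = 3; v \<in> e; t \<in> tri_at T e; t' \<in> tri_at T e;
        (t,t') \<in> (adj_across T {e \<in> edges_of T. card (tri_at T e) = 2 \<and> v \<in> e})\<^sup>*\<rbrakk> \<Longrightarrow> t = t'"
    and euler: "card (edges_of T) + 1 \<le> card (\<Union>T) + card T"
    and cycles2: "\<lbrakk>B \<subseteq> T; \<And>e. e \<in> edges_of T \<Longrightarrow> even (card (tri_at B e))\<rbrakk> \<Longrightarrow> B = {}"
    and cycles3: "\<lbrakk>\<And>e. e \<in> edges_of T \<Longrightarrow> bnd num T (c :: 'v set \<Rightarrow> 3) e = 0; t \<in> T\<rbrakk> \<Longrightarrow> c t = 0"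
begin

definition "E2 = {e \<in> edges_of T. card (tri_at T e) = 2}"
definition "E3 = {e \<in> edges_of T. card (tri_at T e) = 3}"

lemma edges_split: "edges_of T = E2 \<union> E3" "E2 \<inter> E3 = {}"
proof -
  show "edges_of T = E2 \<union> E3"
  proof
    show "edges_of T \<subseteq> E2 \<union> E3"
    proof
      fix e assume e: "e \<in> edges_of T"
      from deg[OF e] show "e \<in> E2 \<union> E3" using e by (elim disjE) (simp_all add: E2_def E3_def)
    qed
  qed (simp add: E2_def E3_def subset_iff)
  show "E2 \<inter> E3 = {}" by (simp add: E2_def E3_def disjoint_iff)
qed

lemma finite_triangle: "t \<in> T \<Longrightarrow> finite t" using card_T by (metis card.infinite zero_neq_numeral)

lemma finite_edges: "finite (edges_of T)"
proof -
  have "edges_of T \<subseteq> \<Union>(Pow ` T)" by (auto simp: edges_of_def)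
  moreover have "finite (\<Union>(Pow ` T))" using finite_T finite_triangle by auto
  ultimately show ?thesis by (rule finite_subset)
qed

lemma finite_E2: "finite E2" and finite_E3: "finite E3"
  using finite_edges by (auto simp: E2_def E3_def)

lemma finite_vertices: "finite (\<Union>T)" using finite_T finite_triangle by auto

lemma card_edge: "e \<in> edges_of T \<Longrightarrow> card e = 2" by (simp add: edges_of_def)

lemma num_neq: "x \<in> t \<Longrightarrow> y \<in> t \<Longrightarrow> t \<in> T \<Longrightarrow> x \<noteq> y \<Longrightarrow> num x \<noteq> num y"
  using inj_num by (auto simp: inj_on_def)

lemma sp_square:
  assumes "e \<in> edges_of T" "v \<in> e"
  shows "sp num e v * sp num e v = (1::'f::comm_ring_1)"
proof -
  obtain t where t: "t \<in> T" "e \<subseteq> t" using assms by (auto simp: edges_of_def)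
  obtain x where x: "e = {v,x}" "v \<noteq> x"
    using assms card_edge[of e] by (auto simp: card_2_iff insert_commute)
  show ?thesis using x t num_neq[of x t v] by (auto simp: sp_pair intro!: sg_square)
qed

definition "corner v = (adj_across T {e \<in> E2. v \<in> e})\<^sup>*"

lemma corner_sym: "(t,t') \<in> corner v \<Longrightarrow> (t',t) \<in> corner v"
  unfolding corner_def by (meson symD sym_adj_across sym_rtrancl)

lemma separated':
  "\<lbrakk>e \<in> E3; v \<in> e; t \<in> tri_at T e; t' \<in> tri_at T e; (t,t') \<in> corner v\<rbrakk> \<Longrightarrow> t = t'"
  using separated[of e v t t'] by (simp add: E3_def E2_def corner_def conj_ac)

lemma corner_closed:
  assumes "e \<in> E2" "v \<in> e" "t \<in> tri_at T e" "t' \<in> tri_at T e" "(s,t) \<in> corner v"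
  shows "(s,t') \<in> corner v"
proof -
  have "(t,t') \<in> adj_across T {e \<in> E2. v \<in> e}"
    using assms by (auto simp: adj_across_def tri_at_def)
  then show ?thesis using assms(5) unfolding corner_def by simp
qed

definition "fan v t = {t'\<in>T. (t,t') \<in> corner v}"

lemma fan_in: "t \<in> T \<Longrightarrow> v \<in> t \<Longrightarrow> t' \<in> fan v t \<Longrightarrow> t' \<in> T \<and> v \<in> t'"
  using adj_across_rtrancl_vertex by (auto simp: fan_def corner_def)

text \<open>Each of the two triple edges at a vertex meets a fan at most once, so by parity a fan which
  meets one of them also meets the other.\<close>

lemma fan_two_flags:
  assumes "e \<in> E3" "v \<in> e" "t \<in> tri_at T e"
  obtains e' t' where "e' \<in> E3" "v \<in> e'" "e' \<noteq> e" "t' \<in> tri_at T e'" "(t,t') \<in> corner v"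
    "{e\<in>E3. v \<in> e} = {e,e'}" "tri_at (fan v t) e = {t}" "tri_at (fan v t) e' = {t'}"
proof -
  have t: "t \<in> T" "v \<in> t" using assms by (auto simp: tri_at_def)
  have "{e\<in>E3. v \<in> e} = {e \<in> edges_of T. v \<in> e \<and> card (tri_at T e) = 3}"
    by (auto simp: E3_def)
  moreover have "card {e\<in>E3. v \<in> e} \<noteq> 0" using assms finite_E3 by auto
  ultimately have "card {e\<in>E3. v \<in> e} = 2" using deg3[of v] by auto
  moreover have "e \<in> {e\<in>E3. v \<in> e}" using assms by simp
  ultimately obtain e' where e': "{e\<in>E3. v \<in> e} = {e,e'}" "e' \<noteq> e"
    by (rule card_2_other)
  have e'3: "e' \<in> E3" "v \<in> e'" using e' by auto
  let ?A = "fan v t"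
  have finA: "finite ?A" using finite_T by (auto simp: fan_def)
  have even0: "even (\<Sum>e | e \<in> edges_of T \<and> v \<in> e. card (tri_at ?A e))"
  proof -
    have "(\<Sum>e | e \<in> edges_of T \<and> v \<in> e. card (tri_at ?A e)) = 2 * card ?A"
    proof (rule vertex_parity[OF finA _ finite_edges])
      show "card s = 3 \<and> v \<in> s" if "s \<in> ?A" for s using fan_in[OF t that] card_T by blast
      show "e \<in> edges_of T" if "s \<in> ?A" "card e = 2" "v \<in> e" "e \<subseteq> s" for s e
        using fan_in[OF t that(1)] that by (auto simp: edges_of_def)
    qed (rule card_edge)
    then show ?thesis by simp
  qed
  \<comment> \<open>A double edge has both of its triangles in the fan or neither.\<close>
  have E2: "even (card (tri_at ?A e))" if "e \<in> E2" "v \<in> e" for e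
  proof (cases "tri_at ?A e = {}")
    case False
    then obtain s where s: "s \<in> ?A" "e \<subseteq> s" by (auto simp: tri_at_def)
    have "tri_at ?A e = tri_at T e"
      using corner_closed[OF that(1,2), of s] s by (auto simp: fan_def tri_at_def)
    then show ?thesis using that by (simp add: E2_def)
  qed auto
  have "{e. e \<in> edges_of T \<and> v \<in> e} = {e. e \<in> E2 \<and> v \<in> e} \<union> {e,e'}"
  proof -
    have "x \<in> E3 \<and> v \<in> x \<longleftrightarrow> x = e \<or> x = e'" for x using e'(1) by blast
    then show ?thesis unfolding edges_split(1) by blast
  qed
  moreover have "{e. e \<in> E2 \<and> v \<in> e} \<inter> {e,e'} = {}" using assms(1) e'3 edges_split(2) by blast
  ultimately have "(\<Sum>e | e \<in> edges_of T \<and> v \<in> e. card (tri_at ?A e)) =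
      (\<Sum>e | e \<in> E2 \<and> v \<in> e. card (tri_at ?A e)) + (card (tri_at ?A e) + card (tri_at ?A e'))"
    using finite_E2 e'(2) by (simp add: sum.union_disjoint)
  moreover have "even (\<Sum>e | e \<in> E2 \<and> v \<in> e. card (tri_at ?A e))"
    using E2 by (auto intro: dvd_sum)
  ultimately have ev: "even (card (tri_at ?A e) + card (tri_at ?A e'))" using even0 by simp
  have uni: "s = s'" if "e \<in> E3" "v \<in> e" "s \<in> tri_at ?A e" "s' \<in> tri_at ?A e" for e s s'
  proof (rule separated'[OF that(1,2)])
    have "(s,t) \<in> corner v" "(t,s') \<in> corner v" using that corner_sym by (auto simp: tri_at_def fan_def)
    then show "(s,s') \<in> corner v" unfolding corner_def by simp
  qed (use that in \<open>auto simp: tri_at_def fan_def\<close>)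
  have tA: "t \<in> ?A" using t by (auto simp: fan_def corner_def)
  have e1: "tri_at ?A e = {t}" using uni[OF assms(1,2)] assms(3) tA by (auto simp: tri_at_def)
  then have "odd (card (tri_at ?A e'))" using ev by simp
  then have "tri_at ?A e' \<noteq> {}" by auto
  then obtain t' where t': "t' \<in> tri_at ?A e'" by blast
  then have e2: "tri_at ?A e' = {t'}" using uni[OF e'3] by blast
  show thesis
  proof (rule that[of e' t'])
    show "t' \<in> tri_at T e'" "(t,t') \<in> corner v" using t' by (auto simp: fan_def tri_at_def)
  qed (fact e' e'3 e1 e2)+
qed

lemma other_E3:
  assumes "e \<in> E3" "v \<in> e" "e' \<in> E3" "v \<in> e'" "e' \<noteq> e"
  shows "{e\<in>E3. v \<in> e} = {e,e'}"
proof -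
  have "tri_at T e \<noteq> {}" using assms by (auto simp: E3_def)
  then obtain t where "t \<in> tri_at T e" by blast
  from fan_two_flags[OF assms(1,2) this] show ?thesis using assms by (metis (no_types, lifting) insertE mem_Collect_eq singletonD)
qed

section \<open>Circles, ends and sheets\<close>

definition "flags = {(e,t). e \<in> E3 \<and> t \<in> tri_at T e}"

text \<open>A flag is one flap along one triple edge. A step follows the flap past the vertex
  \<open>v\<close> through its fan, so the classes of \<open>flag_rel\<close> are the ends.\<close>

definition "flag_step = {((e,t),(e',t')). (e,t) \<in> flags \<and> (e',t') \<in> flags \<and> (\<exists>v. v \<in> e \<and> v \<in> e' \<and> (t,t') \<in> corner v)}"

definition "flag_rel = flag_step\<^sup>* \<inter> flags \<times> flags"

definition "edge_step = {(e,e'). e \<in> E3 \<and> e' \<in> E3 \<and> e \<inter> e' \<noteq> {}}"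

definition "edge_rel = edge_step\<^sup>* \<inter> E3 \<times> E3"

definition "tri_rel = (adj_across T E2)\<^sup>* \<inter> T \<times> T"

lemma equiv_flag_rel: "equiv flags flag_rel"
  unfolding flag_rel_def
proof (rule equiv_rtrancl_sym)
  show "sym flag_step" unfolding flag_step_def sym_def using corner_sym by blast
qed (auto simp: flag_step_def)

lemma equiv_edge_rel: "equiv E3 edge_rel"
  unfolding edge_rel_def
  by (rule equiv_rtrancl_sym) (auto simp: edge_step_def sym_def)

lemma equiv_tri_rel: "equiv T tri_rel"
  unfolding tri_rel_def
  by (rule equiv_rtrancl_sym) (auto simp: adj_across_def sym_def)

lemma finite_flags: "finite flags"
proof -
  have "flags \<subseteq> E3 \<times> T" by (auto simp: flags_def tri_at_def)
  then show ?thesis using finite_E3 finite_T by (auto intro: finite_subset)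
qed

abbreviation "circles \<equiv> E3 // edge_rel"
abbreviation "ends \<equiv> flags // flag_rel"
abbreviation "sheets \<equiv> T // tri_rel"

lemma finite_circles: "finite circles" and finite_ends: "finite ends" and finite_sheets: "finite sheets"
  using finite_E3 finite_T finite_flags finite_quotient equiv_edge_rel equiv_flag_rel equiv_tri_rel
  by (metis equiv_type)+

definition rep :: "'x set \<Rightarrow> 'x" where "rep C = (SOME x. x \<in> C)"

lemma rep_in: "equiv A r \<Longrightarrow> C \<in> A // r \<Longrightarrow> rep C \<in> C"
  unfolding rep_def by (metis equiv_Eps_in)

lemma circle_induct:
  assumes "C \<in> circles" "P (rep C)" "e \<in> C"
    and step: "\<And>e e' v. \<lbrakk>e \<in> E3; e' \<in> E3; v \<in> e; v \<in> e'; P e\<rbrakk> \<Longrightarrow> P e'"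
  shows "P e"
proof -
  have "(rep C, e) \<in> edge_rel"
    using assms rep_in[OF equiv_edge_rel assms(1)] equiv_edge_rel by (metis quotient_eq_iff)
  then have "(rep C, e) \<in> edge_step\<^sup>*" by (simp add: edge_rel_def)
  then show "P e" using assms(2)
    by (induction rule: rtrancl_induct) (use step in \<open>auto simp: edge_step_def\<close>)
qed

lemma circle_subset: "C \<in> circles \<Longrightarrow> C \<subseteq> E3"
  using equiv_edge_rel Union_quotient by (metis Union_upper)

lemma E3_circle: "e \<in> E3 \<Longrightarrow> \<exists>C\<in>circles. e \<in> C"
  using equiv_edge_rel Union_quotient by (metis UnionE)

end

section \<open>The bound modulo 2: no more sheets than circles\<close>

lemma card_sym_diff_parity:
  assumes "finite A" "finite B"
  shows "even (card ((A - B) \<union> (B - A))) \<longleftrightarrow> even (card A + card B)"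
proof -
  have "card ((A - B) \<union> (B - A)) = card (A - B) + card (B - A)"
    by (rule card_Un_disjoint) (use assms in auto)
  moreover have "card A = card (A - B) + card (A \<inter> B)"
    by (metis add.commute assms(1) card_Int_Diff)
  moreover have "card B = card (B - A) + card (A \<inter> B)"
    by (metis add.commute assms(2) card_Int_Diff inf_commute)
  ultimately show ?thesis by presburger
qed

context residual begin

text \<open>Modulo 2 the boundary of \<open>B\<close> is a 1-cycle supported on the triple edges. At
  most two of these pass through \<open>v\<close>, so it takes the same value on both.\<close>

lemma parity_step:
  assumes B: "B \<subseteq> T" "\<And>e. e \<in> E2 \<Longrightarrow> even (card (tri_at B e))"
    and e: "e \<in> E3" "e' \<in> E3" "v \<in> e" "v \<in> e'" "even (card (tri_at B e))"
  shows "even (card (tri_at B e'))"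
proof (cases "e' = e")
  case False
  have E3v: "x \<in> E3 \<and> v \<in> x \<longleftrightarrow> x = e \<or> x = e'" for x
    using other_E3[OF e(1,3,2,4) False] by blast
  let ?A = "{t\<in>B. v \<in> t}"
  have finA: "finite ?A" using finite_T B(1) by (auto intro: finite_subset)
  have "(\<Sum>x | x \<in> edges_of T \<and> v \<in> x. card (tri_at ?A x)) = 2 * card ?A"
  proof (rule vertex_parity[OF finA _ finite_edges])
    show "x \<in> edges_of T" if "s \<in> ?A" "card x = 2" "v \<in> x" "x \<subseteq> s" for s x
      using B(1) that by (auto simp: edges_of_def)
  qed (use B(1) card_T card_edge in auto)
  moreover have "tri_at ?A x = tri_at B x" if "v \<in> x" for x using that by (auto simp: tri_at_def)
  ultimately have "even (\<Sum>x | x \<in> edges_of T \<and> v \<in> x. card (tri_at B x))" by simp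
  moreover have "{x. x \<in> edges_of T \<and> v \<in> x} = {x. x \<in> E2 \<and> v \<in> x} \<union> {e,e'}"
    unfolding edges_split(1) using E3v by blast
  moreover have "{x. x \<in> E2 \<and> v \<in> x} \<inter> {e,e'} = {}" using e edges_split(2) by blast
  ultimately have "even ((\<Sum>x | x \<in> E2 \<and> v \<in> x. card (tri_at B x)) + (card (tri_at B e) + card (tri_at B e')))"
    using finite_E2 False by (auto simp: sum.union_disjoint)
  moreover have "even (\<Sum>x | x \<in> E2 \<and> v \<in> x. card (tri_at B x))"
    using B(2) by (auto intro: dvd_sum)
  ultimately show ?thesis using e(5) by simp
qed (use e in simp)

text \<open>Both triangles at a double edge belong to the same sheet, so the boundary of a union of
  sheets lives on the triple edges.\<close>

lemma sheets_closed:
  assumes "\<U> \<subseteq> sheets" "e \<in> E2"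
  shows "even (card (tri_at (\<Union>\<U>) e))"
proof (cases "tri_at (\<Union>\<U>) e = {}")
  case False
  then obtain C s where s: "C \<in> \<U>" "s \<in> C" "e \<subseteq> s" by (auto simp: tri_at_def)
  have C: "C \<in> sheets" using s assms by auto
  have sT: "s \<in> T" using C s(2) equiv_tri_rel by (metis Union_iff Union_quotient)
  have "t \<in> C" if "t \<in> T" "e \<subseteq> t" for t
  proof -
    have "(s,t) \<in> adj_across T E2" using assms(2) s sT that by (auto simp: adj_across_def)
    then have "(s,t) \<in> tri_rel" using sT that by (auto simp: tri_rel_def)
    then show ?thesis using C s(2) equiv_tri_rel by (metis in_quotient_imp_closed)
  qed
  then have "tri_at T e \<subseteq> tri_at (\<Union>\<U>) e" using s by (auto simp: tri_at_def)
  moreover have "\<Union>\<U> \<subseteq> T" using assms equiv_tri_rel by (metis Sup_subset_mono Union_quotient)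
  then have "tri_at (\<Union>\<U>) e \<subseteq> tri_at T e" by (auto simp: tri_at_def)
  ultimately have "tri_at (\<Union>\<U>) e = tri_at T e" by simp
  then show ?thesis using assms(2) by (simp add: E2_def)
qed simp

text \<open>The boundary modulo 2 of a union of sheets is constant along each circle. With more
  sheets than circles, two different families of sheets would have the same boundary by the
  pigeonhole principle, and their symmetric difference would be a nonempty 2-cycle modulo 2.\<close>

lemma card_sheets_le: "card sheets \<le> card circles"
proof (rule ccontr)
  assume less: "\<not> card sheets \<le> card circles"
  define odd_at where "odd_at \<U> = {C\<in>circles. odd (card (tri_at (\<Union>\<U>) (rep C)))}" for \<U>
  have "\<not> inj_on odd_at (Pow sheets)"
  proof
    assume "inj_on odd_at (Pow sheets)"
    moreover have "odd_at ` Pow sheets \<subseteq> Pow circles" by (auto simp: odd_at_def)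
    ultimately have "card (Pow sheets) \<le> card (Pow circles)"
      using finite_circles by (meson card_inj_on_le finite_Pow_iff)
    then show False using less by (simp add: card_Pow finite_sheets finite_circles)
  qed
  then obtain \<U> \<V> where UV: "\<U> \<subseteq> sheets" "\<V> \<subseteq> sheets" "\<U> \<noteq> \<V>" "odd_at \<U> = odd_at \<V>"
    by (auto simp: inj_on_def)
  define \<D> where "\<D> = (\<U> - \<V>) \<union> (\<V> - \<U>)"
  have D: "\<D> \<subseteq> sheets" "\<D> \<noteq> {}" using UV by (auto simp: \<D>_def)
  have disj: "C = C'" if "C \<in> sheets" "C' \<in> sheets" "t \<in> C" "t \<in> C'" for C C' t
    using quotient_disj[OF equiv_tri_rel that(1,2)] that(3,4) by blast
  have UD: "tri_at (\<Union>\<D>) e = (tri_at (\<Union>\<U>) e - tri_at (\<Union>\<V>) e) \<union> (tri_at (\<Union>\<V>) e - tri_at (\<Union>\<U>) e)" for e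
  proof
    show "tri_at (\<Union>\<D>) e \<subseteq> (tri_at (\<Union>\<U>) e - tri_at (\<Union>\<V>) e) \<union> (tri_at (\<Union>\<V>) e - tri_at (\<Union>\<U>) e)"
    proof
      fix t assume "t \<in> tri_at (\<Union>\<D>) e"
      then obtain C where C: "t \<in> C" "C \<in> \<D>" "e \<subseteq> t" by (auto simp: tri_at_def)
      then have "C \<in> \<U> \<and> t \<notin> \<Union>\<V> \<or> C \<in> \<V> \<and> t \<notin> \<Union>\<U>"
        using disj UV(1,2) unfolding \<D>_def by blast
      then show "t \<in> (tri_at (\<Union>\<U>) e - tri_at (\<Union>\<V>) e) \<union> (tri_at (\<Union>\<V>) e - tri_at (\<Union>\<U>) e)"
        using C by (auto simp: tri_at_def)
    qed
  qed (auto simp: tri_at_def \<D>_def)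
  have sub: "\<Union>\<D> \<subseteq> T" "\<Union>\<U> \<subseteq> T" "\<Union>\<V> \<subseteq> T"
    using D UV equiv_tri_rel by (metis Sup_subset_mono Union_quotient)+
  have fin: "finite (tri_at (\<Union>\<U>) e)" "finite (tri_at (\<Union>\<V>) e)" for e
    using finite_subset[OF sub(2) finite_T] finite_subset[OF sub(3) finite_T]
    by (simp_all add: tri_at_def del: Union_iff)
  have "\<Union>\<D> = {}"
  proof (rule cycles2[OF sub(1)])
    fix e assume "e \<in> edges_of T"
    then consider "e \<in> E2" | "e \<in> E3" using edges_split by blast
    then show "even (card (tri_at (\<Union>\<D>) e))"
    proof cases
      case 1
      then show ?thesis using sheets_closed D by blast
    next
      case 2
      then obtain C where C: "C \<in> circles" "e \<in> C" using E3_circle by blast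
      have "even (card (tri_at (\<Union>\<D>) (rep C)))"
        unfolding UD card_sym_diff_parity[OF fin] using UV(4) C(1) by (auto simp: odd_at_def)
      then show ?thesis
      proof (rule circle_induct[OF C(1) _ C(2)])
        show "even (card (tri_at (\<Union>\<D>) e'))"
          if "e \<in> E3" "e' \<in> E3" "v \<in> e" "v \<in> e'" "even (card (tri_at (\<Union>\<D>) e))" for e e' v
          by (rule parity_step[OF sub(1) _ that]) (rule sheets_closed[OF D(1)])
      qed
    qed
  qed
  moreover have "{} \<notin> sheets" using equiv_tri_rel by (metis in_quotient_imp_non_empty)
  moreover obtain C where "C \<in> \<D>" using D(2) by (meson ex_in_conv)
  ultimately show False using D(1) by (metis Union_empty_conv subsetD)
qed

section \<open>Counting ends, and the bound modulo 3 on relative cycles\<close>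

definition "good = {C\<in>circles. \<exists>e t e' t'. e \<in> C \<and> e' \<in> C \<and> (e,t) \<in> flags \<and> (e',t') \<in> flags \<and> ((e,t),(e',t')) \<notin> flag_rel}"

lemma flag_rel_circle: "((e,t),(e',t')) \<in> flag_rel \<Longrightarrow> (e,e') \<in> edge_rel"
proof -
  assume "((e,t),(e',t')) \<in> flag_rel"
  then have st: "((e,t),(e',t')) \<in> flag_step\<^sup>*" and fl: "(e,t) \<in> flags" "(e',t') \<in> flags"
    by (auto simp: flag_rel_def)
  have "(fst x, fst y) \<in> edge_step\<^sup>*" if "(x,y) \<in> flag_step\<^sup>*" for x y
    using that
  proof (induction rule: rtrancl_induct)
    case (step y z)
    then have "(fst y, fst z) \<in> edge_step" by (auto simp: flag_step_def edge_step_def flags_def)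
    then show ?case using step by simp
  qed simp
  from this[OF st] fl show ?thesis by (auto simp: edge_rel_def flags_def)
qed

lemma card_ends_ge: "card circles + card good \<le> card ends"
proof -
  \<comment> \<open>The ends that lie over the circle \<open>C\<close>: at least one for each
    circle, at least two for a circle in \<open>good\<close>.\<close>
  define fib where "fib C = {F\<in>ends. fst ` F \<subseteq> C}" for C
  have gc: "good \<subseteq> circles" by (auto simp: good_def)
  have nonempty: "\<exists>e t. (e,t) \<in> flags \<and> e \<in> C" if "C \<in> circles" for C
  proof -
    have r: "rep C \<in> C" using rep_in[OF equiv_edge_rel that] .
    then have "rep C \<in> E3" using circle_subset that by blast
    then have "tri_at T (rep C) \<noteq> {}" by (auto simp: E3_def)
    then show ?thesis using r \<open>rep C \<in> E3\<close> by (auto simp: flags_def)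
  qed
  have infib: "flag_rel `` {(e,t)} \<in> fib C" if "C \<in> circles" "(e,t) \<in> flags" "e \<in> C" for C e t
  proof -
    have "e' \<in> C" if "(e',t') \<in> flag_rel `` {(e,t)}" for e' t'
      using flag_rel_circle[of e t e' t'] that \<open>e \<in> C\<close> \<open>C \<in> circles\<close> equiv_edge_rel
      by (metis Image_singleton_iff in_quotient_imp_closed)
    then show ?thesis using that by (auto simp: fib_def quotientI)
  qed
  have fin: "finite (fib C)" for C using finite_ends by (auto simp: fib_def)
  have ge1: "card (fib C) \<ge> 1" if "C \<in> circles" for C
    using nonempty[OF that] infib[OF that] fin by (metis One_nat_def Suc_leI card_gt_0_iff empty_iff)
  have ge2: "card (fib C) \<ge> 2" if "C \<in> good" for C
  proof -
    from that obtain e t e' t' where *: "C \<in> circles" "e \<in> C" "e' \<in> C" "(e,t) \<in> flags" "(e',t') \<in> flags" "((e,t),(e',t')) \<notin> flag_rel"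
      by (auto simp: good_def)
    have "flag_rel `` {(e,t)} \<noteq> flag_rel `` {(e',t')}"
      using * equiv_flag_rel by (metis eq_equiv_class_iff)
    moreover have "{flag_rel `` {(e,t)}, flag_rel `` {(e',t')}} \<subseteq> fib C" using infib * by blast
    ultimately show ?thesis using fin[of C] by (metis card_2_iff card_mono)
  qed
  have disjf: "fib C \<inter> fib C' = {}" if "C \<in> circles" "C' \<in> circles" "C \<noteq> C'" for C C'
  proof -
    have "C \<inter> C' = {}" using that quotient_disj[OF equiv_edge_rel] by blast
    moreover have "F \<noteq> {}" if "F \<in> ends" for F using that equiv_flag_rel by (metis in_quotient_imp_non_empty)
    moreover have "fst ` F \<subseteq> C \<inter> C'" if "F \<in> fib C" "F \<in> fib C'" for F using that by (simp add: fib_def)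
    ultimately have "False" if "F \<in> fib C" "F \<in> fib C'" for F
      using that by (metis (no_types, lifting) fib_def image_is_empty mem_Collect_eq subset_empty)
    then show ?thesis by blast
  qed
  have "card circles + card good = (\<Sum>C\<in>circles. 1 + (if C \<in> good then 1 else 0))"
    unfolding sum.distrib using gc finite_circles by (simp add: sum.If_cases Int_absorb1)
  also have "\<dots> \<le> (\<Sum>C\<in>circles. card (fib C))"
  proof (rule sum_mono)
    fix C assume "C \<in> circles"
    then show "1 + (if C \<in> good then 1 else 0) \<le> card (fib C)"
      using ge1[of C] ge2[of C] by (cases "C \<in> good") simp_all
  qed
  also have "\<dots> = card (\<Union>C\<in>circles. fib C)"
    by (rule card_UN_disjoint[symmetric]) (use finite_circles fin disjf in auto)
  also have "\<dots> \<le> card ends" by (rule card_mono) (use finite_ends in \<open>auto simp: fib_def\<close>)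
  finally show ?thesis .
qed

text \<open>The 2-chains modulo 3 with boundary on the triple edges; these are the 2-cycles of the
  cut surface once its ends have become points.\<close>

definition "rel_cycles = {c :: 'v set \<Rightarrow> 3. c \<in> supp_funs T \<and> (\<forall>e\<in>E2. bnd num T c e = 0)}"

text \<open>The condition on \<open>A\<close> at a double edge is that \<open>A\<close> contains
  both of its triangles or neither. Such edges then drop out of the balance at \<open>v\<close>, and
  only the two triple edges remain. The star of \<open>v\<close> and a single fan both
  qualify.\<close>

lemma bnd_balance:
  fixes c :: "'v set \<Rightarrow> 3"
  assumes c: "c \<in> rel_cycles" and e: "e \<in> E3" "e' \<in> E3" "v \<in> e" "v \<in> e'" "e' \<noteq> e"
    and A: "A \<subseteq> T" "\<And>t. t \<in> A \<Longrightarrow> v \<in> t" "\<And>x. x \<in> E2 \<Longrightarrow> v \<in> x \<Longrightarrow> tri_at A x = {} \<or> tri_at A x = tri_at T x"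
  shows "sp num e v * (\<Sum>t\<in>tri_at A e. inc num t e * c t) + sp num e' v * (\<Sum>t\<in>tri_at A e'. inc num t e' * c t) = 0"
proof -
  have E3v: "x \<in> E3 \<and> v \<in> x \<longleftrightarrow> x = e \<or> x = e'" for x
    using other_E3[OF e(1,3,2,4,5)] by blast
  have finA: "finite A" using finite_T A(1) by (auto intro: finite_subset)
  let ?f = "\<lambda>x. sp num x v * (\<Sum>t\<in>tri_at A x. inc num t x * c t)"
  have "(\<Sum>x | x \<in> edges_of T \<and> v \<in> x. ?f x) = 0"
  proof (rule vertex_balance[OF finA _ finite_edges])
    show "x \<in> edges_of T" if "s \<in> A" "card x = 2" "v \<in> x" "x \<subseteq> s" for s x
      using A(1) that by (auto simp: edges_of_def)
  qed (use A card_T card_edge in auto)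
  moreover have "{x. x \<in> edges_of T \<and> v \<in> x} = {x. x \<in> E2 \<and> v \<in> x} \<union> {e,e'}"
    unfolding edges_split(1) using E3v by blast
  moreover have "{x. x \<in> E2 \<and> v \<in> x} \<inter> {e,e'} = {}" using e edges_split(2) by blast
  ultimately have "(\<Sum>x | x \<in> E2 \<and> v \<in> x. ?f x) + (?f e + ?f e') = 0"
    using finite_E2 e(5) by (simp add: sum.union_disjoint ac_simps)
  moreover have "(\<Sum>x | x \<in> E2 \<and> v \<in> x. ?f x) = 0"
  proof (rule sum.neutral, clarify)
    fix x assume x: "x \<in> E2" "v \<in> x"
    have "bnd num T c x = 0" using c x by (auto simp: rel_cycles_def)
    then have "(\<Sum>t\<in>tri_at A x. inc num t x * c t) = 0"
      using A(3)[OF x] by (auto simp: bnd_def)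
    then show "?f x = 0" by simp
  qed
  ultimately show ?thesis by simp
qed

lemma bnd_step:
  assumes "c \<in> rel_cycles" "e \<in> E3" "e' \<in> E3" "v \<in> e" "v \<in> e'" "e' \<noteq> e"
  shows "sp num e v * bnd num T c e + sp num e' v * bnd num T c e' = 0"
proof -
  have *: "tri_at {t\<in>T. v \<in> t} x = tri_at T x" if "v \<in> x" for x using that by (auto simp: tri_at_def)
  have "sp num e v * (\<Sum>t\<in>tri_at {t\<in>T. v \<in> t} e. inc num t e * c t)
      + sp num e' v * (\<Sum>t\<in>tri_at {t\<in>T. v \<in> t} e'. inc num t e' * c t) = 0"
    by (rule bnd_balance[OF assms]) (simp_all add: *)
  then show ?thesis unfolding bnd_def *[OF assms(4)] *[OF assms(5)] .
qed

lemma bnd_step_zero: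
  assumes "c \<in> rel_cycles" "e \<in> E3" "e' \<in> E3" "v \<in> e" "v \<in> e'" "bnd num T c e = 0"
  shows "bnd num T c e' = 0"
proof (cases "e' = e")
  case False
  have "sp num e' v * bnd num T c e' = 0"
    using bnd_step[OF assms(1-5) False] assms(6) by simp
  then have "(sp num e' v * sp num e' v) * bnd num T c e' = 0" by (simp add: mult.assoc)
  moreover have "e' \<in> edges_of T" using assms(3) edges_split by blast
  ultimately show ?thesis using sp_square[of e' v, where 'f=3] assms(5) by (metis mult_1)
qed (use assms in simp)

text \<open>If the boundary of \<open>c\<close> does not vanish on a circle then it orients the circle, and \<open>flag_val\<close>
  compares this orientation with the one induced by a triangle. It is constant along the
  ends of sheets.\<close>

definition "flag_val c = (\<lambda>(e,t). bnd num T c e * (inc num t e * (c t :: 3)))"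

text \<open>Past the vertex \<open>v\<close>, the coefficient of the flap and the total boundary
  coefficient change by the same sign. The sign enters the product twice and disappears.\<close>

lemma flag_val_step:
  assumes c: "c \<in> rel_cycles" and "((e,t),(e',t')) \<in> flag_step"
  shows "flag_val c (e,t) = flag_val c (e',t')"
proof -
  obtain v where v: "e \<in> E3" "e' \<in> E3" "t \<in> tri_at T e" "t' \<in> tri_at T e'" "v \<in> e" "v \<in> e'" "(t,t') \<in> corner v"
    using assms(2) by (auto simp: flag_step_def flags_def)
  show ?thesis
  proof (cases "e' = e")
    case True
    \<comment> \<open>If the edge stays the same, separation at the triple edge excludes two
      different flaps of one fan.\<close>
    then have "t = t'" using separated'[OF v(1,5,3)] v by blast
    with True show ?thesis by simp
  next
    case False
    obtain e'' t'' where *: "e'' \<in> E3" "v \<in> e''" "e'' \<noteq> e" "t'' \<in> tri_at T e''" "(t,t'') \<in> corner v"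
      "{e\<in>E3. v \<in> e} = {e,e''}" "tri_at (fan v t) e = {t}" "tri_at (fan v t) e'' = {t''}"
      by (rule fan_two_flags[OF v(1,5,3)])
    have "e' \<in> {e,e''}" using v unfolding *(6)[symmetric] by simp
    then have e'': "e'' = e'" using False by simp
    have "(t',t'') \<in> corner v" using v(7) *(5) corner_sym unfolding corner_def by (meson rtrancl_trans)
    then have t'': "t'' = t'" using separated'[OF v(2,6,4)] * e'' by blast
    have tT: "t \<in> T" "v \<in> t" using v by (auto simp: tri_at_def)
    have "sp num e v * (inc num t e * c t) + sp num e' v * (inc num t' e' * c t') = 0"
    proof -
      have "tri_at (fan v t) x = {} \<or> tri_at (fan v t) x = tri_at T x" if "x \<in> E2" "v \<in> x" for x
      proof (cases "tri_at (fan v t) x = {}")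
        case False
        then obtain s where "s \<in> fan v t" "x \<subseteq> s" by (auto simp: tri_at_def)
        then have "tri_at (fan v t) x = tri_at T x"
          using corner_closed[OF that, of s] by (auto simp: fan_def tri_at_def)
        then show ?thesis ..
      qed simp
      then show ?thesis
        using bnd_balance[OF c v(1,2,5,6) False, of "fan v t"] fan_in[OF tT] *(7) *(8)[unfolded e'' t'']
        by (simp add: subset_iff)
    qed
    moreover have "sp num e v * bnd num T c e + sp num e' v * bnd num T c e' = 0"
      using bnd_step[OF c v(1,2,5,6) False] .
    \<comment> \<open>Both balances have the form x = - y; they are multiplied.\<close>
    ultimately have "(sp num e v * bnd num T c e) * (sp num e v * (inc num t e * c t)) =
        (sp num e' v * bnd num T c e') * (sp num e' v * (inc num t' e' * c t'))"
      by (metis add_eq_0_iff minus_mult_minus)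
    then have "(sp num e v * sp num e v) * (bnd num T c e * (inc num t e * c t)) =
        (sp num e' v * sp num e' v) * (bnd num T c e' * (inc num t' e' * c t'))"
      by (simp add: ac_simps)
    moreover have "e \<in> edges_of T" "e' \<in> edges_of T" using v edges_split by blast+
    ultimately show ?thesis using sp_square[of e v, where 'f=3] sp_square[of e' v, where 'f=3] v(5,6)
      by (simp add: flag_val_def)
  qed
qed

lemma flag_val_const:
  assumes "c \<in> rel_cycles" "(x,y) \<in> flag_rel"
  shows "flag_val c x = flag_val c y"
proof -
  have "(x,y) \<in> flag_step\<^sup>*" using assms(2) by (simp add: flag_rel_def)
  then show ?thesis
    by (induction rule: rtrancl_induct) (use flag_val_step[OF assms(1)] in auto)
qed

text \<open>A chain is determined by its boundary, and the boundary on a circle by its value at one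
  edge. On a circle outside \<open>good\<close> all flags have the same \<open>flag_val\<close>, so
  the square of the boundary coefficient is a sum of three equal values, hence 0.\<close>

lemma card_rel_cycles_le: "card rel_cycles \<le> 3 ^ card good"
proof -
  define F where "F c = (\<lambda>C. if C \<in> good then bnd num T c (rep C) else 0)" for c :: "'v set \<Rightarrow> 3"
  have bnd_diff: "bnd num T (c - d) e = bnd num T c e - bnd num T d e" for c d :: "'v set \<Rightarrow> 3" and e
    by (simp add: bnd_def algebra_simps sum_subtractf)
  have "inj_on F rel_cycles"
  proof (rule inj_onI)
    fix c d assume cd: "c \<in> rel_cycles" "d \<in> rel_cycles" "F c = F d"
    let ?b = "c - d"
    have b: "?b \<in> rel_cycles" using cd by (auto simp: rel_cycles_def supp_funs_def bnd_diff)
    have z: "bnd num T ?b (rep C) = 0" if "C \<in> good" for C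
      using fun_cong[OF cd(3), of C] that by (simp add: F_def bnd_diff)
    have "bnd num T ?b e = 0" if "e \<in> edges_of T" for e
    proof (cases "e \<in> E2")
      case True then show ?thesis using b by (auto simp: rel_cycles_def)
    next
      case False
      then have e: "e \<in> E3" using that edges_split by blast
      then obtain C where C: "C \<in> circles" "e \<in> C" using E3_circle by blast
      show ?thesis
      proof (cases "C \<in> good")
        case True
        show ?thesis
          by (rule circle_induct[where P = "\<lambda>e. bnd num T ?b e = 0", OF C(1) z[OF True] C(2)])
             (rule bnd_step_zero[OF b])
      next
        case False
        have tri: "card (tri_at T e) = 3" using e by (simp add: E3_def)
        then have "tri_at T e \<noteq> {}" by auto
        then obtain t0 where t0: "t0 \<in> tri_at T e" by blast
        have "flag_val ?b (e,t) = flag_val ?b (e,t0)" if "t \<in> tri_at T e" for t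
        proof (rule flag_val_const[OF b])
          show "((e,t),(e,t0)) \<in> flag_rel"
            using False C that t0 e unfolding good_def flags_def by blast
        qed
        then have "(\<Sum>t\<in>tri_at T e. flag_val ?b (e,t)) = (\<Sum>t\<in>tri_at T e. flag_val ?b (e,t0))"
          by (rule sum.cong[OF refl])
        also have "\<dots> = 0" by (simp add: tri triple_eq_0_mod_3)
        also have "(\<Sum>t\<in>tri_at T e. flag_val ?b (e,t)) = bnd num T ?b e * bnd num T ?b e"
          by (simp add: flag_val_def bnd_def[of num T ?b e] sum_distrib_left)
        finally show ?thesis by (rule square_eq_0_mod_3)
      qed
    qed
    then have "?b t = 0" if "t \<in> T" for t using cycles3 that by blast
    moreover have "?b t = 0" if "t \<notin> T" for t using b that by (auto simp: rel_cycles_def supp_funs_def)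
    ultimately have "?b = 0" by (auto simp: fun_eq_iff)
    then show "c = d" by simp
  qed
  moreover have "F ` rel_cycles \<subseteq> supp_funs good" by (auto simp: F_def supp_funs_def)
  moreover have fg: "finite good" using finite_circles by (auto simp: good_def)
  ultimately have "card rel_cycles \<le> card (supp_funs good :: ('v set set \<Rightarrow> 3) set)"
    by (intro card_inj_on_le) (auto intro: finite_supp_funs)
  then show ?thesis using fg by (simp add: card_supp_funs)
qed

end

section \<open>The cut surface and its Euler characteristic\<close>

context residual begin

text \<open>The vertices of the surface obtained by cutting along the triple edges, with each
  boundary circle and each end collapsed to a single point: \<open>cut_vertex t v\<close> is the one at the corner \<open>v\<close> of \<open>t\<close>,
  as an indicator function, or \<open>0\<close> if \<open>v\<close> is on a triple edge but its fan around \<open>v\<close> meets none.\<close>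

definition "triple_vertices = \<Union>E3"

definition "points = Inl ` (\<Union>T - triple_vertices) \<union> Inr ` ends"

definition "fan_end t v = {F\<in>ends. \<exists>e s. (e,s) \<in> F \<and> v \<in> e \<and> (t,s) \<in> corner v}"

definition cut_vertex :: "'v set \<Rightarrow> 'v \<Rightarrow> 'v + ('v set \<times> 'v set) set \<Rightarrow> 3" where
  "cut_vertex t v = (\<lambda>q. if v \<in> triple_vertices then (if q \<in> Inr ` fan_end t v then 1 else 0)
     else (if q = Inl v then 1 else 0))"

lemma fan_end_cong:
  assumes "(t,t') \<in> corner v" shows "fan_end t v = fan_end t' v"
proof -
  have "(t,s) \<in> corner v \<longleftrightarrow> (t',s) \<in> corner v" for s
    using assms corner_sym[OF assms] unfolding corner_def by (meson rtrancl_trans)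
  then show ?thesis by (simp add: fan_end_def)
qed

lemma cut_vertex_adj:
  assumes "e \<in> E2" "v \<in> e" "t \<in> tri_at T e" "t' \<in> tri_at T e"
  shows "cut_vertex t v = cut_vertex t' v"
proof -
  have "(t,t) \<in> corner v" by (simp add: corner_def)
  then have "(t,t') \<in> corner v" using corner_closed[OF assms] by blast
  then show ?thesis using fan_end_cong[OF \<open>(t,t') \<in> corner v\<close>] by (simp add: cut_vertex_def fun_eq_iff)
qed

lemma end_in_flags: "F \<in> ends \<Longrightarrow> x \<in> F \<Longrightarrow> x \<in> flags"
  using equiv_flag_rel Union_quotient by (metis Union_iff)

lemma fan_end_flag:
  assumes "(e,t) \<in> flags" "v \<in> e"
  shows "fan_end t v = {flag_rel `` {(e,t)}}"
proof
  have "(e,t) \<in> flag_rel `` {(e,t)}" by (rule equiv_class_self[OF equiv_flag_rel assms(1)])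
  then show "{flag_rel `` {(e,t)}} \<subseteq> fan_end t v"
    using assms by (auto simp: fan_end_def quotientI corner_def)
next
  show "fan_end t v \<subseteq> {flag_rel `` {(e,t)}}"
  proof
    fix F assume "F \<in> fan_end t v"
    then obtain e' s where F: "F \<in> ends" "(e',s) \<in> F" "v \<in> e'" "(t,s) \<in> corner v" by (auto simp: fan_end_def)
    then have fl: "(e',s) \<in> flags" using end_in_flags by blast
    then have "((e,t),(e',s)) \<in> flag_step" using assms F by (auto simp: flag_step_def)
    then have "((e,t),(e',s)) \<in> flag_rel" using fl assms by (auto simp: flag_rel_def)
    then have "flag_rel `` {(e,t)} = flag_rel `` {(e',s)}" by (rule equiv_class_eq[OF equiv_flag_rel])
    moreover obtain x where "F = flag_rel `` {x}" using F(1) by (rule quotientE)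
    then have "F = flag_rel `` {(e',s)}" using F(2) equiv_class_eq[OF equiv_flag_rel, of x "(e',s)"] by simp
    ultimately show "F \<in> {flag_rel `` {(e,t)}}" by simp
  qed
qed

lemma cut_vertex_E3:
  assumes "(e,t) \<in> flags" "a \<in> e" "b \<in> e"
  shows "cut_vertex t a = cut_vertex t b"
proof -
  have "a \<in> triple_vertices" "b \<in> triple_vertices" using assms by (auto simp: triple_vertices_def flags_def)
  then show ?thesis using fan_end_flag[OF assms(1,2)] fan_end_flag[OF assms(1,3)] by (simp add: cut_vertex_def)
qed

definition "some_tri e = (SOME t. t \<in> tri_at T e)"

text \<open>The boundary of the edge \<open>e\<close> in the cut surface, as a function of the point
  \<open>q\<close>. The chosen triangle only serves to name the corners; for a double edge both
  triangles give the same result.\<close>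

definition cobnd :: "'v set \<Rightarrow> 'v + ('v set \<times> 'v set) set \<Rightarrow> 3" where
  "cobnd e = (\<lambda>q. \<Sum>a\<in>e. sp num e a * cut_vertex (some_tri e) a q)"

lemma cobnd_eq:
  assumes "e \<in> E2" "t \<in> tri_at T e"
  shows "cobnd e q = (\<Sum>a\<in>e. sp num e a * cut_vertex t a q)"
proof -
  have "some_tri e \<in> tri_at T e" unfolding some_tri_def by (rule someI) (rule assms(2))
  then show ?thesis unfolding cobnd_def using cut_vertex_adj[OF assms(1) _ _ assms(2)] by (intro sum.cong) auto
qed

text \<open>The two corners of \<open>t\<close> on a triple edge lie at the same end, so in the cut
  surface the edge shrinks to a point.\<close>

lemma cobnd_E3:
  assumes "e \<in> E3" "t \<in> tri_at T e"
  shows "(\<Sum>a\<in>e. sp num e a * cut_vertex t a q) = 0"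
proof -
  have "card e = 2" using assms edges_split card_edge by blast
  then obtain a b where ab: "e = {a,b}" "a \<noteq> b" by (auto simp: card_2_iff)
  have "cut_vertex t a = cut_vertex t b"
    using cut_vertex_E3[of e t a b] assms ab by (auto simp: flags_def)
  moreover have "sp num e b = - (sp num e a :: 3)"
  proof -
    have "sp num {a,b} a = (sg num b a :: 3)" using ab(2) by (rule sp_pair)
    moreover have "sp num {b,a} b = (sg num a b :: 3)" using ab(2)[symmetric] by (rule sp_pair)
    ultimately show ?thesis unfolding ab(1) by (simp add: insert_commute sg_antisym[of num a b])
  qed
  ultimately show ?thesis using ab by simp
qed

text \<open>The double boundary of a triangle vanishes for arbitrary labels \<open>g\<close> at its
  corners. This freedom is used because, after cutting, the point at a vertex depends on the
  triangle.\<close>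

lemma sum_cut_triangle:
  assumes t: "t \<in> T"
  shows "(\<Sum>e | e \<in> edges_of T \<and> e \<subseteq> t. inc num t e * (\<Sum>a\<in>e. sp num e a * g a)) = (0::3)"
proof -
  have "(\<Sum>e | e \<in> edges_of T \<and> e \<subseteq> t. inc num t e * (\<Sum>a\<in>e. sp num e a * g a))
      = (\<Sum>e | e \<in> edges_of T \<and> e \<subseteq> t. \<Sum>a | a \<in> t \<and> a \<in> e. inc num t e * (sp num e a * g a))"
  proof (rule sum.cong[OF refl])
    fix e assume "e \<in> {e. e \<in> edges_of T \<and> e \<subseteq> t}"
    then have "{a. a \<in> t \<and> a \<in> e} = e" by auto
    then show "inc num t e * (\<Sum>a\<in>e. sp num e a * g a) = (\<Sum>a | a \<in> t \<and> a \<in> e. inc num t e * (sp num e a * g a))"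
      by (simp add: sum_distrib_left)
  qed
  also have "\<dots> = (\<Sum>a\<in>t. \<Sum>e | e \<in> {e. e \<in> edges_of T \<and> e \<subseteq> t} \<and> a \<in> e. inc num t e * (sp num e a * g a))"
    by (rule sum.swap_restrict) (use finite_edges finite_triangle[OF t] in auto)
  also have "\<dots> = (\<Sum>a\<in>t. 0)"
  proof (rule sum.cong[OF refl])
    fix v assume "v \<in> t"
    then obtain x y where xy: "t = {v,x,y}" "v \<noteq> x" "x \<noteq> y" "v \<noteq> y" using triple_through card_T[OF t] by metis
    have "{e. e \<in> {e. e \<in> edges_of T \<and> e \<subseteq> t} \<and> v \<in> e} = {e. card e = 2 \<and> v \<in> e \<and> e \<subseteq> t}"
      using t by (auto simp: edges_of_def)
    also have "\<dots> = {{v,x},{v,y}}" unfolding xy(1) by (rule edges_through_vertex_triple) (use xy in auto)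
    finally have s: "{e. e \<in> {e. e \<in> edges_of T \<and> e \<subseteq> t} \<and> v \<in> e} = {{v,x},{v,y}}" .
    have ne: "{v,x} \<noteq> {v,y}" using xy by (auto simp: doubleton_eq_iff)
    have "(\<Sum>e | e \<in> {e. e \<in> edges_of T \<and> e \<subseteq> t} \<and> v \<in> e. inc num t e * (sp num e v * g v))
        = (sp num {v,x} v * inc num t {v,x} + sp num {v,y} v * inc num t {v,y}) * g v"
      unfolding s using ne by (simp add: algebra_simps)
    then show "(\<Sum>e | e \<in> {e. e \<in> edges_of T \<and> e \<subseteq> t} \<and> v \<in> e. inc num t e * (sp num e v * g v)) = 0"
      by (simp only: xy(1) sp_inc_cancel[OF xy(2-4)] mult_zero_left)
  qed
  finally show ?thesis by simp
qed

text \<open>The double boundary vanishes in the cut surface too. Triple edges contribute nothing and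
  may be added to the sum, after which each triangle cancels by itself.\<close>

lemma sum_bnd_cobnd:
  fixes c :: "'v set \<Rightarrow> 3"
  shows "(\<Sum>e\<in>E2. bnd num T c e * cobnd e q) = 0"
proof -
  have "(\<Sum>e\<in>E2. bnd num T c e * cobnd e q)
     = (\<Sum>e\<in>E2. \<Sum>t | t \<in> T \<and> e \<subseteq> t. c t * (inc num t e * (\<Sum>a\<in>e. sp num e a * cut_vertex t a q)))"
  proof (rule sum.cong[OF refl])
    fix e assume e: "e \<in> E2"
    have "bnd num T c e * cobnd e q = (\<Sum>t\<in>tri_at T e. c t * (inc num t e * cobnd e q))"
      by (simp add: bnd_def sum_distrib_right sum_distrib_left ac_simps)
    also have "\<dots> = (\<Sum>t\<in>tri_at T e. c t * (inc num t e * (\<Sum>a\<in>e. sp num e a * cut_vertex t a q)))"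
      by (rule sum.cong[OF refl]) (simp add: cobnd_eq[OF e])
    finally show "bnd num T c e * cobnd e q = (\<Sum>t | t \<in> T \<and> e \<subseteq> t. c t * (inc num t e * (\<Sum>a\<in>e. sp num e a * cut_vertex t a q)))"
      by (simp add: tri_at_def)
  qed
  also have "\<dots> = (\<Sum>e\<in>edges_of T. \<Sum>t | t \<in> T \<and> e \<subseteq> t. c t * (inc num t e * (\<Sum>a\<in>e. sp num e a * cut_vertex t a q)))"
  proof (rule sum.mono_neutral_left[OF finite_edges])
    show "E2 \<subseteq> edges_of T" using edges_split by blast
    show "\<forall>e\<in>edges_of T - E2. (\<Sum>t | t \<in> T \<and> e \<subseteq> t. c t * (inc num t e * (\<Sum>a\<in>e. sp num e a * cut_vertex t a q))) = 0"
    proof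
      fix e assume "e \<in> edges_of T - E2"
      then have "e \<in> E3" using edges_split by blast
      then show "(\<Sum>t | t \<in> T \<and> e \<subseteq> t. c t * (inc num t e * (\<Sum>a\<in>e. sp num e a * cut_vertex t a q))) = 0"
        by (intro sum.neutral) (auto simp: cobnd_E3 tri_at_def)
    qed
  qed
  also have "\<dots> = (\<Sum>t\<in>T. \<Sum>e | e \<in> edges_of T \<and> e \<subseteq> t. c t * (inc num t e * (\<Sum>a\<in>e. sp num e a * cut_vertex t a q)))"
    by (rule sum.swap_restrict) (use finite_edges finite_T in auto)
  also have "\<dots> = 0"
    by (rule sum.neutral) (simp add: sum_cut_triangle flip: sum_distrib_left)
  finally show ?thesis .
qed

text \<open>Modulo the image of the coboundary, all the points on one sheet are equal, so that image
  and one point on each sheet generate all functions on the points.\<close>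

definition present :: "('v set \<Rightarrow> 3) \<times> ('v set set \<Rightarrow> 3) \<Rightarrow> 'v + ('v set \<times> 'v set) set \<Rightarrow> 3" where
  "present = (\<lambda>(z,w) q. (\<Sum>e\<in>E2. z e * cobnd e q)
      + (\<Sum>C\<in>sheets. w C * cut_vertex (rep C) (rep (rep C)) q))"

definition "params = (supp_funs E2 :: ('v set \<Rightarrow> 3) set) \<times> (supp_funs sheets :: ('v set set \<Rightarrow> 3) set)"

lemma present_diff: "present (x - y) = present x - present y"
  by (cases x, cases y) (auto simp: present_def fun_eq_iff algebra_simps sum_subtractf)

lemma params_diff: "x \<in> params \<Longrightarrow> y \<in> params \<Longrightarrow> x - y \<in> params"
  by (cases x, cases y) (auto simp: params_def supp_funs_def)

definition "gen = present ` params"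

lemma gen_diff: "f \<in> gen \<Longrightarrow> g \<in> gen \<Longrightarrow> f - g \<in> gen"
proof -
  assume "f \<in> gen" "g \<in> gen"
  then obtain x y where "x \<in> params" "y \<in> params" "f = present x" "g = present y"
    unfolding gen_def by (elim imageE)
  then show ?thesis unfolding gen_def using params_diff[of x y] present_diff[of x y] by (metis image_eqI)
qed

lemma gen_0: "0 \<in> gen"
proof -
  have "(0,0) \<in> params" "present (0,0) = 0" by (auto simp: params_def supp_funs_def present_def)
  then show ?thesis unfolding gen_def by (metis image_eqI)
qed

lemma gen_add: "f \<in> gen \<Longrightarrow> g \<in> gen \<Longrightarrow> f + g \<in> gen"
  using gen_diff[OF _ gen_diff[OF gen_0]] by fastforce

lemma gen_scale: "f \<in> gen \<Longrightarrow> (\<lambda>q. k * f q) \<in> gen"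
proof -
  assume f: "f \<in> gen"
  have "(\<lambda>q. k * f q) = 0 \<or> (\<lambda>q. k * f q) = f \<or> (\<lambda>q. k * f q) = f + f"
    using cases_mod_3[of k] by (auto simp: fun_eq_iff)
  then show ?thesis using f gen_0 gen_add by metis
qed

lemma gen_cobnd:
  assumes "e \<in> E2" shows "cobnd e \<in> gen"
proof -
  have "((\<lambda>x. if x = e then 1 else 0), 0) \<in> params" using assms by (auto simp: params_def supp_funs_def)
  moreover have "present ((\<lambda>x. if x = e then 1 else 0), 0) = cobnd e"
    using assms finite_E2 by (auto simp: present_def fun_eq_iff if_distrib[of "\<lambda>x. x * _"] cong: if_cong)
  ultimately show ?thesis unfolding gen_def by (metis image_eqI)
qed

lemma gen_rep:
  assumes "C \<in> sheets" shows "cut_vertex (rep C) (rep (rep C)) \<in> gen"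
proof -
  have "(0, (\<lambda>x. if x = C then 1 else 0)) \<in> params" using assms by (auto simp: params_def supp_funs_def)
  moreover have "present (0, (\<lambda>x. if x = C then 1 else 0)) = cut_vertex (rep C) (rep (rep C))"
    using assms finite_sheets by (auto simp: present_def fun_eq_iff if_distrib[of "\<lambda>x. x * _"] cong: if_cong)
  ultimately show ?thesis unfolding gen_def by (metis image_eqI)
qed

text \<open>Two corners of a triangle differ by the boundary of their common edge up to sign, and by
  nothing if that edge is a triple edge.\<close>

lemma cut_vertex_diff_gen:
  assumes "t \<in> T" "a \<in> t" "b \<in> t"
  shows "cut_vertex t a - cut_vertex t b \<in> gen"
proof (cases "a = b")
  case False
  let ?e = "{a,b}"
  have e: "?e \<in> edges_of T" using assms False by (auto simp: edges_of_def)
  have tt: "t \<in> tri_at T ?e" using assms by (auto simp: tri_at_def)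
  show ?thesis
  proof (cases "?e \<in> E3")
    case True
    then have "cut_vertex t a = cut_vertex t b"
      using cut_vertex_E3[of ?e t a b] tt by (auto simp: flags_def)
    then show ?thesis using gen_0 by simp
  next
    case F: False
    then have e2: "?e \<in> E2" using e edges_split by blast
    have "sp num {b,a} b = (sg num a b :: 3)" using False[symmetric] by (rule sp_pair)
    then have s: "sp num ?e a = (sg num b a :: 3)" "sp num ?e b = (sg num a b :: 3)"
      using sp_pair[OF False] by (simp_all add: insert_commute)
    have q: "cobnd ?e q = sg num b a * (cut_vertex t a q - cut_vertex t b q)" for q
      unfolding cobnd_eq[OF e2 tt, of q] using False s by (simp add: sg_antisym[of num a b] algebra_simps)
    have "sg num b a * sg num b a = (1::3)" using num_neq[of b t a] assms False by (intro sg_square) auto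
    then have "(\<lambda>q. sg num b a * cobnd ?e q) = cut_vertex t a - cut_vertex t b"
      by (auto simp: fun_eq_iff q simp flip: mult.assoc)
    then show ?thesis using gen_scale[OF gen_cobnd[OF e2]] by metis
  qed
qed (use gen_0 in simp)

lemma rep_triangle: "t \<in> T \<Longrightarrow> rep t \<in> t"
proof -
  assume "t \<in> T"
  then have "t \<noteq> {}" using card_T by force
  then show "rep t \<in> t" unfolding rep_def by (simp add: some_in_eq)
qed

text \<open>Sweep through the sheet from its chosen triangle: neighbouring triangles share a corner
  on the double edge between them.\<close>

lemma cut_vertex_gen:
  assumes "t \<in> T" "a \<in> t"
  shows "cut_vertex t a \<in> gen"
proof -
  define C where "C = tri_rel `` {t}"
  have C: "C \<in> sheets" "t \<in> C"
    unfolding C_def using assms(1) by (simp_all only: quotientI equiv_class_self[OF equiv_tri_rel])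
  have r: "rep C \<in> C" using rep_in[OF equiv_tri_rel C(1)] .
  then have rT: "rep C \<in> T" using C(1) equiv_tri_rel by (metis Union_iff Union_quotient)
  have "(rep C, t) \<in> tri_rel" using r C equiv_tri_rel by (metis quotient_eq_iff)
  then have "(rep C, t) \<in> (adj_across T E2)\<^sup>*" by (simp add: tri_rel_def)
  then have "\<forall>a\<in>t. cut_vertex t a \<in> gen"
  proof (induction rule: rtrancl_induct)
    case base
    show ?case
    proof
      fix a assume "a \<in> rep C"
      from gen_add[OF cut_vertex_diff_gen[OF rT this rep_triangle[OF rT]] gen_rep[OF C(1)]]
      show "cut_vertex (rep C) a \<in> gen" by simp
    qed
  next
    case (step s s')
    then obtain e where e: "e \<in> E2" "e \<subseteq> s" "e \<subseteq> s'" "s \<in> T" "s' \<in> T" by (auto simp: adj_across_def)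
    have "card e = 2" using e(1) edges_split card_edge by blast
    then obtain b where b: "b \<in> e" by fastforce
    have eq: "cut_vertex s b = cut_vertex s' b"
      by (rule cut_vertex_adj[OF e(1) b]) (use e in \<open>auto simp: tri_at_def\<close>)
    have "cut_vertex s b \<in> gen" using step.IH b e(2) by blast
    then have g: "cut_vertex s' b \<in> gen" unfolding eq .
    have bs: "b \<in> s'" using b e(3) by blast
    show ?case
    proof
      fix a assume "a \<in> s'"
      from gen_add[OF cut_vertex_diff_gen[OF e(5) this bs] g]
      show "cut_vertex s' a \<in> gen" by simp
    qed
  qed
  then show ?thesis using assms by blast
qed

lemma finite_points: "finite points"
  using finite_vertices finite_ends by (auto simp: points_def)

lemma supp_funs_points_subset_gen: "supp_funs points \<subseteq> gen"
proof
  fix f :: "'v + ('v set \<times> 'v set) set \<Rightarrow> 3" assume f: "f \<in> supp_funs points"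
  have ind: "(\<lambda>x. if x = q then 1 else 0) \<in> gen" if q: "q \<in> points" for q
  proof -
    consider v where "v \<in> \<Union>T" "v \<notin> triple_vertices" "q = Inl v" | F where "F \<in> ends" "q = Inr F"
      using q by (auto simp: points_def)
    then show ?thesis
    proof cases
      case 1
      then obtain t where t: "t \<in> T" "v \<in> t" by blast
      have "cut_vertex t v = (\<lambda>x. if x = q then 1 else 0)" using 1 by (auto simp: cut_vertex_def fun_eq_iff)
      then show ?thesis using cut_vertex_gen[OF t] by simp
    next
      case 2
      then obtain e t where et: "(e,t) \<in> flags" "F = flag_rel `` {(e,t)}" by (auto elim!: quotientE)
      have "card e = 2" using et edges_split card_edge by (auto simp: flags_def)
      then obtain v where v: "v \<in> e" by fastforce
      have t: "t \<in> T" "v \<in> t" "v \<in> triple_vertices" using et v by (auto simp: flags_def tri_at_def triple_vertices_def)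
      have "cut_vertex t v = (\<lambda>x. if x = q then 1 else 0)"
        using fan_end_flag[OF et(1) v] t(3) 2 et by (auto simp: cut_vertex_def fun_eq_iff)
      then show ?thesis using cut_vertex_gen[OF t(1,2)] by simp
    qed
  qed
  have sums: "(\<lambda>x. \<Sum>q\<in>S. f q * (if x = q then 1 else 0)) \<in> gen" if "finite S" "S \<subseteq> points" for S
    using that
  proof (induction S rule: finite_induct)
    case empty then show ?case using gen_0 by (simp add: zero_fun_def)
  next
    case (insert q S)
    have "(\<lambda>x. \<Sum>q\<in>insert q S. f q * (if x = q then 1 else 0)) =
        (\<lambda>x. f q * (if x = q then 1 else 0)) + (\<lambda>x. \<Sum>q\<in>S. f q * (if x = q then 1 else 0))"
      using insert.hyps by (auto simp: fun_eq_iff)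
    then show ?case using gen_add[OF gen_scale[OF ind[of q]]] insert by simp
  qed
  from sums[OF finite_points] have "(\<lambda>x. \<Sum>q\<in>points. f q * (if x = q then 1 else 0)) \<in> gen" by simp
  moreover have "(\<lambda>x. \<Sum>q\<in>points. f q * (if x = q then 1 else 0)) = f"
    using f finite_points by (auto simp: fun_eq_iff supp_funs_def if_distrib[of "\<lambda>y. _ * y"] cong: if_cong)
  ultimately show "f \<in> gen" by simp
qed

lemma gen_subset: "gen \<subseteq> supp_funs points"
proof -
  have "cut_vertex t a q = 0" if "t \<in> T" "a \<in> t" "q \<notin> points" for t a q
    using that by (auto simp: cut_vertex_def points_def fan_end_def)
  then have "cobnd e q = 0" if "e \<in> E2" "q \<notin> points" for e q
  proof -
    have "tri_at T e \<noteq> {}" using that by (auto simp: E2_def)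
    then obtain t where t: "t \<in> tri_at T e" by blast
    then show ?thesis unfolding cobnd_eq[OF that(1) t]
      using that \<open>\<And>t a q. t \<in> T \<Longrightarrow> a \<in> t \<Longrightarrow> q \<notin> points \<Longrightarrow> cut_vertex t a q = 0\<close>
      by (intro sum.neutral) (auto simp: tri_at_def)
  qed
  moreover have "rep C \<in> T" if "C \<in> sheets" for C
    using rep_in[OF equiv_tri_rel that] that equiv_tri_rel by (metis Union_iff Union_quotient)
  ultimately show ?thesis
    using \<open>\<And>t a q. t \<in> T \<Longrightarrow> a \<in> t \<Longrightarrow> q \<notin> points \<Longrightarrow> cut_vertex t a q = 0\<close> rep_triangle
    by (auto simp: gen_def present_def supp_funs_def)
qed

text \<open>The inequality chi \<le> h_0 + h_2 for the cut surface, with dimensions turned into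
  powers of 3. Boundaries of 2-chains lie in the kernel of \<open>present\<close>, whose image
  consists of all functions on the points; the sheets stand for h_0 and \<open>rel_cycles\<close>
  for h_2. What is given away is h_1.\<close>

lemma card_count: "3 ^ card T * 3 ^ card points \<le> card rel_cycles * (3 ^ card E2 * 3 ^ card sheets)"
proof -
  let ?ker = "{x \<in> params. present x = 0}"
  have finp: "finite params"
    unfolding params_def by (intro finite_cartesian_product finite_supp_funs finite_E2 finite_sheets)
  have cp: "card params = 3 ^ card E2 * 3 ^ card sheets"
    by (simp add: params_def card_cartesian_product card_supp_funs finite_E2 finite_sheets)
  have "card params = card ?ker * card (present ` params)"
    by (rule card_eq_card_ker_times_card_image[OF finp params_diff present_diff])
  also have "present ` params = supp_funs points"
    using supp_funs_points_subset_gen gen_subset by (auto simp: gen_def)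
  also have "card (supp_funs points :: ('v + ('v set \<times> 'v set) set \<Rightarrow> 3) set) = 3 ^ card points"
    by (simp add: card_supp_funs finite_points)
  finally have 1: "card params = card ?ker * 3 ^ card points" .
  define D where "D c = (\<lambda>e. if e \<in> E2 then bnd num T c e else 0)" for c :: "'v set \<Rightarrow> 3"
  have bnd_diff: "bnd num T (c - d) e = bnd num T c e - bnd num T d e" for c d :: "'v set \<Rightarrow> 3" and e
    by (simp add: bnd_def algebra_simps sum_subtractf)
  have "card (supp_funs T :: ('v set \<Rightarrow> 3) set) = card {c \<in> supp_funs T. D c = 0} * card (D ` supp_funs T)"
    by (rule card_eq_card_ker_times_card_image[OF finite_supp_funs[OF finite_T]])
       (auto simp: supp_funs_def D_def fun_eq_iff bnd_diff)
  also have "{c \<in> supp_funs T. D c = 0} = rel_cycles" by (auto simp: rel_cycles_def D_def fun_eq_iff)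
  finally have 2: "3 ^ card T = card rel_cycles * card (D ` supp_funs T)" by (simp add: card_supp_funs finite_T)
  have "(\<lambda>z. (z, 0 :: 'v set set \<Rightarrow> 3)) ` (D ` supp_funs T) \<subseteq> ?ker"
  proof (clarsimp)
    fix c :: "'v set \<Rightarrow> 3"
    have "(D c, 0) \<in> params" by (auto simp: D_def params_def supp_funs_def)
    moreover have "(\<Sum>e\<in>E2. D c e * cobnd e q) = 0" for q
      using sum_bnd_cobnd[of c q] by (simp add: D_def)
    then have "present (D c, 0) = 0" by (auto simp: present_def fun_eq_iff)
    ultimately show "(D c, 0) \<in> params \<and> present (D c, 0) = 0" by blast
  qed
  moreover have "inj_on (\<lambda>z. (z, 0 :: 'v set set \<Rightarrow> 3)) (D ` supp_funs T)" by (auto simp: inj_on_def)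
  moreover have "finite ?ker" using finp by auto
  ultimately have "card (D ` supp_funs T) \<le> card ?ker" by (meson card_inj_on_le)
  then have "3 ^ card T * 3 ^ card points \<le> card rel_cycles * card ?ker * 3 ^ card points"
    unfolding 2 by simp
  then show ?thesis using 1 cp by (simp add: mult.assoc)
qed

text \<open>Double counting: each triple vertex is on exactly two triple edges and each edge has two
  vertices. So the circles contribute 0 to the Euler characteristic.\<close>

lemma card_E3_eq: "card E3 = card triple_vertices"
proof -
  have fin: "finite triple_vertices" unfolding triple_vertices_def
    by (rule finite_subset[OF _ finite_vertices]) (auto simp: E3_def edges_of_def)
  have "(\<Sum>v\<in>triple_vertices. card {e\<in>E3. v \<in> e}) = (\<Sum>v\<in>triple_vertices. 2)"
  proof (rule sum.cong[OF refl])
    fix v assume "v \<in> triple_vertices"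
    then have "{e\<in>E3. v \<in> e} \<noteq> {}" by (auto simp: triple_vertices_def)
    then have "card {e\<in>E3. v \<in> e} \<noteq> 0" using finite_E3 by simp
    moreover have "{e\<in>E3. v \<in> e} = {e \<in> edges_of T. v \<in> e \<and> card (tri_at T e) = 3}"
      by (auto simp: E3_def)
    ultimately show "card {e\<in>E3. v \<in> e} = 2" using deg3[of v] by auto
  qed
  moreover have "(\<Sum>v\<in>triple_vertices. card {e\<in>E3. v \<in> e}) = 2 * card E3"
  proof -
    have "(\<Sum>v\<in>triple_vertices. card {e\<in>E3. v \<in> e}) = (\<Sum>v\<in>triple_vertices. \<Sum>e | e \<in> E3 \<and> v \<in> e. 1)" by simp
    also have "\<dots> = (\<Sum>e\<in>E3. \<Sum>v | v \<in> triple_vertices \<and> v \<in> e. 1)"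
      by (rule sum.swap_restrict) (use fin finite_E3 in auto)
    also have "\<dots> = (\<Sum>e\<in>E3. 2)"
    proof (rule sum.cong[OF refl])
      fix e assume e: "e \<in> E3"
      then have "{v. v \<in> triple_vertices \<and> v \<in> e} = e" by (auto simp: triple_vertices_def)
      moreover have "card e = 2" using e edges_split card_edge by blast
      ultimately show "(\<Sum>v | v \<in> triple_vertices \<and> v \<in> e. 1) = (2::nat)" by simp
    qed
    finally show ?thesis by simp
  qed
  ultimately show ?thesis by simp
qed

theorem residual_False: False
proof -
  have sub: "triple_vertices \<subseteq> \<Union>T" by (auto simp: triple_vertices_def E3_def edges_of_def)
  have "card points = card (\<Union>T - triple_vertices) + card ends"
    unfolding points_def
    by (subst card_Un_disjoint) (use finite_vertices finite_ends in \<open>auto simp: card_image\<close>)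
  also have "card (\<Union>T - triple_vertices) = card (\<Union>T) - card E3"
    using sub finite_vertices card_E3_eq by (simp add: card_Diff_subset finite_subset)
  finally have p: "card points = card (\<Union>T) - card E3 + card ends" .
  have le: "card E3 \<le> card (\<Union>T)" using sub finite_vertices card_E3_eq by (simp add: card_mono)
  have e: "card (edges_of T) = card E2 + card E3"
    using edges_split finite_E2 finite_E3 by (simp add: card_Un_disjoint)
  have "(3::nat) ^ (card T + card points) \<le> 3 ^ card good * (3 ^ card E2 * 3 ^ card sheets)"
    using card_count card_rel_cycles_le by (simp add: power_add) (meson le_trans mult_le_mono1)
  also have "\<dots> = 3 ^ (card good + card E2 + card sheets)" by (simp add: power_add mult.assoc)
  finally have "card T + card points \<le> card good + card E2 + card sheets" by simp
  \<comment> \<open>Cutting drops the triple edges and equally many vertices and adds the ends as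
    points, so the Euler characteristic grows by exactly the number of ends.\<close>
  then show False using p le e euler card_sheets_le card_ends_ge by linarith
qed

end

section \<open>Homology modulo 2 and 3, and the Euler characteristic\<close>

text \<open>Connectedness is expressed by cuts instead of paths. In this form it is easily kept when
  an edge of a triangle or a leaf is removed, and it drives the inductions that add one vertex at a
  time.\<close>

definition cut_connected :: "'v set \<Rightarrow> 'v set set \<Rightarrow> bool" where
  "cut_connected V E \<longleftrightarrow> (\<forall>A\<subseteq>V. A \<noteq> {} \<longrightarrow> A \<noteq> V \<longrightarrow> (\<exists>e\<in>E. e \<inter> A \<noteq> {} \<and> \<not> e \<subseteq> A))"

lemma cut_connectedE:
  assumes "cut_connected V E" "\<And>e. e \<in> E \<Longrightarrow> e \<subseteq> V \<and> card e = 2" "A \<subseteq> V" "A \<noteq> {}" "A \<noteq> V"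
  obtains a w where "{a,w} \<in> E" "a \<in> A" "w \<in> V" "w \<notin> A"
proof -
  obtain e where e: "e \<in> E" "e \<inter> A \<noteq> {}" "\<not> e \<subseteq> A"
    using assms(1,3-5) unfolding cut_connected_def by blast
  then obtain a w where "a \<in> e" "a \<in> A" "w \<in> e" "w \<notin> A" by blast
  moreover have "card e = 2" "e \<subseteq> V" using assms(2) e(1) by auto
  ultimately obtain b where "e = {a,b}" using card_2_other[of e a] by blast
  with \<open>w \<in> e\<close> \<open>w \<notin> A\<close> \<open>a \<in> A\<close> have "e = {a,w}" by blast
  then show thesis using that e \<open>a \<in> A\<close> \<open>w \<notin> A\<close> \<open>e \<subseteq> V\<close> by blast
qed

text \<open>Grow \<open>A\<close> to \<open>V\<close> along crossing edges: each new vertex brings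
  an edge that is inside the new set but was not inside the old one.\<close>

lemma card_edges_outside:
  assumes "cut_connected V E" "finite V" "finite E" "\<And>e. e \<in> E \<Longrightarrow> e \<subseteq> V \<and> card e = 2" "A \<subseteq> V" "A \<noteq> {}"
  shows "card (V - A) \<le> card {e\<in>E. \<not> e \<subseteq> A}"
  using assms(5,6)
proof (induction "card (V - A)" arbitrary: A)
  case 0 then show ?case by simp
next
  case (Suc n)
  then have "A \<noteq> V" by auto
  then obtain a w where aw: "{a,w} \<in> E" "a \<in> A" "w \<in> V" "w \<notin> A"
    using cut_connectedE[OF assms(1,4) Suc.prems] by metis
  let ?A = "insert w A"
  have "V - ?A = (V - A) - {w}" by auto
  then have c: "card (V - A) = Suc (card (V - ?A))"
    using aw assms(2) by (metis DiffI card_Suc_Diff1 finite_Diff)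
  then have "card (V - ?A) \<le> card {e\<in>E. \<not> e \<subseteq> ?A}"
    using Suc aw by (intro Suc.hyps(1)) auto
  moreover have "card {e\<in>E. \<not> e \<subseteq> ?A} < card {e\<in>E. \<not> e \<subseteq> A}"
  proof (rule psubset_card_mono)
    have "{a,w} \<in> {e\<in>E. \<not> e \<subseteq> A} - {e\<in>E. \<not> e \<subseteq> ?A}" using aw by simp
    then show "{e\<in>E. \<not> e \<subseteq> ?A} \<subset> {e\<in>E. \<not> e \<subseteq> A}" by blast
  qed (simp add: assms(3))
  ultimately show ?case using c by linarith
qed

section \<open>The chain complex of a connected 2-complex\<close>

locale complex2 =
  fixes V :: "'v set" and E T :: "'v set set" and num :: "'v \<Rightarrow> nat"
  assumes finite_V: "finite V" and E_sub: "e \<in> E \<Longrightarrow> e \<subseteq> V \<and> card e = 2"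
    and T_sub: "t \<in> T \<Longrightarrow> t \<subseteq> V \<and> card t = 3" and faces: "edges_of T \<subseteq> E"
    and inj: "inj_on num V" and conn: "cut_connected V E" and V_ne: "V \<noteq> {}"
begin

lemma fin_E: "finite E" and fin_T: "finite T"
  using finite_V E_sub T_sub by (auto intro!: finite_subset[of _ "Pow V"])

lemma fin_tri: "t \<in> T \<Longrightarrow> finite t" using T_sub finite_V finite_subset by blast

lemma bnd1_bnd: "bnd1 num E (bnd num T c) v = 0"
proof -
  have "(\<Sum>e | e \<in> E \<and> v \<in> e. sp num e v * (\<Sum>t\<in>tri_at {t\<in>T. v \<in> t} e. inc num t e * c t)) = 0"
  proof (rule vertex_balance)
    show "e \<in> E" if "t \<in> {t\<in>T. v \<in> t}" "card e = 2" "v \<in> e" "e \<subseteq> t" for t e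
      using that faces by (auto simp: edges_of_def)
  qed (use fin_T fin_E T_sub E_sub in auto)
  moreover have "tri_at {t\<in>T. v \<in> t} e = tri_at T e" if "v \<in> e" for e using that by (auto simp: tri_at_def)
  ultimately show ?thesis by (simp add: bnd1_def bnd_def)
qed

lemma num_neq: "a \<in> V \<Longrightarrow> b \<in> V \<Longrightarrow> a \<noteq> b \<Longrightarrow> num a \<noteq> num b"
  using inj by (auto simp: inj_on_def)

lemma sp_antisym:
  assumes "a \<noteq> b" shows "sp num {a,b} b = - (sp num {a,b} a :: 'f::comm_ring_1)"
proof -
  have "sp num {a,b} a = (sg num b a :: 'f)" using assms by (rule sp_pair)
  moreover have "sp num {b,a} b = (sg num a b :: 'f)" using assms[symmetric] by (rule sp_pair)
  ultimately show ?thesis by (simp add: insert_commute sg_antisym[of num a b])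
qed

lemma sum_bnd1: "(\<Sum>v\<in>V. bnd1 num E z v) = (0::'f::comm_ring_1)"
proof -
  have "(\<Sum>v\<in>V. bnd1 num E z v) = (\<Sum>v\<in>V. \<Sum>e | e \<in> E \<and> v \<in> e. sp num e v * z e)" by (simp add: bnd1_def)
  also have "\<dots> = (\<Sum>e\<in>E. \<Sum>v | v \<in> V \<and> v \<in> e. sp num e v * z e)"
    by (rule sum.swap_restrict) (use finite_V fin_E in auto)
  also have "\<dots> = (\<Sum>e\<in>E. 0)"
  proof (rule sum.cong[OF refl])
    fix e assume e: "e \<in> E"
    then obtain a b where ab: "e = {a,b}" "a \<noteq> b" using E_sub by (metis card_2_iff)
    have "{v. v \<in> V \<and> v \<in> e} = {a,b}" using ab E_sub[OF e] by auto
    then show "(\<Sum>v | v \<in> V \<and> v \<in> e. sp num e v * z e) = 0" using ab by (simp add: sp_antisym)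
  qed
  finally show ?thesis by simp
qed

lemma bnd1_diff: "bnd1 num E (\<lambda>e. z e - z' e) v = bnd1 num E z v - bnd1 num E z' v"
  by (simp add: bnd1_def algebra_simps sum_subtractf)

lemma bnd1_scale: "bnd1 num E (\<lambda>e. k * z e) v = k * bnd1 num E z v"
  by (simp add: bnd1_def algebra_simps sum_distrib_left)

lemma bnd1_sum: "bnd1 num E (\<lambda>e. \<Sum>i\<in>I. z i e) v = (\<Sum>i\<in>I. bnd1 num E (z i) v)"
  by (simp add: bnd1_def sum_distrib_left) (rule sum.swap)

lemma bnd_diff: "bnd num T (\<lambda>e. z e - z' e) v = bnd num T z v - bnd num T z' v"
  by (simp add: bnd_def algebra_simps sum_subtractf)

lemma bnd_minus: "bnd num T (z - z') v = bnd num T z v - bnd num T z' v"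
  by (simp add: bnd_def algebra_simps sum_subtractf)

lemma bnd1_minus: "bnd1 num E (z - z') v = bnd1 num E z v - bnd1 num E z' v"
  by (simp add: bnd1_def algebra_simps sum_subtractf)

lemma bnd_scale: "bnd num T (\<lambda>e. k * z e) v = k * bnd num T z v"
  by (simp add: bnd_def algebra_simps sum_distrib_left)

text \<open>The vertices \<open>w\<close> for which such a chain exists form a set that no edge
  leaves; by connectedness it is all of \<open>V\<close>.\<close>

lemma path_chain:
  assumes "v0 \<in> V" "w \<in> V"
  shows "\<exists>z :: 'v set \<Rightarrow> 'f::comm_ring_1. \<forall>v\<in>V. bnd1 num E z v = (if v = w then 1 else 0) - (if v = v0 then 1 else 0)"
proof -
  define A where "A = {w\<in>V. \<exists>z :: 'v set \<Rightarrow> 'f. \<forall>v\<in>V. bnd1 num E z v = (if v = w then 1 else 0) - (if v = v0 then 1 else 0)}"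
  have "v0 \<in> A" using assms by (auto simp: A_def bnd1_def intro!: exI[of _ "\<lambda>_. 0"])
  have "A = V"
  proof (rule ccontr)
    assume "A \<noteq> V"
    moreover have "A \<subseteq> V" "A \<noteq> {}" using \<open>v0 \<in> A\<close> by (auto simp: A_def)
    ultimately obtain a w where aw: "{a,w} \<in> E" "a \<in> A" "w \<in> V" "w \<notin> A"
      using cut_connectedE[OF conn E_sub] by metis
    obtain z :: "'v set \<Rightarrow> 'f" where z: "\<forall>v\<in>V. bnd1 num E z v = (if v = a then 1 else 0) - (if v = v0 then 1 else 0)"
      using aw by (auto simp: A_def)
    have ne: "a \<noteq> w" and aV: "a \<in> V" using aw by (auto simp: A_def)
    \<comment> \<open>The edge oriented from \<open>w\<close> to \<open>a\<close>: with this
      coefficient the boundary at \<open>a\<close> is the square of \<open>sp\<close>, that is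
      1.\<close>
    define y :: "'v set \<Rightarrow> 'f" where "y = (\<lambda>e. if e = {a,w} then sp num {a,w} a else 0)"
    have "bnd1 num E y v = (if v = a then 1 else 0) - (if v = w then 1 else 0)" for v
    proof (cases "v \<in> {a,w}")
      case True
      have "bnd1 num E y v = (\<Sum>e\<in>{{a,w}}. sp num e v * y e)"
        unfolding bnd1_def by (rule sum.mono_neutral_right) (use fin_E aw True in \<open>auto simp: y_def\<close>)
      also have "\<dots> = sp num {a,w} v * sp num {a,w} a" by (simp add: y_def)
      also have "sp num {a,w} a * (sp num {a,w} a :: 'f) = 1"
        using sg_square[of num w a, where 'b='f] num_neq[OF aw(3) aV] ne by (simp add: sp_pair)
      then have "sp num {a,w} v * (sp num {a,w} a :: 'f) = (if v = a then 1 else 0) - (if v = w then 1 else 0)"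
        using True sp_antisym[OF ne, where 'f='f] ne by auto
      finally show ?thesis .
    next
      case False
      have "bnd1 num E y v = 0" unfolding bnd1_def by (rule sum.neutral) (use False in \<open>auto simp: y_def\<close>)
      then show ?thesis using False by auto
    qed
    then have "\<forall>v\<in>V. bnd1 num E (\<lambda>e. z e - y e) v = (if v = w then 1 else 0) - (if v = v0 then 1 else 0)"
      using z by (simp add: bnd1_diff)
    then have "w \<in> A" using aw unfolding A_def by blast
    then show False using aw by simp
  qed
  then show ?thesis using assms(2) unfolding A_def by blast
qed

text \<open>Exactness at the vertices over any coefficient ring. The chains joining a base vertex to
  \<open>w\<close> are combined with weights \<open>y w\<close>; the base vertex receives minus the
  total weight, which is 0.\<close>

lemma sum_zero_chain:
  fixes y :: "'v \<Rightarrow> 'f::comm_ring_1"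
  assumes "(\<Sum>v\<in>V. y v) = 0"
  obtains z where "\<And>v. v \<in> V \<Longrightarrow> bnd1 num E z v = y v"
proof -
  obtain v0 where v0: "v0 \<in> V" using V_ne by auto
  obtain p :: "'v \<Rightarrow> 'v set \<Rightarrow> 'f" where p: "\<And>w v. w \<in> V \<Longrightarrow> v \<in> V \<Longrightarrow>
      bnd1 num E (p w) v = (if v = w then 1 else 0) - (if v = v0 then 1 else 0)"
    using path_chain[OF v0, where 'f='f] by metis
  have "bnd1 num E (\<lambda>e. \<Sum>w\<in>V. y w * p w e) v = y v" if v: "v \<in> V" for v
  proof -
    have "bnd1 num E (\<lambda>e. \<Sum>w\<in>V. y w * p w e) v = (\<Sum>w\<in>V. y w * ((if v = w then 1 else 0) - (if v = v0 then 1 else 0)))"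
      using p v by (simp add: bnd1_sum bnd1_scale)
    also have "\<dots> = (\<Sum>w\<in>V. y w * (if v = w then 1 else 0)) - (\<Sum>w\<in>V. y w) * (if v = v0 then 1 else 0)"
      by (simp add: algebra_simps sum_subtractf sum_distrib_right)
    also have "\<dots> = y v" using assms v finite_V by (simp add: if_distrib[of "\<lambda>x. _ * x"] cong: if_cong)
    finally show ?thesis .
  qed
  then show thesis by (rule that)
qed

end

section \<open>Reduction of integral homology modulo 2 and 3\<close>

lemma of_int_eq_0_mod_3: "of_int x = (0::3) \<longleftrightarrow> 3 dvd x"
proof -
  have "x = 3 * (x div 3) + x mod 3" by simp
  then have "of_int x = (of_int (3 * (x div 3) + x mod 3) :: 3)" by simp
  also have "\<dots> = 3 * of_int (x div 3) + of_int (x mod 3)"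
    by (simp only: of_int_add of_int_mult of_int_numeral)
  also have "\<dots> = of_int (x mod 3)" by (simp only: triple_eq_0_mod_3 add_0)
  finally have *: "of_int x = (of_int (x mod 3) :: 3)" .
  have "x mod 3 = 0 \<or> x mod 3 = 1 \<or> x mod 3 = 2" by presburger
  then show ?thesis unfolding * by (auto simp: dvd_eq_mod_eq_0)
qed

lemma lift_mod_3: "\<exists>d :: 'x \<Rightarrow> int. \<forall>t. of_int (d t) = (c t :: 3)"
proof (intro choice allI)
  show "\<exists>k::int. of_int k = c t" for t
    using cases_mod_3[of "c t"] of_int_0 of_int_1 of_int_numeral by metis
qed

locale acyclic_complex2 = complex2 +
  assumes H2: "\<lbrakk>\<And>e. e \<in> E \<Longrightarrow> bnd num T (c :: 'v set \<Rightarrow> int) e = 0; t \<in> T\<rbrakk> \<Longrightarrow> c t = 0"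
    and H1: "(\<And>v. v \<in> V \<Longrightarrow> bnd1 num E (z :: 'v set \<Rightarrow> int) v = 0) \<Longrightarrow> \<exists>c. \<forall>e\<in>E. z e = bnd num T c e"
begin

text \<open>Universal coefficients by hand. If the boundary of \<open>c\<close> is \<open>p\<close>
  times \<open>z\<close>, then \<open>z\<close> is a cycle and hence the boundary of some
  \<open>d\<close>; now \<open>c\<close> minus \<open>p\<close> times \<open>d\<close> is an
  integral 2-cycle and vanishes.\<close>

lemma H2_mod:
  fixes c :: "'v set \<Rightarrow> int"
  assumes "p \<noteq> 0" "\<And>e. e \<in> E \<Longrightarrow> p dvd bnd num T c e" "t \<in> T"
  shows "p dvd c t"
proof -
  define z where "z e = bnd num T c e div p" for e
  have z: "bnd num T c e = p * z e" if "e \<in> E" for e using assms(2)[OF that] by (simp add: z_def)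
  have "p * bnd1 num E z v = 0" for v
  proof -
    have "p * bnd1 num E z v = bnd1 num E (\<lambda>e. p * z e) v" by (simp add: bnd1_scale)
    also have "\<dots> = bnd1 num E (bnd num T c) v" unfolding bnd1_def by (rule sum.cong) (auto simp: z)
    finally show ?thesis by (simp add: bnd1_bnd)
  qed
  then have "bnd1 num E z v = 0" for v using assms(1) by simp
  then obtain d where d: "\<And>e. e \<in> E \<Longrightarrow> z e = bnd num T d e" using H1 by blast
  have "bnd num T (\<lambda>t. c t - p * d t) e = 0" if "e \<in> E" for e
    using z[OF that] d[OF that] by (simp add: bnd_diff bnd_scale)
  from H2[OF this assms(3)] show ?thesis by (metis dvd_triv_left eq_iff_diff_eq_0)
qed

text \<open>One degree lower: the boundary of \<open>z\<close> is \<open>p\<close> times some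
  \<open>y\<close> of total weight 0, so \<open>y\<close> is the boundary of some \<open>w\<close>,
  and \<open>z\<close> minus \<open>p\<close> times \<open>w\<close> is an integral cycle, thus a
  boundary.\<close>

lemma H1_mod:
  fixes z :: "'v set \<Rightarrow> int"
  assumes "p \<noteq> 0" "\<And>v. v \<in> V \<Longrightarrow> p dvd bnd1 num E z v"
  obtains c where "\<And>e. e \<in> E \<Longrightarrow> p dvd (z e - bnd num T c e)"
proof -
  define y where "y v = bnd1 num E z v div p" for v
  have y: "bnd1 num E z v = p * y v" if "v \<in> V" for v using assms(2)[OF that] by (simp add: y_def)
  have "p * (\<Sum>v\<in>V. y v) = (\<Sum>v\<in>V. bnd1 num E z v)" by (simp add: sum_distrib_left y)
  also have "\<dots> = 0" by (rule sum_bnd1)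
  finally have "(\<Sum>v\<in>V. y v) = 0" using assms(1) by (metis mult_eq_0_iff)
  then obtain w where w: "\<And>v. v \<in> V \<Longrightarrow> bnd1 num E w v = y v" using sum_zero_chain by blast
  have "bnd1 num E (\<lambda>e. z e - p * w e) v = 0" if "v \<in> V" for v
    using y[OF that] w[OF that] by (simp add: bnd1_diff bnd1_scale)
  then obtain c where c: "\<forall>e\<in>E. z e - p * w e = bnd num T c e" using H1 by blast
  have "z e - bnd num T c e = p * w e" if "e \<in> E" for e using c that by (metis add.commute diff_diff_eq2 add_diff_cancel_right')
  then show thesis using that by (metis dvd_triv_left)
qed

lemma sg_of_int: "of_int (sg num x y) = (sg num x y :: 'f::comm_ring_1)"
  by (auto simp: sg_def)

lemma inc_of_int: "of_int (inc num t e) = (inc num t e :: 'f::comm_ring_1)"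
  by (simp add: inc_def sg_of_int)

lemma sp_of_int: "of_int (sp num e v) = (sp num e v :: 'f::comm_ring_1)"
  by (simp add: sp_def sg_of_int)

lemma bnd_of_int: "of_int (bnd num T c e) = (bnd num T (\<lambda>t. of_int (c t)) e :: 'f::comm_ring_1)"
  by (simp add: bnd_def inc_of_int)

lemma bnd1_of_int: "of_int (bnd1 num E c e) = (bnd1 num E (\<lambda>t. of_int (c t)) e :: 'f::comm_ring_1)"
  by (simp add: bnd1_def sp_of_int)

lemma H2_mod_3:
  fixes c :: "'v set \<Rightarrow> 3"
  assumes "\<And>e. e \<in> E \<Longrightarrow> bnd num T c e = 0" "t \<in> T"
  shows "c t = 0"
proof -
  obtain d :: "'v set \<Rightarrow> int" where d: "\<And>t. of_int (d t) = c t" using lift_mod_3[of c] by blast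
  have "of_int (bnd num T d e) = bnd num T c e" for e by (simp add: bnd_of_int d)
  then have "3 dvd bnd num T d e" if "e \<in> E" for e using assms(1)[OF that] of_int_eq_0_mod_3 by metis
  then have "3 dvd d t" using H2_mod[of 3 d t] assms(2) by simp
  then show ?thesis using d of_int_eq_0_mod_3 by metis
qed

lemma odd_inc:
  assumes "t \<in> T" "e \<subseteq> t" shows "odd (inc num t e :: int)"
proof -
  have sg: "odd (sg num a x :: int)" if "a \<in> e" "x \<in> t - e" for a x
    using num_neq[of a x] that assms T_sub by (auto simp: sg_def)
  have prod: "odd (prod f A)" if "finite A" "\<And>x. x \<in> A \<Longrightarrow> odd (f x)" for f :: "'v \<Rightarrow> int" and A
    using that by (induction A rule: finite_induct) auto
  show ?thesis unfolding inc_def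
    by (intro prod sg) (use finite_subset[OF assms(2) fin_tri[OF assms(1)]] fin_tri[OF assms(1)] in auto)
qed

text \<open>Incidence numbers are odd, so modulo 2 the boundary of an indicator chain merely counts
  triangles.\<close>

lemma H2_mod_2:
  assumes "B \<subseteq> T" "\<And>e. e \<in> E \<Longrightarrow> even (card (tri_at B e))"
  shows "B = {}"
proof -
  define c :: "'v set \<Rightarrow> int" where "c t = (if t \<in> B then 1 else 0)" for t
  have "even (bnd num T c e)" if "e \<in> E" for e
  proof -
    have fin: "finite (tri_at B e)" using fin_T assms(1) by (auto simp: tri_at_def intro: finite_subset)
    have "bnd num T c e = (\<Sum>t\<in>tri_at B e. inc num t e)"
      unfolding bnd_def by (rule sum.mono_neutral_cong_right) (use fin_T assms(1) in \<open>auto simp: tri_at_def c_def\<close>)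
    moreover have "even (\<Sum>t\<in>A. inc num t e :: int) \<longleftrightarrow> even (card A)" if "finite A" "A \<subseteq> tri_at B e" for A
      using that odd_inc[of _ e] assms(1) by (induction A rule: finite_induct) (auto simp: tri_at_def subset_iff)
    ultimately show ?thesis using assms(2)[OF that] fin by simp
  qed
  then have "even (c t)" if "t \<in> T" for t using H2_mod[of 2 c t] that by simp
  then have "even (c t)" if "t \<in> B" for t using that assms(1) by blast
  moreover have "odd (c t)" if "t \<in> B" for t using that by (simp add: c_def)
  ultimately show ?thesis by blast
qed

text \<open>The augmented chain complex over the field with three elements is exact, so the orders
  of its groups multiply up. Working modulo 3 makes these groups finite.\<close>

lemma euler: "card E + 1 = card V + card T"
proof -
  define d2 where "d2 c = (\<lambda>e. if e \<in> E then bnd num T c e else 0)" for c :: "'v set \<Rightarrow> 3"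
  define d1 where "d1 z = (\<lambda>v. if v \<in> V then bnd1 num E z v else 0)" for z :: "'v set \<Rightarrow> 3"
  define d0 where "d0 y = (\<Sum>v\<in>V. y v)" for y :: "'v \<Rightarrow> 3"
  have c2: "card (supp_funs T :: ('v set \<Rightarrow> 3) set) = card {c \<in> supp_funs T. d2 c = 0} * card (d2 ` supp_funs T)"
    by (rule card_eq_card_ker_times_card_image[OF finite_supp_funs[OF fin_T]])
       (auto simp: supp_funs_def d2_def fun_eq_iff bnd_minus)
  have c1: "card (supp_funs E :: ('v set \<Rightarrow> 3) set) = card {c \<in> supp_funs E. d1 c = 0} * card (d1 ` supp_funs E)"
    by (rule card_eq_card_ker_times_card_image[OF finite_supp_funs[OF fin_E]])
       (auto simp: supp_funs_def d1_def fun_eq_iff bnd1_minus)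
  have c0: "card (supp_funs V :: ('v \<Rightarrow> 3) set) = card {c \<in> supp_funs V. d0 c = 0} * card (d0 ` supp_funs V)"
    by (rule card_eq_card_ker_times_card_image[OF finite_supp_funs[OF finite_V]])
       (auto simp: supp_funs_def d0_def sum_subtractf)
  have "{c \<in> supp_funs T. d2 c = 0} = {0}"
  proof -
    have "c t = 0" if "c \<in> supp_funs T" "d2 c = 0" for c t
    proof (cases "t \<in> T")
      case True
      have "bnd num T c e = 0" if "e \<in> E" for e using fun_cong[OF \<open>d2 c = 0\<close>, of e] that by (simp add: d2_def)
      then show ?thesis using H2_mod_3 True by blast
    qed (use that in \<open>auto simp: supp_funs_def\<close>)
    then show ?thesis by (auto simp: supp_funs_def d2_def fun_eq_iff bnd_def)
  qed
  then have k2: "card (d2 ` supp_funs T) = 3 ^ card T" using c2 by (simp add: card_supp_funs fin_T)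
  have k1: "{z \<in> supp_funs E. d1 z = 0} = d2 ` supp_funs T"
  proof (intro subset_antisym subsetI)
    fix z assume z: "z \<in> {z \<in> supp_funs E. d1 z = 0}"
    obtain y :: "'v set \<Rightarrow> int" where y: "\<And>t. of_int (y t) = z t" using lift_mod_3[of z] by blast
    have "of_int (bnd1 num E y v) = bnd1 num E z v" for v by (simp add: bnd1_of_int y)
    moreover have "bnd1 num E z v = 0" if "v \<in> V" for v
    proof -
      have "d1 z v = 0" using z by simp
      then show ?thesis using that by (simp add: d1_def)
    qed
    ultimately have "3 dvd bnd1 num E y v" if "v \<in> V" for v using that of_int_eq_0_mod_3 by metis
    then obtain c where c: "\<And>e. e \<in> E \<Longrightarrow> 3 dvd (y e - bnd num T c e)" using H1_mod[of 3 y] by auto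
    have eq: "z e = bnd num T (\<lambda>t. of_int (c t)) e" if "e \<in> E" for e
    proof -
      have "of_int (y e - bnd num T c e) = (0::3)" using c[OF that] of_int_eq_0_mod_3 by metis
      then show ?thesis by (simp add: y bnd_of_int)
    qed
    define c' :: "'v set \<Rightarrow> 3" where "c' t = (if t \<in> T then of_int (c t) else 0)" for t
    have "bnd num T c' e = bnd num T (\<lambda>t. of_int (c t)) e" for e
      unfolding bnd_def by (rule sum.cong) (auto simp: c'_def tri_at_def)
    then have "z = d2 c'" using eq z by (auto simp: d2_def fun_eq_iff supp_funs_def)
    moreover have "c' \<in> supp_funs T" by (auto simp: c'_def supp_funs_def)
    ultimately show "z \<in> d2 ` supp_funs T" by blast
  next
    fix z assume "z \<in> d2 ` supp_funs T"
    then obtain c where c: "z = d2 c" by auto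
    have "bnd1 num E (d2 c) v = bnd1 num E (bnd num T c) v" for v
      unfolding bnd1_def by (rule sum.cong) (auto simp: d2_def)
    then show "z \<in> {z \<in> supp_funs E. d1 z = 0}"
      unfolding c by (auto simp: supp_funs_def d1_def fun_eq_iff bnd1_bnd) (simp add: d2_def)
  qed
  have i1: "d1 ` supp_funs E = {y \<in> supp_funs V. d0 y = 0}"
  proof (intro subset_antisym subsetI)
    fix y assume "y \<in> d1 ` supp_funs E"
    then show "y \<in> {y \<in> supp_funs V. d0 y = 0}"
      by (auto simp: supp_funs_def d0_def d1_def sum_bnd1)
  next
    fix y assume y: "y \<in> {y \<in> supp_funs V. d0 y = 0}"
    then have "(\<Sum>v\<in>V. y v) = 0" by (simp add: d0_def)
    then obtain z where z: "\<And>v. v \<in> V \<Longrightarrow> bnd1 num E z v = y v" using sum_zero_chain by blast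
    define z' where "z' e = (if e \<in> E then z e else 0)" for e
    have "bnd1 num E z' v = bnd1 num E z v" for v
      unfolding bnd1_def by (rule sum.cong) (auto simp: z'_def)
    then have "y = d1 z'" using z y by (auto simp: d1_def fun_eq_iff supp_funs_def)
    moreover have "z' \<in> supp_funs E" by (auto simp: z'_def supp_funs_def)
    ultimately show "y \<in> d1 ` supp_funs E" by blast
  qed
  have "d0 ` supp_funs V = UNIV"
  proof -
    obtain v0 where v0: "v0 \<in> V" using V_ne by auto
    have "x \<in> d0 ` supp_funs V" for x
    proof
      show "x = d0 (\<lambda>v. if v = v0 then x else 0)" using v0 finite_V by (simp add: d0_def)
    qed (use v0 in \<open>auto simp: supp_funs_def\<close>)
    then show ?thesis by blast
  qed
  then have k0: "3 ^ card V = card {y \<in> supp_funs V. d0 y = 0} * 3" using c0 by (simp add: card_supp_funs finite_V)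
  have "(3::nat) ^ (card E + 1) = 3 * 3 ^ card E" by simp
  also have "(3::nat) ^ card E = card (d2 ` supp_funs T) * card (d1 ` supp_funs E)"
    using c1 k1 by (simp add: card_supp_funs fin_E)
  also have "3 * \<dots> = (3::nat) ^ (card V + card T)" using k2 k0 i1 by (simp add: power_add)
  finally show ?thesis by (metis power_inject_exp one_less_numeral_iff semiring_norm(77))
qed

end

section \<open>The greedy collapse\<close>

definition abs_collapse :: "'v set set \<Rightarrow> 'v set set \<Rightarrow> bool" where
  "abs_collapse K L \<longleftrightarrow> (\<exists>s\<in>K. \<exists>f\<in>K. f \<noteq> {} \<and> f \<subseteq> s \<and> card s = card f + 1 \<and>
     (\<forall>r\<in>K. f \<subseteq> r \<longrightarrow> r = s \<or> r = f) \<and> L = K - {s,f})"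

text \<open>The empty simplex is listed because the geometric complexes contain it; no collapse
  removes it.\<close>

definition cells :: "'v set \<Rightarrow> 'v set set \<Rightarrow> 'v set set \<Rightarrow> 'v set set" where
  "cells V E T = {{}} \<union> (\<lambda>v. {v}) ` V \<union> E \<union> T"

text \<open>The first two conditions are bounds from above and pass to every set of remaining
  triangles. The third passes only at vertices where the triple edges survive, which is the delicate
  point of the next proof.\<close>

locale locally_simple = acyclic_complex2 +
  assumes deg_le: "e \<in> E \<Longrightarrow> card (tri_at T e) \<le> 3"
    and few_triple: "card {e\<in>E. v \<in> e \<and> card (tri_at T e) = 3} \<le> 2"
    and separating: "\<lbrakk>e \<in> E; card (tri_at T e) = 3; v \<in> e; t \<in> tri_at T e; t' \<in> tri_at T e;
       (t,t') \<in> (adj_across T {e\<in>E. card (tri_at T e) = 2 \<and> v \<in> e})\<^sup>*\<rbrakk> \<Longrightarrow> t = t'"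
begin

lemma tri_at_edge: "S \<subseteq> T \<Longrightarrow> e \<notin> edges_of S \<Longrightarrow> card e = 2 \<Longrightarrow> tri_at S e = {}"
  by (auto simp: edges_of_def tri_at_def)

text \<open>Without a free edge the remaining triangles would satisfy \<open>residual\<close>, which
  is contradictory. The graph \<open>F\<close> also keeps the edges that no longer lie in a
  triangle.\<close>

lemma free_edge_exists:
  assumes S: "S \<subseteq> T" "S \<noteq> {}" and F: "F \<subseteq> E" "edges_of S \<subseteq> F" "cut_connected V F"
    and count: "card F + 1 = card V + card S"
  obtains e where "e \<in> F" "card (tri_at S e) = 1"
proof (rule ccontr)
  assume "\<not> thesis"
  then have nofree: "\<forall>e\<in>F. card (tri_at S e) \<noteq> 1" using that by blast
  have finS: "finite S" using S fin_T finite_subset by blast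
  have ES: "edges_of S \<subseteq> E" using F by blast
  have finE: "finite {e\<in>edges_of S. P e}" for P
    by (rule finite_subset[OF _ fin_E]) (use ES in blast)
  have sub: "tri_at S e \<subseteq> tri_at T e" for e using S by (auto simp: tri_at_def)
  have fin: "finite (tri_at T e)" for e using fin_T by (auto simp: tri_at_def)
  have le: "card (tri_at S e) \<le> card (tri_at T e)" for e using sub fin by (simp add: card_mono)
  have deg: "card (tri_at S e) = 2 \<or> card (tri_at S e) = 3" if "e \<in> edges_of S" for e
  proof -
    have "tri_at S e \<noteq> {}" using that by (auto simp: edges_of_def tri_at_def)
    then have "card (tri_at S e) \<noteq> 0" using finite_subset[OF sub fin] by simp
    moreover have "card (tri_at S e) \<noteq> 1" using nofree F that by blast
    moreover have "card (tri_at S e) \<le> 3" using le[of e] deg_le[of e] that ES by force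
    ultimately show ?thesis by linarith
  qed
  let ?D = "\<lambda>v. {e \<in> edges_of S. v \<in> e \<and> card (tri_at S e) = 3}"
  let ?B = "\<lambda>v. {e\<in>E. v \<in> e \<and> card (tri_at T e) = 3}"
  have DB: "?D v \<subseteq> ?B v" for v
  proof
    fix e assume e: "e \<in> ?D v"
    then have "card (tri_at T e) = 3" using le[of e] deg_le[of e] ES by force
    then show "e \<in> ?B v" using e ES by blast
  qed
  have finB: "finite (?B v)" for v using fin_E by simp
  \<comment> \<open>By \<open>vertex_parity\<close> the number of triple edges at \<open>v\<close>
    is even, and it is at most 2.\<close>
  have deg3: "card (?D v) \<in> {0,2}" for v
  proof -
    let ?A = "{t\<in>S. v \<in> t}"
    have "(\<Sum>e | e \<in> edges_of S \<and> v \<in> e. card (tri_at ?A e)) = 2 * card ?A"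
    proof (rule vertex_parity)
      show "e \<in> edges_of S" if "t \<in> ?A" "card e = 2" "v \<in> e" "e \<subseteq> t" for t e
        using that by (auto simp: edges_of_def)
      show "finite (edges_of S)" using finite_subset[OF ES fin_E] .
    qed (use finS S T_sub in \<open>auto simp: edges_of_def\<close>)
    moreover have "(\<Sum>e | e \<in> edges_of S \<and> v \<in> e. card (tri_at ?A e)) = (\<Sum>e | e \<in> edges_of S \<and> v \<in> e. card (tri_at S e))"
      by (rule sum.cong) (auto simp: tri_at_def intro!: arg_cong[of _ _ card])
    moreover have "(\<Sum>e | e \<in> edges_of S \<and> v \<in> e. card (tri_at S e))
        = (\<Sum>e | e \<in> edges_of S \<and> v \<in> e. 2 + (if card (tri_at S e) = 3 then 1 else 0))"
      by (rule sum.cong) (use deg in force)+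
    moreover have "\<dots> = 2 * card {e \<in> edges_of S. v \<in> e} + card (?D v)"
    proof -
      have fs: "finite {e. e \<in> edges_of S \<and> v \<in> e}" by (rule finE)
      have I: "{e. e \<in> edges_of S \<and> v \<in> e} \<inter> {e. card (tri_at S e) = 3} = ?D v" by blast
      show ?thesis unfolding sum.distrib by (simp add: sum.If_cases[OF fs] I)
    qed
    ultimately have "even (card (?D v))" by presburger
    moreover have "card (?D v) \<le> 2" using card_mono[OF finB DB, of v] few_triple[of v] by linarith
    ultimately show ?thesis by (auto simp: le_Suc_eq numeral_2_eq_2)
  qed
  interpret residual S num
  proof
    show "card (?D v) \<in> {0,2}" for v by (rule deg3)
    show "card t = 3" if "t \<in> S" for t using that S T_sub by blast
    have US: "\<Union>S \<subseteq> V" using S T_sub by blast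
    show "inj_on num (\<Union>S)" by (rule inj_on_subset[OF inj US])
    show "card (tri_at S e) = 2 \<or> card (tri_at S e) = 3" if "e \<in> edges_of S" for e using deg that .
    show "t = t'" if e: "e \<in> edges_of S" "card (tri_at S e) = 3" "v \<in> e" "t \<in> tri_at S e" "t' \<in> tri_at S e"
        and path: "(t,t') \<in> (adj_across S {e \<in> edges_of S. card (tri_at S e) = 2 \<and> v \<in> e})\<^sup>*" for e v t t'
    proof -
      have "e \<in> ?D v" using e by blast
      then have ne: "?D v \<noteq> {}" by blast
      have "finite (?D v)" by (rule finE)
      then have "card (?D v) \<noteq> 0" using ne card_0_eq by blast
      then have "card (?D v) = 2" using deg3[of v] by (metis insertE singletonD)
      \<comment> \<open>One triple edge of \<open>S\<close> at \<open>v\<close> forces a second one,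
        and \<open>T\<close> has at most two there; so every triple edge of \<open>T\<close> at
        \<open>v\<close> is still triple in \<open>S\<close>. Hence a double edge of
        \<open>S\<close> at \<open>v\<close> was never triple, and a chain of adjacent triangles in
        \<open>S\<close> is one in \<open>T\<close>.\<close>
      then have D2: "?D v = ?B v"
        using few_triple[of v] by (intro card_seteq[OF finB DB]) simp
      have "adj_across S {e \<in> edges_of S. card (tri_at S e) = 2 \<and> v \<in> e} \<subseteq> adj_across T {e\<in>E. card (tri_at T e) = 2 \<and> v \<in> e}"
      proof -
        have "card (tri_at T x) = 2" if x: "x \<in> edges_of S" "card (tri_at S x) = 2" "v \<in> x" for x
        proof -
          have "card (tri_at T x) \<noteq> 3"
          proof
            assume "card (tri_at T x) = 3"
            then have "x \<in> ?D v" unfolding D2 using x ES by blast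
            then show False using x(2) by simp
          qed
          then show ?thesis using le[of x] x deg_le[of x] ES by force
        qed
        then have "{e \<in> edges_of S. card (tri_at S e) = 2 \<and> v \<in> e} \<subseteq> {e\<in>E. card (tri_at T e) = 2 \<and> v \<in> e}"
          using ES by blast
        then show ?thesis using S(1) unfolding adj_across_def by blast
      qed
      then have "(t,t') \<in> (adj_across T {e\<in>E. card (tri_at T e) = 2 \<and> v \<in> e})\<^sup>*"
        using path rtrancl_mono by blast
      moreover have "e \<in> E" "card (tri_at T e) = 3" using \<open>e \<in> ?D v\<close> DB[of v] by blast+
      ultimately show ?thesis using separating e(3-5) sub by blast
    qed
    show "card (edges_of S) + 1 \<le> card (\<Union>S) + card S"
    proof -
      obtain t where t: "t \<in> S" using S by blast
      then have "t \<noteq> {}" using S T_sub by force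
      then have "\<Union>S \<noteq> {}" using t by blast
      \<comment> \<open>The part of the graph outside the triangles has at least as many edges as
        vertices; this turns the equation for \<open>F\<close> and \<open>S\<close> into the
        inequality required of \<open>S\<close> alone.\<close>
      then have "card (V - \<Union>S) \<le> card {e\<in>F. \<not> e \<subseteq> \<Union>S}"
        using card_edges_outside[OF F(3) finite_V finite_subset[OF F(1) fin_E] _ US] F(1) E_sub by blast
      moreover have "card (edges_of S) + card {e\<in>F. \<not> e \<subseteq> \<Union>S} \<le> card F"
      proof -
        have "edges_of S \<inter> {e\<in>F. \<not> e \<subseteq> \<Union>S} = {}" by (auto simp: edges_of_def)
        then have "card (edges_of S) + card {e\<in>F. \<not> e \<subseteq> \<Union>S} = card (edges_of S \<union> {e\<in>F. \<not> e \<subseteq> \<Union>S})"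
          using finite_subset[OF F(1) fin_E] F(2) by (subst card_Un_disjoint) (auto intro: finite_subset)
        also have "\<dots> \<le> card F" by (rule card_mono) (use finite_subset[OF F(1) fin_E] F(2) in auto)
        finally show ?thesis .
      qed
      moreover have "card (V - \<Union>S) + card (\<Union>S) = card V"
        using US finite_V by (metis add.commute card_Diff_subset card_mono finite_subset le_add_diff_inverse)
      ultimately show ?thesis using count by linarith
    qed
    show "B = {}" if "B \<subseteq> S" "\<And>e. e \<in> edges_of S \<Longrightarrow> even (card (tri_at B e))" for B
    proof (rule H2_mod_2)
      show "B \<subseteq> T" using that S by blast
      show "even (card (tri_at B e))" if "e \<in> E" for e
      proof (cases "e \<in> edges_of S")
        case False
        have "tri_at B e \<subseteq> tri_at S e" using \<open>B \<subseteq> S\<close> by (auto simp: tri_at_def)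
        then have "tri_at B e = {}" using tri_at_edge[OF S(1) False] E_sub that by blast
        then show ?thesis by simp
      qed (use \<open>\<And>e. e \<in> edges_of S \<Longrightarrow> even (card (tri_at B e))\<close> in simp)
    qed
    show "c t = 0" if c: "\<And>e. e \<in> edges_of S \<Longrightarrow> bnd num S (c :: 'a set \<Rightarrow> 3) e = 0" "t \<in> S" for c t
    proof -
      define c' where "c' t = (if t \<in> S then c t else 0)" for t
      have eq: "bnd num T c' e = bnd num S c e" for e
        unfolding bnd_def by (rule sum.mono_neutral_cong_right) (use fin sub in \<open>auto simp: c'_def tri_at_def\<close>)
      have "bnd num T c' e = 0" if "e \<in> E" for e
      proof (cases "e \<in> edges_of S")
        case False
        then have "tri_at S e = {}" using tri_at_edge[OF S(1) False] E_sub that by blast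
        then show ?thesis unfolding eq by (simp add: bnd_def)
      qed (use c eq in simp)
      then have "c' t = 0" using H2_mod_3 c(2) S by blast
      then show ?thesis using c(2) by (simp add: c'_def)
    qed
  qed (use S finS in auto)
  show False by (rule residual_False)
qed

text \<open>A cut that separates \<open>a\<close> from \<open>b\<close> separates \<open>c\<close>
  from one of them, so it is also crossed by \<open>{a,c}\<close> or \<open>{b,c}\<close>.\<close>

lemma cut_connected_remove:
  assumes conn: "cut_connected V F" and t: "{a,b,c} \<in> S" "card {a,b,c} = 3" and F: "edges_of S \<subseteq> F" and V: "{a,b,c} \<subseteq> V"
  shows "cut_connected V (F - {{a,b}})"
  unfolding cut_connected_def
proof (intro allI impI)
  fix A assume A: "A \<subseteq> V" "A \<noteq> {}" "A \<noteq> V"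
  then obtain e where e: "e \<in> F" "e \<inter> A \<noteq> {}" "\<not> e \<subseteq> A" using conn unfolding cut_connected_def by blast
  have ne: "a \<noteq> b" "b \<noteq> c" "a \<noteq> c" using t(2) by (auto simp: card_insert_if split: if_splits)
  have "{a,c} \<in> edges_of S" "{b,c} \<in> edges_of S" using t(1) ne by (auto simp: edges_of_def intro!: bexI[of _ "{a,b,c}"])
  then have ac: "{a,c} \<in> F - {{a,b}}" "{b,c} \<in> F - {{a,b}}" using F ne by (auto simp: doubleton_eq_iff)
  show "\<exists>e\<in>F - {{a,b}}. e \<inter> A \<noteq> {} \<and> \<not> e \<subseteq> A"
  proof (cases "e = {a,b}")
    case True
    have "({a,c} \<inter> A \<noteq> {} \<and> \<not> {a,c} \<subseteq> A) \<or> ({b,c} \<inter> A \<noteq> {} \<and> \<not> {b,c} \<subseteq> A)"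
      using e(2,3) unfolding True by auto
    then show ?thesis
      by (elim disjE) (rule bexI[OF _ ac(1)], assumption, rule bexI[OF _ ac(2)], assumption)
  next
    case False
    then have "e \<in> F - {{a,b}}" using e(1) by simp
    then show ?thesis using e(2,3) by (intro bexI[of _ e]) simp_all
  qed
qed

section \<open>The collapse of triangles and then of leaves\<close>

lemma cells_collapse_triangle:
  assumes S: "S \<subseteq> T" and F: "F \<subseteq> E" "edges_of S \<subseteq> F" and e: "e \<in> F" "card (tri_at S e) = 1"
  obtains t where "t \<in> S" "e \<subseteq> t" "abs_collapse (cells V F S) (cells V (F - {e}) (S - {t}))"
    "edges_of (S - {t}) \<subseteq> F - {e}"
proof -
  obtain t where t: "tri_at S e = {t}" using e(2) by (metis One_nat_def card_1_singletonE)
  then have tS: "t \<in> S" "e \<subseteq> t" by (auto simp: tri_at_def)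
  have ce: "card e = 2" "card t = 3" using E_sub T_sub F S e tS by blast+
  have uni: "r = t" if "r \<in> S" "e \<subseteq> r" for r using t that by (auto simp: tri_at_def)
  have cF: "card x = 2" if "x \<in> F" for x using that F E_sub by blast
  have cS: "card x = 3" if "x \<in> S" for x using that S T_sub by blast
  have "abs_collapse (cells V F S) (cells V (F - {e}) (S - {t}))"
    unfolding abs_collapse_def
  proof (intro bexI conjI ballI impI)
    show "e \<noteq> {}" using ce by auto
    show "card t = card e + 1" using ce by simp
    show "cells V (F - {e}) (S - {t}) = cells V F S - {t, e}"
    proof -
      have "x \<noteq> t" "x \<noteq> e" if "x \<in> {{}} \<union> (\<lambda>v. {v}) ` V" for x using that ce by auto
      moreover have "x \<noteq> t" if "x \<in> F" for x using cF[OF that] ce by auto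
      moreover have "x \<noteq> e" if "x \<in> S" for x using cS[OF that] ce by auto
      ultimately show ?thesis unfolding cells_def by auto
    qed
    fix r assume r: "r \<in> cells V F S" "e \<subseteq> r"
    from r(1) consider "r \<in> {{}} \<union> (\<lambda>v. {v}) ` V" | "r \<in> F" | "r \<in> S" unfolding cells_def by blast
    then show "r = t \<or> r = e"
    proof cases
      case 1
      then have "card e \<le> 1" using r(2) by (auto dest: subset_singletonD)
      then show ?thesis using ce by simp
    next
      case 2
      then have "e = r" using card_subset_eq[of r e] r(2) cF[OF 2] ce card.infinite[of r] by fastforce
      then show ?thesis by simp
    qed (use uni r in blast)
  qed (use tS e in \<open>auto simp: cells_def\<close>)
  moreover have "edges_of (S - {t}) \<subseteq> F - {e}"
    using F(2) uni by (auto simp: edges_of_def)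
  ultimately show thesis using that tS by blast
qed

text \<open>Every collapse removes one edge and one triangle, so the Euler count and the
  connectedness of the graph persist. The last triangle is kept as the future disc, and the count
  then says that edges and vertices are equal in number.\<close>

lemma collapse_triangles:
  assumes "S \<subseteq> T" "S \<noteq> {}" "F \<subseteq> E" "edges_of S \<subseteq> F" "cut_connected V F" "card F + 1 = card V + card S"
  shows "\<exists>F' t. t \<in> T \<and> F' \<subseteq> E \<and> edges_of {t} \<subseteq> F' \<and> cut_connected V F' \<and> card F' = card V
     \<and> abs_collapse\<^sup>*\<^sup>* (cells V F S) (cells V F' {t})"
  using assms
proof (induction "card S" arbitrary: S F rule: less_induct)
  case less
  have finS: "finite S" using less.prems fin_T finite_subset by blast
  show ?case
  proof (cases "card S = 1")
    case True
    then obtain t where "S = {t}" by (metis One_nat_def card_1_singletonE)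
    then show ?thesis using less.prems by (intro exI[of _ F] exI[of _ t]) auto
  next
    case False
    obtain e where e: "e \<in> F" "card (tri_at S e) = 1"
      using free_edge_exists[OF less.prems] by blast
    obtain t where t: "t \<in> S" "e \<subseteq> t" "abs_collapse (cells V F S) (cells V (F - {e}) (S - {t}))"
      "edges_of (S - {t}) \<subseteq> F - {e}"
      using cells_collapse_triangle[OF less.prems(1,3,4) e] by blast
    have "card e = 2" "card t = 3" "t \<subseteq> V" using e t less.prems E_sub T_sub by blast+
    then obtain a b where ab: "e = {a,b}" "a \<noteq> b" by (meson card_2_iff)
    have "card (t - {a,b}) = 1" using \<open>card t = 3\<close> t(2) ab by (simp add: card_Diff_subset)
    then obtain c where "t - {a,b} = {c}" by (metis One_nat_def card_1_singletonE)
    then have c: "t = {a,b,c}" using t(2) ab by blast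
    have conn': "cut_connected V (F - {e})"
      using cut_connected_remove[OF less.prems(5), of a b c S] t(1) \<open>card t = 3\<close> \<open>t \<subseteq> V\<close> less.prems(4) c ab by simp
    have fF: "finite F" using less.prems fin_E finite_subset by blast
    have cardS: "card (S - {t}) + 1 = card S" using t finS by (metis Suc_eq_plus1 card_Suc_Diff1)
    have cardF: "card (F - {e}) + 1 = card F" using e fF by (metis Suc_eq_plus1 card_Suc_Diff1)
    have "\<exists>F' t'. t' \<in> T \<and> F' \<subseteq> E \<and> edges_of {t'} \<subseteq> F' \<and> cut_connected V F' \<and> card F' = card V
       \<and> abs_collapse\<^sup>*\<^sup>* (cells V (F - {e}) (S - {t})) (cells V F' {t'})"
    proof (rule less.hyps)
      show "S - {t} \<noteq> {}"
      proof
        assume "S - {t} = {}"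
        then have "S = {t}" using t(1) by blast
        then show False using False by simp
      qed
    qed (use cardS cardF less.prems t conn' in auto)
    then show ?thesis using t(3) by (meson converse_rtranclp_into_rtranclp)
  qed
qed

text \<open>There are as many edges not inside \<open>t\<close> as vertices outside it. Each such
  edge has at most two vertices outside \<open>t\<close>, and one that leaves \<open>t\<close> has
  only one. So the degrees outside \<open>t\<close> add up to less than twice the number of vertices
  there, and some vertex has degree at most 1; connectedness excludes degree 0.\<close>

lemma collapse_leaves:
  assumes "t \<subseteq> W" "W \<subseteq> V" "F \<subseteq> E" "\<Union>F \<subseteq> W" "{e. card e = 2 \<and> e \<subseteq> t} \<subseteq> F" "cut_connected W F" "card F = card W" "t \<in> T"
  shows "abs_collapse\<^sup>*\<^sup>* (cells W F {t}) (Pow t)"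
  using assms(1-7)
proof (induction "card W" arbitrary: W F rule: less_induct)
  case less
  have finW: "finite W" using less.prems finite_V finite_subset by blast
  have finF: "finite F" using less.prems fin_E finite_subset by blast
  have ct: "card t = 3" using assms(8) T_sub by blast
  have fint: "finite t" using ct card.infinite by force
  have cF: "card e = 2" if "e \<in> F" for e using that less.prems E_sub by blast
  have t2: "card {e. card e = 2 \<and> e \<subseteq> t} = 3"
    using n_subsets[OF fint, of 2] ct by (simp add: conj_commute choose_two)
  show ?case
  proof (cases "W = t")
    case True
    have "{e. card e = 2 \<and> e \<subseteq> t} = F"
      using card_subset_eq[OF finF less.prems(5)] t2 less.prems(7) True ct by simp
    then have "cells W F {t} = Pow t"
    proof -
      assume F: "{e. card e = 2 \<and> e \<subseteq> t} = F"
      have "x \<in> cells W F {t}" if x: "x \<subseteq> t" for x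
      proof -
        have "card x \<le> 3" using x fint ct by (metis card_mono)
        then consider "card x = 0" | "card x = 1" | "card x = 2" | "card x = 3" by linarith
        then show ?thesis
        proof cases
          case 1 then have "x = {}" using finite_subset[OF x fint] by simp
          then show ?thesis by (simp add: cells_def)
        next
          case 2 then obtain v where "x = {v}" by (metis One_nat_def card_1_singletonE)
          then show ?thesis using x True by (auto simp: cells_def)
        next
          case 3 then show ?thesis using x F by (auto simp: cells_def)
        next
          case 4 then have "x = t" using x fint ct by (simp add: card_subset_eq)
          then show ?thesis by (auto simp: cells_def)
        qed
      qed
      then show ?thesis using F True by (auto simp: cells_def)
    qed
    then show ?thesis by simp
  next
    case False
    define d where "d v = card {e\<in>F. v \<in> e}" for v
    have sum_d: "(\<Sum>v\<in>W - t. d v) = (\<Sum>e\<in>F. card (e - t))"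
    proof -
      have "(\<Sum>v\<in>W - t. d v) = (\<Sum>v\<in>W - t. \<Sum>e | e \<in> F \<and> v \<in> e. 1)" by (simp add: d_def)
      also have "\<dots> = (\<Sum>e\<in>F. \<Sum>v | v \<in> W - t \<and> v \<in> e. 1)"
        by (rule sum.swap_restrict) (use finW finF in auto)
      also have "\<dots> = (\<Sum>e\<in>F. card (e - t))"
      proof (rule sum.cong[OF refl])
        fix e assume "e \<in> F"
        then have "{v. v \<in> W - t \<and> v \<in> e} = e - t" using less.prems(4) by auto
        then show "(\<Sum>v | v \<in> W - t \<and> v \<in> e. 1) = card (e - t)" by simp
      qed
      finally show ?thesis .
    qed
    let ?I = "{e\<in>F. \<not> e \<subseteq> t}"
    have cI: "card ?I = card W - 3"
    proof -
      have "F = {e. card e = 2 \<and> e \<subseteq> t} \<union> ?I" using less.prems(5) cF by auto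
      moreover have "card ({e. card e = 2 \<and> e \<subseteq> t} \<union> ?I) = card {e. card e = 2 \<and> e \<subseteq> t} + card ?I"
        by (rule card_Un_disjoint) (use finF less.prems(5) finite_subset in auto)
      ultimately have "card F = 3 + card ?I" using t2 by simp
      then show ?thesis using less.prems(7) by simp
    qed
    obtain a w where aw: "{a,w} \<in> F" "a \<in> t" "w \<in> W" "w \<notin> t"
    proof (rule cut_connectedE[OF less.prems(6) _ less.prems(1)])
      show "e \<subseteq> W \<and> card e = 2" if "e \<in> F" for e using cF[OF that] less.prems(4) that by blast
      show "t \<noteq> {}" using ct by auto
    qed (use False in auto)
    have sz: "card (e - t) \<le> 2" if "e \<in> F" for e
      using cF[OF that] by (metis Diff_subset card_mono card.infinite zero_neq_numeral)
    have "(\<Sum>e\<in>F. card (e - t)) = (\<Sum>e\<in>?I. card (e - t))"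
      by (rule sum.mono_neutral_right) (use finF in \<open>auto simp: card_gt_0_iff\<close>)
    also have "\<dots> < (\<Sum>e\<in>?I. 2)"
    proof (rule sum_strict_mono_ex1)
      have "{a,w} - t = {w}" using aw by auto
      then show "\<exists>e\<in>?I. card (e - t) < 2" using aw by (intro bexI[of _ "{a,w}"]) auto
    qed (use finF sz in auto)
    also have "\<dots> = 2 * card (W - t)" using cI ct less.prems(1) finW fint by (simp add: card_Diff_subset)
    finally have lt: "(\<Sum>v\<in>W - t. d v) < (\<Sum>v\<in>W - t. 2)" using sum_d by simp
    obtain v where v: "v \<in> W - t" "d v < 2"
    proof (rule ccontr)
      assume "\<not> thesis"
      then have "\<forall>v\<in>W - t. 2 \<le> d v" using that by fastforce
      then have "(\<Sum>v\<in>W - t. 2) \<le> (\<Sum>v\<in>W - t. d v)" by (intro sum_mono) auto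
      then show False using lt by simp
    qed
    have cut_v: "\<exists>e\<in>F. e \<inter> {v} \<noteq> {} \<and> \<not> e \<subseteq> {v}"
    proof -
      have "t \<noteq> {}" using ct by auto
      then have "{v} \<noteq> W" using v less.prems(1) by blast
      then show ?thesis using less.prems(6)[unfolded cut_connected_def, rule_format, of "{v}"] v by simp
    qed
    then have "{e\<in>F. v \<in> e} \<noteq> {}" by blast
    then have "d v \<noteq> 0" using finF by (simp add: d_def)
    then have "d v = 1" using v by simp
    then obtain e where e: "{e\<in>F. v \<in> e} = {e}" unfolding d_def by (metis One_nat_def card_1_singletonE)
    then have eF: "e \<in> F" "v \<in> e" by blast+
    have uni: "x = e" if "x \<in> F" "v \<in> x" for x using e that by blast
    obtain u where u: "e = {v,u}" "u \<noteq> v" using card_2_other[OF cF[OF eF(1)] eF(2)] by blast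
    have uW: "u \<in> W" using less.prems(4) eF u by blast
    let ?W = "W - {v}" and ?F = "F - {e}"
    have vt: "v \<notin> t" "v \<in> W" using v by auto
    have "abs_collapse (cells W F {t}) (cells ?W ?F {t})"
      unfolding abs_collapse_def
    proof (intro bexI conjI ballI impI)
      show "card e = card {v} + 1" using cF[OF eF(1)] by simp
      show "cells ?W ?F {t} = cells W F {t} - {e, {v}}"
      proof -
        have "{v} \<notin> F" using cF[of "{v}"] by auto
        moreover have "e \<noteq> {x}" "e \<noteq> {}" for x using u by auto
        moreover have "e \<noteq> t" "{v} \<noteq> t" using vt u by auto
        ultimately show ?thesis unfolding cells_def by auto
      qed
      fix r assume r: "r \<in> cells W F {t}" "{v} \<subseteq> r"
      then show "r = e \<or> r = {v}" using uni vt unfolding cells_def by auto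
    qed (use eF vt in \<open>auto simp: cells_def\<close>)
    moreover have "abs_collapse\<^sup>*\<^sup>* (cells ?W ?F {t}) (Pow t)"
    proof (rule less.hyps)
      show "card ?W < card W" using vt finW by (meson card_Diff1_less)
      show "card ?F = card ?W" using vt finW finF eF less.prems(7) by simp
      show "\<Union>?F \<subseteq> ?W" using less.prems(4) uni by blast
      show "{e. card e = 2 \<and> e \<subseteq> t} \<subseteq> ?F" using less.prems(5) eF vt by blast
      show "cut_connected ?W ?F" unfolding cut_connected_def
      proof (intro allI impI)
        fix A assume A: "A \<subseteq> ?W" "A \<noteq> {}" "A \<noteq> ?W"
        \<comment> \<open>The leaf \<open>v\<close> joins the side of its only neighbour
          \<open>u\<close>, so that the removed edge does not cross the cut.\<close>
        define A' where "A' = (if u \<in> A then insert v A else A)"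
        have "A' \<subseteq> W" "A' \<noteq> {}" "A' \<noteq> W" using A vt uW u by (auto simp: A'_def)
        then obtain x where x: "x \<in> F" "x \<inter> A' \<noteq> {}" "\<not> x \<subseteq> A'"
          using less.prems(6) unfolding cut_connected_def by metis
        have "x \<noteq> e" using x u A by (auto simp: A'_def split: if_splits)
        moreover have "v \<notin> x" using uni x(1) \<open>x \<noteq> e\<close> by blast
        ultimately show "\<exists>e\<in>?F. e \<inter> A \<noteq> {} \<and> \<not> e \<subseteq> A"
          using x by (intro bexI[of _ x]) (auto simp: A'_def split: if_splits)
      qed
    qed (use less.prems vt in auto)
    ultimately show ?thesis by (rule converse_rtranclp_into_rtranclp)
  qed
qed

theorem collapses_to_triangle:
  assumes "T \<noteq> {}"
  shows "\<exists>t\<in>T. abs_collapse\<^sup>*\<^sup>* (cells V E T) (Pow t)"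
proof -
  obtain F' t where Ft: "t \<in> T" "F' \<subseteq> E" "edges_of {t} \<subseteq> F'" "cut_connected V F'" "card F' = card V"
     "abs_collapse\<^sup>*\<^sup>* (cells V E T) (cells V F' {t})"
    using collapse_triangles[OF subset_refl assms subset_refl faces conn euler] by blast
  have "abs_collapse\<^sup>*\<^sup>* (cells V F' {t}) (Pow t)"
  proof (rule collapse_leaves)
    show "{e. card e = 2 \<and> e \<subseteq> t} \<subseteq> F'" using Ft(3) by (auto simp: edges_of_def)
    show "\<Union>F' \<subseteq> V" using Ft(2) E_sub by blast
  qed (use Ft T_sub in auto)
  then show ?thesis using Ft by (meson rtranclp_trans)
qed

end

section \<open>Geometric simplicial complexes\<close>

locale scomplex =
  fixes K :: "'a::euclidean_space set set"
  assumes sc: "simplicial_complex K"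
begin

lemma closed_simplex: "\<sigma> \<in> K \<Longrightarrow> closed \<sigma>" "\<sigma> \<in> K \<Longrightarrow> compact \<sigma>" "\<sigma> \<in> K \<Longrightarrow> convex \<sigma>"
  using sc Polytope.closed_simplex Polytope.compact_simplex convex_simplex by (meson simplicial_complex_def)+

text \<open>Simplices are point sets here, and a vertex is recognized by its singleton being in
  \<open>K\<close>. The map \<open>vs\<close> leads to abstract complexes, and the convex hull leads
  back.\<close>

definition vs :: "'a set \<Rightarrow> 'a set" where "vs \<sigma> = {v. {v} \<in> K \<and> v \<in> \<sigma>}"

lemma fin_K: "finite K" using sc by (simp add: simplicial_complex_def)

lemma face_in: "\<sigma> \<in> K \<Longrightarrow> \<tau> face_of \<sigma> \<Longrightarrow> \<tau> \<in> K" using sc by (auto simp: simplicial_complex_def)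

lemma Int_face: "\<sigma> \<in> K \<Longrightarrow> \<tau> \<in> K \<Longrightarrow> (\<sigma> \<inter> \<tau>) face_of \<sigma>" using sc by (auto simp: simplicial_complex_def)

text \<open>A vertex of \<open>K\<close> inside a simplex meets it in a face and so is an extreme
  point of it; conversely the singletons of extreme points are faces and lie in
  \<open>K\<close>.\<close>

lemma simplex_vs:
  assumes "\<sigma> \<in> K"
  shows "\<not> affine_dependent (vs \<sigma>)" "convex hull (vs \<sigma>) = \<sigma>"
proof -
  obtain n C where C: "\<not> affine_dependent C" "\<sigma> = convex hull C"
    using sc assms unfolding simplicial_complex_def simplex_def by meson
  have "vs \<sigma> = C"
  proof (intro subset_antisym subsetI)
    fix v assume "v \<in> vs \<sigma>"
    then have v: "{v} \<in> K" "v \<in> \<sigma>" by (auto simp: vs_def)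
    have "(\<sigma> \<inter> {v}) face_of \<sigma>" by (rule Int_face[OF assms v(1)])
    moreover have "\<sigma> \<inter> {v} = {v}" using v by auto
    ultimately have "v extreme_point_of (convex hull C)" using C(2) by (simp add: face_of_singleton)
    then show "v \<in> C" by (rule extreme_point_of_convex_hull)
  next
    fix v assume v: "v \<in> C"
    then have "v extreme_point_of \<sigma>" using C extreme_point_of_convex_hull_affine_independent by blast
    then have "{v} \<in> K" using face_in[OF assms] by (simp add: face_of_singleton)
    then show "v \<in> vs \<sigma>" using v C by (simp add: vs_def hull_inc)
  qed
  then show "\<not> affine_dependent (vs \<sigma>)" "convex hull (vs \<sigma>) = \<sigma>" using C by auto
qed

lemma finite_vs: "\<sigma> \<in> K \<Longrightarrow> finite (vs \<sigma>)"
  using simplex_vs(1) aff_independent_finite by blast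

lemma hull_in:
  assumes "\<sigma> \<in> K" "A \<subseteq> vs \<sigma>"
  shows "convex hull A \<in> K" "vs (convex hull A) = A"
proof -
  have "(convex hull A) face_of \<sigma>"
    using face_of_convex_hull_affine_independent[OF simplex_vs(1)[OF assms(1)], of "convex hull A"] simplex_vs(2)[OF assms(1)] assms(2) by auto
  then show K: "convex hull A \<in> K" using face_in assms(1) by blast
  have iA: "\<not> affine_dependent A" using simplex_vs(1)[OF assms(1)] assms(2) affine_independent_subset by blast
  have "v \<in> A" if "v \<in> vs (convex hull A)" for v
  proof -
    have v: "{v} \<in> K" "v \<in> convex hull A" using that by (auto simp: vs_def)
    have "(convex hull A \<inter> {v}) face_of convex hull A" by (rule Int_face[OF K v(1)])
    moreover have "convex hull A \<inter> {v} = {v}" using v by auto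
    ultimately show ?thesis using extreme_point_of_convex_hull by (metis face_of_singleton)
  qed
  moreover have "v \<in> vs (convex hull A)" if "v \<in> A" for v
    using that assms(2) by (auto simp: vs_def hull_inc)
  ultimately show "vs (convex hull A) = A" by blast
qed

lemma vs_mono: "\<sigma> \<subseteq> \<tau> \<Longrightarrow> vs \<sigma> \<subseteq> vs \<tau>" by (auto simp: vs_def)

lemma vs_Int: "vs (\<sigma> \<inter> \<tau>) = vs \<sigma> \<inter> vs \<tau>" by (auto simp: vs_def)

lemma subset_iff_vs: "\<sigma> \<in> K \<Longrightarrow> \<tau> \<in> K \<Longrightarrow> \<sigma> \<subseteq> \<tau> \<longleftrightarrow> vs \<sigma> \<subseteq> vs \<tau>"
  using vs_mono hull_mono[of "vs \<sigma>" "vs \<tau>" convex] simplex_vs(2) by metis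

lemma Int_in: "\<sigma> \<in> K \<Longrightarrow> \<tau> \<in> K \<Longrightarrow> \<sigma> \<inter> \<tau> \<in> K"
  using Int_face face_in by blast

lemma face_iff_vs: "\<sigma> \<in> K \<Longrightarrow> \<tau> \<in> K \<Longrightarrow> \<sigma> face_of \<tau> \<longleftrightarrow> vs \<sigma> \<subseteq> vs \<tau>"
  using subset_iff_vs[of \<sigma> \<tau>] Int_face[of \<tau> \<sigma>] face_of_imp_subset[of \<sigma> \<tau>] by (metis inf.absorb_iff2)

lemma vs_sing: "{v} \<in> K \<Longrightarrow> vs {v} = {v}" by (auto simp: vs_def)

lemma aff_dim_vs: "\<sigma> \<in> K \<Longrightarrow> aff_dim \<sigma> = int (card (vs \<sigma>)) - 1"
proof -
  assume s: "\<sigma> \<in> K"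
  have "aff_dim \<sigma> = aff_dim (convex hull vs \<sigma>)" by (simp only: simplex_vs(2)[OF s])
  then show ?thesis
    using aff_dim_affine_independent[OF simplex_vs(1)[OF s]] by (simp only: aff_dim_convex_hull)
qed

lemma hull_vs_image: "A \<subseteq> vs ` K \<Longrightarrow> a \<in> A \<Longrightarrow> convex hull a \<in> K \<and> vs (convex hull a) = a"
proof -
  assume "A \<subseteq> vs ` K" "a \<in> A"
  then obtain \<sigma> where "\<sigma> \<in> K" "a = vs \<sigma>" by blast
  then show ?thesis using hull_in[of \<sigma> a] by simp
qed

lemma empty_in: "K \<noteq> {} \<Longrightarrow> {} \<in> K" using face_in[OF _ empty_face_of] by (metis ex_in_conv)

section \<open>Abstract collapses realized geometrically\<close>

lemma elementary_collapse_abs: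
  assumes "abs_collapse A B" "A \<subseteq> vs ` K"
  shows "elementary_collapse ((\<lambda>a. convex hull a) ` A) ((\<lambda>a. convex hull a) ` B)"
proof -
  obtain s f where sf: "s \<in> A" "f \<in> A" "f \<noteq> {}" "f \<subseteq> s" "card s = card f + 1"
     "\<And>r. r \<in> A \<Longrightarrow> f \<subseteq> r \<Longrightarrow> r = s \<or> r = f" "B = A - {s,f}"
    using assms(1) unfolding abs_collapse_def by blast
  have h: "convex hull a \<in> K" "vs (convex hull a) = a" if "a \<in> A" for a
    using hull_vs_image[OF assms(2) that] by auto
  have inj: "inj_on (\<lambda>a. convex hull a) A" by (rule inj_onI) (metis h(2))
  show ?thesis unfolding elementary_collapse_def
  proof (intro bexI conjI ballI impI)
    show "(convex hull f) facet_of (convex hull s)"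
      unfolding facet_of_def
      using face_iff_vs[OF h(1)[OF sf(2)] h(1)[OF sf(1)]] h(2)[OF sf(1)] h(2)[OF sf(2)] sf(3-5)
        aff_dim_vs[OF h(1)[OF sf(2)]] aff_dim_vs[OF h(1)[OF sf(1)]] by simp
    show "(\<lambda>a. convex hull a) ` B = (\<lambda>a. convex hull a) ` A - {convex hull s, convex hull f}"
      unfolding sf(7) using inj_on_image_set_diff[OF inj, of A "{s,f}"] sf(1,2) by auto
    fix \<rho> assume "\<rho> \<in> (\<lambda>a. convex hull a) ` A" and *: "(convex hull f) face_of \<rho>"
    then obtain r where r: "r \<in> A" "\<rho> = convex hull r" by auto
    then have "f \<subseteq> r" using * face_iff_vs[OF h(1)[OF sf(2)] h(1)[OF r(1)]] h(2) sf(2) r by metis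
    then show "\<rho> = convex hull s \<or> \<rho> = convex hull f" using sf(6) r by blast
  qed (use sf in auto)
qed

lemma elementary_collapses_abs:
  assumes "abs_collapse\<^sup>*\<^sup>* A B" "A \<subseteq> vs ` K"
  shows "elementary_collapse\<^sup>*\<^sup>* ((\<lambda>a. convex hull a) ` A) ((\<lambda>a. convex hull a) ` B) \<and> B \<subseteq> A"
  using assms(1)
proof (induction rule: rtranclp_induct)
  case (step B C)
  have "C \<subseteq> B" using step.hyps(2) unfolding abs_collapse_def by blast
  moreover have "elementary_collapse ((\<lambda>a. convex hull a) ` B) ((\<lambda>a. convex hull a) ` C)"
    using elementary_collapse_abs step assms(2) by blast
  ultimately show ?case using step.IH by (meson order_trans rtranclp.rtrancl_into_rtrancl)
qed simp

text \<open>What is left is a triangle with its faces, and a compact convex set of dimension 2 is a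
  disc.\<close>

lemma collapses_onto_abs:
  assumes "abs_collapse\<^sup>*\<^sup>* (vs ` K) (Pow t)" "card t = 3"
  shows "\<exists>D. collapses_onto (\<Union>K) D \<and> D homeomorphic cball (0::real^2) 1"
proof -
  let ?h = "\<lambda>a. convex hull a"
  have KK: "?h ` vs ` K = K" using simplex_vs(2) by (auto simp: image_iff)
  from elementary_collapses_abs[OF assms(1)] have *: "elementary_collapse\<^sup>*\<^sup>* K (?h ` Pow t)" "Pow t \<subseteq> vs ` K"
    unfolding KK by auto
  have t: "?h t \<in> K" "vs (?h t) = t" using hull_vs_image[OF *(2)] by auto
  have sub: "?h ` Pow t \<subseteq> K" using *(2) hull_vs_image[OF subset_refl] by blast
  have sc0: "simplicial_complex (?h ` Pow t)"
    unfolding simplicial_complex_def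
  proof (intro conjI allI impI ballI)
    show "finite (?h ` Pow t)" using finite_subset[OF sub fin_K] .
    show "\<exists>n. n simplex S" if "S \<in> ?h ` Pow t" for S using sc sub that by (auto simp: simplicial_complex_def)
    show "S \<inter> S' face_of S" if "S \<in> ?h ` Pow t \<and> S' \<in> ?h ` Pow t" for S S'
      using Int_face sub that by blast
    fix F S assume FS: "S \<in> ?h ` Pow t \<and> F face_of S"
    then obtain s where s: "s \<subseteq> t" "S = ?h s" by auto
    have SK: "S \<in> K" "vs S = s" using hull_in[OF t(1), of s] t(2) s by auto
    have FK: "F \<in> K" using face_in[OF SK(1)] FS by blast
    have "vs F \<subseteq> t" using face_iff_vs[OF FK SK(1)] FS SK(2) s by blast
    then show "F \<in> ?h ` Pow t" using simplex_vs(2)[OF FK] by (metis PowI image_eqI)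
  qed
  have U: "\<Union>(?h ` Pow t) = ?h t" using hull_mono[of _ t convex] by blast
  have "aff_dim (?h t) = 2" using aff_dim_vs[OF t(1)] t(2) assms(2) by simp
  moreover have "compact (?h t)" using closed_simplex(2)[OF t(1)] .
  moreover have "aff_dim (cball (0::real^2) 1) = 2" by (simp add: aff_dim_cball)
  ultimately have "?h t homeomorphic cball (0::real^2) 1"
    by (intro homeomorphic_convex_compact_sets) auto
  moreover have "collapses_onto (\<Union>K) (?h t)"
    unfolding collapses_onto_def using sc sc0 sub U * by blast
  ultimately show ?thesis by blast
qed

section \<open>Vertices, edges, triangles and open stars\<close>

definition "VV = {v. {v} \<in> K}"
definition "EE = {e \<in> vs ` K. card e = 2}"
definition "TT = {t \<in> vs ` K. card t = 3}"

lemma finite_VV: "finite VV"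
proof -
  have "(\<lambda>v. {v}) ` VV \<subseteq> K" by (auto simp: VV_def)
  then have "finite ((\<lambda>v. {v}) ` VV)" using fin_K finite_subset by blast
  then show ?thesis by (rule finite_imageD) (auto simp: inj_on_def)
qed

lemma vs_subset_VV: "vs \<sigma> \<subseteq> VV" by (auto simp: vs_def VV_def)

lemma edges_TT: "edges_of TT \<subseteq> EE"
proof
  fix e assume "e \<in> edges_of TT"
  then obtain t \<sigma> where t: "card e = 2" "e \<subseteq> t" "\<sigma> \<in> K" "t = vs \<sigma>" by (auto simp: edges_of_def TT_def)
  then have "convex hull e \<in> K" "vs (convex hull e) = e" using hull_in[OF t(3)] by auto
  then show "e \<in> EE" using t(1) by (auto simp: EE_def image_iff)
qed

lemma cells_eq:
  assumes "\<And>\<sigma>. \<sigma> \<in> K \<Longrightarrow> card (vs \<sigma>) \<le> 3" "K \<noteq> {}"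
  shows "vs ` K = cells VV EE TT"
proof
  show "vs ` K \<subseteq> cells VV EE TT"
  proof
    fix a assume "a \<in> vs ` K"
    then obtain \<sigma> where s: "\<sigma> \<in> K" "a = vs \<sigma>" by auto
    have "card a \<le> 3" "finite a" using assms(1)[OF s(1)] finite_vs[OF s(1)] s by auto
    then consider "a = {}" | "card a = 1" | "card a = 2" | "card a = 3" by (metis One_nat_def card_0_eq le_SucE le_zero_eq numeral_2_eq_2 numeral_3_eq_3)
    then show "a \<in> cells VV EE TT"
    proof cases
      case 2
      then obtain v where "a = {v}" by (metis One_nat_def card_1_singletonE)
      then show ?thesis using vs_subset_VV[of \<sigma>] s by (auto simp: cells_def)
    qed (use s in \<open>auto simp: cells_def EE_def TT_def\<close>)
  qed
  show "cells VV EE TT \<subseteq> vs ` K"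
  proof -
    have "vs {} = {}" by (simp add: vs_def)
    then have "{} \<in> vs ` K" using empty_in[OF assms(2)] by (metis image_eqI)
    moreover have "{v} \<in> vs ` K" if "v \<in> VV" for v using that vs_sing[of v] by (metis VV_def image_eqI mem_Collect_eq)
    ultimately show ?thesis by (auto simp: cells_def EE_def TT_def)
  qed
qed

lemma rel_interior_subset_simplex:
  assumes "\<sigma> \<in> K" "\<tau> \<in> K" "x \<in> rel_interior \<sigma>" "x \<in> \<tau>"
  shows "\<sigma> \<subseteq> \<tau>"
proof -
  have "\<sigma> \<subseteq> \<sigma> \<inter> \<tau>"
    by (rule subset_of_face_of[OF Int_face[OF assms(1,2)] subset_refl])
       (use assms rel_interior_subset[of \<sigma>] in blast)
  then show ?thesis by blast
qed

definition ostar :: "'a \<Rightarrow> 'a set" where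
  "ostar v = {x \<in> \<Union>K. \<forall>\<sigma>\<in>K. x \<in> \<sigma> \<longrightarrow> v \<in> \<sigma>}"

lemma compact_Union: "compact (\<Union>K)" using fin_K closed_simplex by (intro compact_Union) auto

lemma ostar_open: "\<exists>U. open U \<and> U \<inter> \<Union>K = ostar v"
proof (intro exI conjI)
  show "open (- \<Union>{\<sigma>\<in>K. v \<notin> \<sigma>})" using fin_K closed_simplex by (intro open_Compl closed_Union) auto
qed (auto simp: ostar_def)

text \<open>Any vertex of the smallest simplex containing \<open>x\<close> will do.\<close>

lemma in_ostar_ex:
  assumes "x \<in> \<Union>K"
  obtains v where "v \<in> VV" "x \<in> ostar v"
proof -
  define \<tau> where "\<tau> = \<Inter>{\<sigma>\<in>K. x \<in> \<sigma>}"
  have fin: "finite {\<sigma>\<in>K. x \<in> \<sigma>}" "{\<sigma>\<in>K. x \<in> \<sigma>} \<noteq> {}" using fin_K assms by auto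
  have "\<Inter>S \<in> K" if "finite S" "S \<noteq> {}" "S \<subseteq> K" for S
    using that by (induction S rule: finite_ne_induct) (auto intro: Int_in)
  then have \<tau>: "\<tau> \<in> K" "x \<in> \<tau>" using fin unfolding \<tau>_def by auto
  then have "vs \<tau> \<noteq> {}" using simplex_vs(2)[OF \<tau>(1)] by force
  then obtain v where v: "v \<in> vs \<tau>" by blast
  then have "v \<in> VV" "v \<in> \<tau>" by (auto simp: vs_def VV_def)
  moreover have "x \<in> ostar v" using assms \<open>v \<in> \<tau>\<close> unfolding ostar_def \<tau>_def by blast
  ultimately show thesis using that by blast
qed

end

section \<open>Simplicial homology from singular homology\<close>

text \<open>Evaluation of a singular cochain \<open>g\<close> on a singular chain.\<close>

definition ext :: "('x \<Rightarrow> int) \<Rightarrow> ('x \<Rightarrow>\<^sub>0 int) \<Rightarrow> int" where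
  "ext g c = (\<Sum>f\<in>Poly_Mapping.keys c. Poly_Mapping.lookup c f * g f)"

lemma ext_superset:
  assumes "finite S" "Poly_Mapping.keys c \<subseteq> S"
  shows "ext g c = (\<Sum>f\<in>S. Poly_Mapping.lookup c f * g f)"
  unfolding ext_def by (rule sum.mono_neutral_left) (use assms in \<open>auto simp: in_keys_iff\<close>)

lemma ext_0 [simp]: "ext g 0 = 0" by (simp add: ext_def)

lemma ext_add: "ext g (a + b) = ext g a + ext g b"
proof -
  let ?S = "Poly_Mapping.keys a \<union> Poly_Mapping.keys b"
  have f: "finite ?S" by simp
  have "Poly_Mapping.keys (a + b) \<subseteq> ?S" by (rule Poly_Mapping.keys_add)
  from ext_superset[OF f this] ext_superset[OF f Un_upper1] ext_superset[OF f Un_upper2]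
  show ?thesis by (simp add: lookup_add distrib_right sum.distrib)
qed

lemma ext_diff: "ext g (a - b) = ext g a - ext g b"
  using ext_add[of g "a - b" b] by simp

lemma ext_of [simp]: "ext g (frag_of f) = g f"
  by (simp add: ext_def)

lemma ext_cmul: "ext g (frag_cmul k c) = k * ext g c"
proof (cases "k = 0")
  case False
  then have "Poly_Mapping.keys (frag_cmul k c) = Poly_Mapping.keys c" by (auto simp: in_keys_iff)
  then show ?thesis by (simp add: ext_def sum_distrib_left mult.assoc)
qed simp

lemma ext_sum: "ext g (\<Sum>i\<in>I. c i) = (\<Sum>i\<in>I. ext g (c i))"
  by (induction I rule: infinite_finite_induct) (simp_all add: ext_add)

lemma ext_lin:
  assumes "Poly_Mapping.keys c \<subseteq> A" "\<And>f. f \<in> A \<Longrightarrow> (\<Sum>i\<in>I. k i * g i f) = h f"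
  shows "(\<Sum>i\<in>I. k i * ext (g i) c) = ext h c"
proof -
  have "(\<Sum>i\<in>I. k i * ext (g i) c) = (\<Sum>i\<in>I. \<Sum>f\<in>Poly_Mapping.keys c. Poly_Mapping.lookup c f * (k i * g i f))"
    by (simp add: ext_def sum_distrib_left ac_simps)
  also have "\<dots> = (\<Sum>f\<in>Poly_Mapping.keys c. \<Sum>i\<in>I. Poly_Mapping.lookup c f * (k i * g i f))"
    by (rule sum.swap)
  also have "\<dots> = (\<Sum>f\<in>Poly_Mapping.keys c. Poly_Mapping.lookup c f * h f)"
    by (rule sum.cong) (use assms in \<open>auto simp flip: sum_distrib_left\<close>)
  finally show ?thesis by (simp add: ext_def)
qed

lemma ext_boundary:
  assumes "p \<noteq> 0"
  shows "ext g (chain_boundary p c) = ext (\<lambda>f. \<Sum>k\<le>p. (-1) ^ k * g (singular_face p k f)) c"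
proof -
  have "Poly_Mapping.keys c \<subseteq> UNIV" by simp
  then show ?thesis
    by (induction c rule: frag_induction)
       (use assms in \<open>simp_all add: chain_boundary_diff chain_boundary_of ext_diff ext_sum ext_cmul\<close>)
qed

abbreviation sdiv :: "nat \<Rightarrow> nat \<Rightarrow> 'a chain \<Rightarrow> 'a chain" where
  "sdiv n p \<equiv> (singular_subdivision p ^^ n)"

lemma sdiv_chain: "singular_chain p X c \<Longrightarrow> singular_chain p X (sdiv n p c)"
  by (induction n) (simp_all add: singular_chain_singular_subdivision)

lemma sdiv_boundary:
  "singular_chain p X c \<Longrightarrow> chain_boundary p (sdiv n p c) = sdiv n (p - 1) (chain_boundary p c)"
  by (induction n) (simp_all add: chain_boundary_singular_subdivision[OF sdiv_chain])

lemma sdiv_zero: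
  "singular_chain 0 X c \<Longrightarrow> sdiv n 0 c = c"
proof (induction n)
  case (Suc n)
  then show ?case using singular_subdivision_zero by simp
qed simp

lemma sdiv_add: "sdiv n p (a + b) = sdiv n p a + sdiv n p b"
  by (induction n) (simp_all add: singular_subdivision_add)

lemma sdiv_diff: "sdiv n p (a - b) = sdiv n p a - sdiv n p b"
  by (induction n) (simp_all add: singular_subdivision_diff)

lemma sdiv_0: "sdiv n p 0 = 0"
  by (induction n) simp_all

lemma sdiv_minus: "sdiv n p (- a) = - sdiv n p a"
  using sdiv_diff[of n p 0 a] by (simp add: sdiv_0)

lemma sdiv_cmul: "sdiv n p (frag_cmul k a) = frag_cmul k (sdiv n p a)"
proof -
  have "sdiv n p (frag_cmul (int m) a) = frag_cmul (int m) (sdiv n p a)" for m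
    by (induction m) (simp_all add: sdiv_0 sdiv_add frag_cmul_distrib)
  note pos = this
  have neg: "frag_cmul (- int m) b = - frag_cmul (int m) b" for m and b :: "'a chain"
    by (rule poly_mapping_eqI) simp
  show ?thesis
  proof (cases k rule: int_cases2)
    case (nonneg m) then show ?thesis by (simp only: pos)
  next
    case (nonpos m) then show ?thesis by (simp only: neg pos sdiv_minus)
  qed
qed

lemma sdiv_sum: "sdiv n p (\<Sum>i\<in>I. c i) = (\<Sum>i\<in>I. sdiv n p (c i))"
  by (induction I rule: infinite_finite_induct) (simp_all add: sdiv_0 sdiv_add)

section \<open>Affine singular simplices\<close>

definition unit_vector :: "nat \<Rightarrow> nat \<Rightarrow> real" where "unit_vector i = (\<lambda>j. if j = i then 1 else 0)"

lemma unit_vector_in: "i \<le> p \<Longrightarrow> unit_vector i \<in> standard_simplex p"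
  unfolding unit_vector_def by simp

lemma face_unit_vector:
  assumes "i \<le> p - 1"
  shows "singular_face p k f (unit_vector i) = f (unit_vector (if i < k then i else Suc i))"
proof -
  have "simplical_face k (unit_vector i) = unit_vector (if i < k then i else Suc i)"
    by (auto simp: simplical_face_def unit_vector_def fun_eq_iff)
  then show ?thesis using unit_vector_in[of i "p - 1"] assms by (simp add: singular_face_def)
qed

definition affine_simplex :: "nat \<Rightarrow> (nat \<Rightarrow> 'a::euclidean_space) \<Rightarrow> (nat \<Rightarrow> real) \<Rightarrow> 'a" where
  "affine_simplex p a = (\<lambda>x\<in>standard_simplex p. \<Sum>i\<le>p. x i *\<^sub>R a i)"

lemma affine_simplex_cong: "(\<And>i. i \<le> p \<Longrightarrow> a i = b i) \<Longrightarrow> affine_simplex p a = affine_simplex p b"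
  unfolding affine_simplex_def by (intro restrict_ext sum.cong) simp_all

lemma affine_simplex_unit_vector: "i \<le> p \<Longrightarrow> affine_simplex p a (unit_vector i) = a i"
proof -
  assume i: "i \<le> p"
  have "(\<Sum>j\<le>p. unit_vector i j *\<^sub>R a j) = (\<Sum>j\<le>p. if j = i then a j else 0)"
    by (rule sum.cong) (auto simp: unit_vector_def)
  then show ?thesis using i unit_vector_in[OF i] by (simp add: affine_simplex_def)
qed

lemma singular_simplex_affine_simplex:
  assumes "convex S" "\<And>i. i \<le> p \<Longrightarrow> a i \<in> S"
  shows "singular_simplex p (top_of_set S) (affine_simplex p a)"
  unfolding singular_simplex_def
proof
  have "continuous_map (powertop_real UNIV) euclidean (\<lambda>x. \<Sum>i\<le>p. x i *\<^sub>R a i)"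
    unfolding euclidean_product_topology
    by (simp, intro continuous_intros continuous_on_product_coordinates)
  then have 1: "continuous_map (subtopology (powertop_real UNIV) (standard_simplex p)) euclidean (\<lambda>x. \<Sum>i\<le>p. x i *\<^sub>R a i)"
    by (rule continuous_map_from_subtopology)
  have 2: "(\<Sum>i\<le>p. x i *\<^sub>R a i) \<in> S" if "x \<in> standard_simplex p" for x
    using that assms unfolding standard_simplex_def by (intro convex_sum) auto
  have "continuous_map (subtopology (powertop_real UNIV) (standard_simplex p)) (top_of_set S) (\<lambda>x. \<Sum>i\<le>p. x i *\<^sub>R a i)"
    using 1 2 by (auto simp: continuous_map_in_subtopology)
  then show "continuous_map (subtopology (powertop_real UNIV) (standard_simplex p)) (top_of_set S) (affine_simplex p a)"
    by (rule continuous_map_eq) (simp add: affine_simplex_def)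
  show "affine_simplex p a \<in> extensional (standard_simplex p)" by (simp add: affine_simplex_def)
qed

lemma face_affine_simplex:
  assumes "1 \<le> p" "k \<le> p"
  shows "singular_face p k (affine_simplex p a) = affine_simplex (p - 1) (\<lambda>j. if j < k then a j else a (Suc j))"
proof
  fix x
  show "singular_face p k (affine_simplex p a) x = affine_simplex (p - 1) (\<lambda>j. if j < k then a j else a (Suc j)) x"
  proof (cases "x \<in> standard_simplex (p - 1)")
    case True
    have "(\<Sum>j\<le>p. simplical_face k x j *\<^sub>R a j) = (\<Sum>j\<le>p - Suc 0. x j *\<^sub>R (if j < k then a j else a (Suc j)))"
      unfolding simplical_face_def
      using sum.zero_middle[OF assms, of "\<lambda>j. x j *\<^sub>R a j" "\<lambda>j. x j *\<^sub>R a (Suc j)"]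
      by (simp add: if_distrib[of "\<lambda>x. x *\<^sub>R _"] if_distrib[of "\<lambda>f. _ *\<^sub>R f"] cong: if_cong)
    then show ?thesis
      using True simplical_face_in_standard_simplex[of p k x] assms
      by (simp add: singular_face_def affine_simplex_def)
  qed (simp add: singular_face_def affine_simplex_def)
qed

section \<open>Chains in acyclic spaces\<close>

lemma trivial_homology_boundary:
  assumes "acyclic_space X" "p \<noteq> 0" "singular_chain p (top_of_set X) c" "chain_boundary p c = 0"
  obtains d where "singular_chain (Suc p) (top_of_set X) d" "chain_boundary (Suc p) d = c"
proof -
  let ?H = "homology_group (int p) (top_of_set X)"
  have "trivial_group (homology_group (int p) (discrete_topology {()}))"
    by (rule homology_dimension_axiom[of _ "()"]) (use assms(2) in auto)
  moreover have iso: "?H \<cong> homology_group (int p) (discrete_topology {()})"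
    using assms(1) by (simp add: acyclic_space_def)
  ultimately have "trivial_group ?H"
    using isomorphic_group_triviality[OF iso group_relative_homology_group group_relative_homology_group] by simp
  then have car: "carrier ?H = {\<one>\<^bsub>?H\<^esub>}" by (simp add: trivial_group_def)
  have "singular_relcycle p (top_of_set X) {} c" using assms by (simp add: singular_cycle)
  then have "homologous_rel_set p (top_of_set X) {} c \<in> carrier ?H"
    unfolding carrier_relative_homology_group by blast
  then have "homologous_rel_set p (top_of_set X) {} c = singular_relboundary_set p (top_of_set X) {}"
    using car by simp
  then have "singular_relboundary p (top_of_set X) {} c"
    by (simp add: homologous_rel_set_eq_relboundary)
  then show thesis using that unfolding singular_boundary by blast
qed

lemma acyclic_path_connected:
  assumes "acyclic_space X" shows "path_connected X" "X \<noteq> {}"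
proof -
  have iso: "homology_group 0 (top_of_set X) \<cong> homology_group 0 (discrete_topology {()})"
    using assms unfolding acyclic_space_def by blast
  have pd: "path_connected_space (discrete_topology {()})"
    by (simp add: path_connected_space_iff_components_subset_singleton path_components_of_discrete_topology)
  then show "path_connected X"
    using isomorphic_homology_imp_path_connectedness[OF iso] path_connectedin_euclidean[of X]
    by (simp add: path_connectedin_def)
  show "X \<noteq> {}"
  proof
    assume "X = {}"
    have "path_components_of (top_of_set X) \<approx> path_components_of (discrete_topology {()})"
      by (rule isomorphic_homology_imp_path_components[OF iso])
    then show False using \<open>X = {}\<close> by (simp add: path_components_of_discrete_topology eqpoll_def bij_betw_def)
  qed
qed

section \<open>A chain map from small singular chains to simplicial chains\<close>

locale numbered_scomplex = scomplex +
  fixes num :: "'a \<Rightarrow> nat"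
  assumes inj_num: "inj_on num VV" and dim2: "\<sigma> \<in> K \<Longrightarrow> card (vs \<sigma>) \<le> 3" and K_ne: "\<Union>K \<noteq> {}"
begin

definition "X = \<Union>K"

lemma num_neq: "a \<in> VV \<Longrightarrow> b \<in> VV \<Longrightarrow> a \<noteq> b \<Longrightarrow> num a \<noteq> num b"
  using inj_num by (auto simp: inj_on_def)

lemma EE_TT_subset: "e \<in> EE \<Longrightarrow> e \<subseteq> VV" "t \<in> TT \<Longrightarrow> t \<subseteq> VV"
  using vs_subset_VV by (auto simp: EE_def TT_def)

lemma finite_EE: "finite EE" and finite_TT: "finite TT"
  using fin_K by (auto simp: EE_def TT_def)

lemma simplexD: "\<sigma> \<in> vs ` K \<Longrightarrow> a \<subseteq> \<sigma> \<Longrightarrow> a \<in> vs ` K"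
  using hull_in by (metis (no_types, lifting) image_iff)

text \<open>A choice of vertices as in simplicial approximation: a Lebesgue number of the cover by
  open stars makes one radius serve for all points.\<close>

lemma lebesgue: "\<exists>star_vertex \<delta>. \<delta> > 0 \<and> (\<forall>x\<in>X. star_vertex x \<in> VV \<and> ball x \<delta> \<inter> X \<subseteq> ostar (star_vertex x))"
proof -
  have "\<forall>v. \<exists>U. open U \<and> U \<inter> X = ostar v" using ostar_open by (simp add: X_def)
  then obtain U where U: "\<And>v. open (U v)" "\<And>v. U v \<inter> X = ostar v" by metis
  have cX: "compact X" using compact_Union by (simp add: X_def)
  have cov: "X \<subseteq> \<Union>(U ` VV)"
  proof
    fix x assume "x \<in> X"
    then obtain v where "v \<in> VV" "x \<in> ostar v" using in_ostar_ex unfolding X_def by blast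
    then show "x \<in> \<Union>(U ` VV)" using U(2) by blast
  qed
  have ne: "U ` VV \<noteq> {}" using cov K_ne by (auto simp: X_def)
  obtain \<delta> where d: "0 < \<delta>" "\<And>S. \<lbrakk>S \<subseteq> X; diameter S < \<delta>\<rbrakk> \<Longrightarrow> \<exists>B \<in> U ` VV. S \<subseteq> B"
    using Lebesgue_number_lemma[OF cX ne cov] U(1) by blast
  \<comment> \<open>A third of the Lebesgue number: the diameter of a ball may be twice its radius
    and has to stay strictly below that number.\<close>
  have "\<exists>v\<in>VV. ball x (\<delta>/3) \<inter> X \<subseteq> ostar v" for x
  proof -
    have "diameter (ball x (\<delta>/3) \<inter> X) \<le> 2 * (\<delta>/3)"
    proof (rule diameter_le)
      show "norm (y - z) \<le> 2 * (\<delta>/3)" if "y \<in> ball x (\<delta>/3) \<inter> X" "z \<in> ball x (\<delta>/3) \<inter> X" for y z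
        using that dist_triangle2[of y z x] by (simp add: dist_norm norm_minus_commute)
    qed (use d in simp)
    then have "diameter (ball x (\<delta>/3) \<inter> X) < \<delta>" using d by linarith
    then obtain v where "v \<in> VV" "ball x (\<delta>/3) \<inter> X \<subseteq> U v" using d(2)[of "ball x (\<delta>/3) \<inter> X"] by blast
    then show ?thesis using U(2) by blast
  qed
  then obtain star_vertex where "\<And>x. star_vertex x \<in> VV \<and> ball x (\<delta>/3) \<inter> X \<subseteq> ostar (star_vertex x)" by metis
  then show ?thesis using d(1) by (intro exI[of _ star_vertex] exI[of _ "\<delta>/3"]) auto
qed

text \<open>Fixed once for all points, so that the cochains below are compatible with passing to
  faces and do not depend on a chain.\<close>

definition "star_vertex = (SOME star_vertex. \<exists>\<delta>>0. \<forall>x\<in>X. star_vertex x \<in> VV \<and> ball x \<delta> \<inter> X \<subseteq> ostar (star_vertex x))"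

lemma star_vertex: "\<exists>\<delta>>0. \<forall>x\<in>X. star_vertex x \<in> VV \<and> ball x \<delta> \<inter> X \<subseteq> ostar (star_vertex x)"
  unfolding star_vertex_def by (rule someI_ex[of "\<lambda>star_vertex. \<exists>\<delta>>0. \<forall>x\<in>X. star_vertex x \<in> VV \<and> ball x \<delta> \<inter> X \<subseteq> ostar (star_vertex x)"]) (rule lebesgue)

lemma star_vertex_in:
  assumes "x \<in> \<sigma>" "\<sigma> \<in> K" shows "star_vertex x \<in> vs \<sigma>"
proof -
  have x: "x \<in> X" using assms by (auto simp: X_def)
  obtain \<delta> where "\<delta> > 0" "\<forall>x\<in>X. star_vertex x \<in> VV \<and> ball x \<delta> \<inter> X \<subseteq> ostar (star_vertex x)" using star_vertex by blast
  moreover have "x \<in> ball x \<delta> \<inter> X" using x \<open>\<delta> > 0\<close> by simp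
  ultimately have "star_vertex x \<in> VV" "x \<in> ostar (star_vertex x)" using x by blast+
  then show ?thesis using assms by (auto simp: ostar_def vs_def VV_def)
qed

lemma star_vertex_vertex: "v \<in> VV \<Longrightarrow> star_vertex v = v"
  using star_vertex_in[of v "{v}"] by (auto simp: VV_def vs_def)

definition "corner_vertex f i = star_vertex (f (unit_vector i))"

text \<open>The vertices chosen at the corners span a simplex of \<open>K\<close>, possibly of lower
  dimension. This is all that the simplicial cochains require.\<close>

definition small :: "nat \<Rightarrow> ((nat \<Rightarrow> real) \<Rightarrow> 'a) \<Rightarrow> bool" where
  "small p f \<longleftrightarrow> corner_vertex f ` {..p} \<in> vs ` K"

lemma small_if_in_simplex:
  assumes "singular_simplex p (top_of_set \<sigma>) f" "\<sigma> \<in> K"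
  shows "corner_vertex f ` {..p} \<subseteq> vs \<sigma>" "small p f"
proof -
  have "f (unit_vector i) \<in> \<sigma>" if "i \<le> p" for i
  proof -
    have "f ` standard_simplex p \<subseteq> \<sigma>"
      using assms(1) by (simp add: singular_simplex_subtopology)
    then show ?thesis using unit_vector_in[OF that] by blast
  qed
  then show *: "corner_vertex f ` {..p} \<subseteq> vs \<sigma>" using star_vertex_in[OF _ assms(2)] by (auto simp: corner_vertex_def)
  then show "small p f" unfolding small_def using simplexD assms(2) by blast
qed

lemma corner_vertex_face: "i \<le> p - 1 \<Longrightarrow> corner_vertex (singular_face p k f) i = corner_vertex f (if i < k then i else Suc i)"
  by (simp add: corner_vertex_def face_unit_vector)

text \<open>Subdivide until every simplex lies in a ball of half the radius. Then corner 0 is in the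
  open star of the vertex chosen at each corner, so all these vertices belong to every simplex of
  \<open>K\<close> that contains corner 0.\<close>

lemma eventually_small:
  assumes "singular_chain p (top_of_set X) c"
  obtains n where "\<And>f. f \<in> Poly_Mapping.keys (sdiv n p c) \<Longrightarrow> small p f"
proof -
  obtain \<delta> where d: "\<delta> > 0" "\<forall>x\<in>X. star_vertex x \<in> VV \<and> ball x \<delta> \<inter> X \<subseteq> ostar (star_vertex x)" using star_vertex by blast
  define \<C> where "\<C> = (\<lambda>x. X \<inter> ball x (\<delta>/2)) ` X"
  have "openin (top_of_set X) U" if "U \<in> \<C>" for U
    using that by (auto simp: \<C>_def intro: openin_open_Int)
  moreover have "topspace (top_of_set X) \<subseteq> \<Union>\<C>" using d(1) by (auto simp: \<C>_def)
  ultimately obtain n where n: "\<And>m f. \<lbrakk>n \<le> m; f \<in> Poly_Mapping.keys (sdiv m p c)\<rbrakk> \<Longrightarrow> \<exists>V\<in>\<C>. f \<in> standard_simplex p \<rightarrow> V"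
    using sufficient_iterated_singular_subdivision_exists[OF _ _ assms, of \<C>] by metis
  have "small p f" if f: "f \<in> Poly_Mapping.keys (sdiv n p c)" for f
  proof -
    obtain x where x: "x \<in> X" "f \<in> standard_simplex p \<rightarrow> X \<inter> ball x (\<delta>/2)"
      using n[OF order_refl f] by (auto simp: \<C>_def)
    have fb: "f (unit_vector i) \<in> X" "dist x (f (unit_vector i)) < \<delta>/2" if "i \<le> p" for i
      using x(2) unit_vector_in[OF that] by auto
    obtain \<sigma> where s: "\<sigma> \<in> K" "f (unit_vector 0) \<in> \<sigma>" using fb[of 0] by (auto simp: X_def)
    have "corner_vertex f i \<in> vs \<sigma>" if "i \<le> p" for i
    proof -
      have "dist (f (unit_vector i)) (f (unit_vector 0)) < \<delta>"
        using fb(2)[OF that] fb(2)[of 0] dist_triangle3[of "f (unit_vector i)" "f (unit_vector 0)" x] by simp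
      then have "f (unit_vector 0) \<in> ball (f (unit_vector i)) \<delta> \<inter> X" using fb(1)[of 0] by simp
      then have "f (unit_vector 0) \<in> ostar (corner_vertex f i)" "corner_vertex f i \<in> VV"
        using d(2) fb(1)[OF that] unfolding corner_vertex_def by blast+
      then show ?thesis using s by (auto simp: ostar_def vs_def VV_def)
    qed
    then have "corner_vertex f ` {..p} \<subseteq> vs \<sigma>" by auto
    then show ?thesis unfolding small_def using simplexD s(1) by blast
  qed
  then show thesis by (rule that)
qed

text \<open>The simplicial cochains: a singular simplex is sent to the oriented simplex on the
  vertices chosen for its corners, or to \<open>0\<close> when two of these coincide.\<close>

definition "vertex_cochain v f = (if corner_vertex f 0 = v then 1 else 0 :: int)"
definition "edge_cochain e f = (if {corner_vertex f 0, corner_vertex f 1} = e then sg num (corner_vertex f 0) (corner_vertex f 1) else 0 :: int)"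
definition "triangle_cochain t f = (if {corner_vertex f 0, corner_vertex f 1, corner_vertex f 2} = t
   then sg num (corner_vertex f 0) (corner_vertex f 1) * sg num (corner_vertex f 1) (corner_vertex f 2) * sg num (corner_vertex f 0) (corner_vertex f 2) else 0 :: int)"

text \<open>Together with the next two lemmas: on small simplices the cochains commute with
  boundaries and so define a chain map to the simplicial chains. For a degenerate edge both sides
  vanish.\<close>

lemma boundary_edge_cochain:
  assumes "small 1 f"
  shows "(\<Sum>e | e \<in> EE \<and> v \<in> e. sp num e v * edge_cochain e f) = (\<Sum>k\<le>1. (-1) ^ k * vertex_cochain v (singular_face 1 k f))"
proof -
  let ?a = "corner_vertex f 0" and ?b = "corner_vertex f 1"
  have s: "{?a,?b} \<in> vs ` K" using assms by (simp add: small_def atMost_Suc insert_commute)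
  have R: "(\<Sum>k\<le>1. (-1) ^ k * vertex_cochain v (singular_face 1 k f)) = (if ?b = v then 1 else 0) - (if ?a = v then 1 else 0)"
    by (simp add: vertex_cochain_def corner_vertex_face)
  show ?thesis
  proof (cases "?a = ?b")
    case True
    then have "edge_cochain e f = 0" for e by (simp add: edge_cochain_def sg_def)
    then show ?thesis unfolding R using True by simp
  next
    case False
    have V: "?a \<in> VV" "?b \<in> VV" using s vs_subset_VV by blast+
    have E: "{?a,?b} \<in> EE" using s False by (simp add: EE_def)
    have "(\<Sum>e | e \<in> EE \<and> v \<in> e. sp num e v * edge_cochain e f) =
        (\<Sum>e\<in>{e. e = {?a,?b} \<and> v \<in> e}. sp num e v * edge_cochain e f)"
      by (rule sum.mono_neutral_right) (use finite_EE E in \<open>auto simp: edge_cochain_def\<close>)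
    also have "{e. e = {?a,?b} \<and> v \<in> e} = (if v \<in> {?a,?b} then {{?a,?b}} else {})" by auto
    also have "(\<Sum>e\<in>(if v \<in> {?a,?b} then {{?a,?b}} else {}). sp num e v * edge_cochain e f) =
       (if v \<in> {?a,?b} then sp num {?a,?b} v * sg num ?a ?b else 0)" by (simp add: edge_cochain_def)
    finally have L: "(\<Sum>e | e \<in> EE \<and> v \<in> e. sp num e v * edge_cochain e f) =
       (if v \<in> {?a,?b} then sp num {?a,?b} v * sg num ?a ?b else 0)" .
    have "sp num {?a,?b} ?a = (sg num ?b ?a :: int)" using False by (rule sp_pair)
    moreover have "sp num {?b,?a} ?b = (sg num ?a ?b :: int)" using False[symmetric] by (rule sp_pair)
    ultimately have "sp num {?a,?b} ?a * sg num ?a ?b = (-1 :: int)" "sp num {?a,?b} ?b * sg num ?a ?b = (1 :: int)"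
      using num_neq[OF V False] by (auto simp: sg_def insert_commute)
    then show ?thesis unfolding L R using False by auto
  qed
qed

lemma boundary_triangle_cochain:
  assumes "small 2 f" and e: "e \<in> EE"
  shows "(\<Sum>t\<in>tri_at TT e. inc num t e * triangle_cochain t f) = (\<Sum>k\<le>2. (-1) ^ k * edge_cochain e (singular_face 2 k f))"
proof -
  let ?a = "corner_vertex f 0" and ?b = "corner_vertex f 1" and ?c = "corner_vertex f 2"
  have "{..2::nat} = {0,1,2}" by auto
  then have s: "{?a,?b,?c} \<in> vs ` K" using assms by (simp add: small_def)
  have V: "?a \<in> VV" "?b \<in> VV" "?c \<in> VV" using s vs_subset_VV by blast+
  have f01: "corner_vertex (singular_face 2 k f) 0 = corner_vertex f (if 0 < k then 0 else 1)" "corner_vertex (singular_face 2 k f) 1 = corner_vertex f (if 1 < k then 1 else 2)" for k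
    by (simp_all add: corner_vertex_face numeral_2_eq_2)
  have R: "(\<Sum>k\<le>2. (-1) ^ k * edge_cochain e (singular_face 2 k f)) = (if {?b,?c} = e then sg num ?b ?c else 0)
     - (if {?a,?c} = e then sg num ?a ?c else 0) + (if {?a,?b} = e then sg num ?a ?b else 0)"
    unfolding numeral_2_eq_2 sum.atMost_Suc by (simp add: edge_cochain_def f01[unfolded numeral_2_eq_2 One_nat_def])
  have ce: "card e = 2" using e by (simp add: EE_def)
  then have ne: "e \<noteq> {x}" for x by auto
  show ?thesis
  proof (cases "?a = ?b \<or> ?b = ?c \<or> ?a = ?c")
    case True
    then have "triangle_cochain t f = 0" for t by (auto simp: triangle_cochain_def sg_def)
    then have L: "(\<Sum>t\<in>tri_at TT e. inc num t e * triangle_cochain t f) = 0" by simp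
    have z: "sg num x x = (0::int)" for x by (simp add: sg_def)
    from True show ?thesis unfolding L R
      by (elim disjE) (simp_all add: z insert_commute sg_antisym[of num ?b ?c, unfolded One_nat_def])
  next
    case False
    then have d: "?a \<noteq> ?b" "?b \<noteq> ?c" "?a \<noteq> ?c" by auto
    let ?t = "{?a,?b,?c}"
    have T: "?t \<in> TT" using s d by (simp add: TT_def)
    have "(\<Sum>t\<in>tri_at TT e. inc num t e * triangle_cochain t f) = (\<Sum>t\<in>{t. t = ?t \<and> e \<subseteq> t}. inc num t e * triangle_cochain t f)"
      by (rule sum.mono_neutral_right) (use finite_TT T in \<open>auto simp: triangle_cochain_def tri_at_def\<close>)
    also have "{t. t = ?t \<and> e \<subseteq> t} = (if e \<subseteq> ?t then {?t} else {})" by auto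
    also have "(\<Sum>t\<in>(if e \<subseteq> ?t then {?t} else {}). inc num t e * triangle_cochain t f) =
       (if e \<subseteq> ?t then inc num ?t e * (sg num ?a ?b * sg num ?b ?c * sg num ?a ?c) else 0)"
      by (simp add: triangle_cochain_def)
    finally have L: "(\<Sum>t\<in>tri_at TT e. inc num t e * triangle_cochain t f) =
       (if e \<subseteq> ?t then inc num ?t e * (sg num ?a ?b * sg num ?b ?c * sg num ?a ?c) else 0)" .
    have cut: "e \<subseteq> ?t \<longleftrightarrow> e = {?a,?b} \<or> e = {?b,?c} \<or> e = {?a,?c}"
      using card_2_subsets_triple[of ?a ?b ?c] d ce by auto
    have i: "inc num ?t {?a,?b} = (sg num ?a ?c * sg num ?b ?c :: int)"
        "inc num ?t {?b,?c} = (sg num ?b ?a * sg num ?c ?a :: int)"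
        "inc num ?t {?a,?c} = (sg num ?a ?b * sg num ?c ?b :: int)"
    proof -
      show "inc num ?t {?a,?b} = (sg num ?a ?c * sg num ?b ?c :: int)" using d by (rule inc_triple)
      have "inc num {?b,?c,?a} {?b,?c} = (sg num ?b ?a * sg num ?c ?a :: int)"
        by (rule inc_triple) (use d in auto)
      moreover have "{?b,?c,?a} = ?t" by auto
      ultimately show "inc num ?t {?b,?c} = (sg num ?b ?a * sg num ?c ?a :: int)" by simp
      have "inc num {?a,?c,?b} {?a,?c} = (sg num ?a ?b * sg num ?c ?b :: int)"
        by (rule inc_triple) (use d in auto)
      moreover have "{?a,?c,?b} = ?t" by auto
      ultimately show "inc num ?t {?a,?c} = (sg num ?a ?b * sg num ?c ?b :: int)" by simp
    qed
    have n: "num ?a \<noteq> num ?b" "num ?b \<noteq> num ?c" "num ?a \<noteq> num ?c" using num_neq V d by blast+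
    have dd: "{?a,?b} \<noteq> {?b,?c}" "{?a,?b} \<noteq> {?a,?c}" "{?b,?c} \<noteq> {?a,?c}" using d by (auto simp: doubleton_eq_iff)
    consider "e = {?a,?b}" | "e = {?b,?c}" | "e = {?a,?c}" | "\<not> e \<subseteq> ?t" using cut by blast
    then show ?thesis
    proof cases
      case 1 then show ?thesis unfolding L R using dd n i(1) by (auto simp: sg_def)
    next
      case 2 then show ?thesis unfolding L R using dd n i(2) by (auto simp: sg_def)
    next
      case 3 then show ?thesis unfolding L R using dd n i(3) by (auto simp: sg_def)
    next
      case 4 then show ?thesis unfolding L R using cut by auto
    qed
  qed
qed

text \<open>In a 2-complex two of the four chosen vertices coincide. The faces that contain both are
  degenerate, and the other two faces have images that cancel.\<close>

lemma boundary_tetrahedron: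
  assumes "small 3 f"
  shows "(\<Sum>k\<le>3. (-1) ^ k * triangle_cochain t (singular_face 3 k f)) = 0"
proof -
  let ?a = "corner_vertex f 0" and ?b = "corner_vertex f 1" and ?c = "corner_vertex f 2" and ?d = "corner_vertex f 3"
  have "{..3::nat} = {0,1,2,3}" by auto
  then have s: "{?a,?b,?c,?d} \<in> vs ` K" using assms by (simp add: small_def)
  have "card {?a,?b,?c,?d} \<le> 3" using s dim2 by auto
  then have eq: "?a = ?b \<or> ?a = ?c \<or> ?a = ?d \<or> ?b = ?c \<or> ?b = ?d \<or> ?c = ?d"
    by (auto simp: card_insert_if split: if_splits)
  have f: "corner_vertex (singular_face 3 k f) 0 = corner_vertex f (if 0 < k then 0 else 1)" "corner_vertex (singular_face 3 k f) 1 = corner_vertex f (if 1 < k then 1 else 2)"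
      "corner_vertex (singular_face 3 k f) 2 = corner_vertex f (if 2 < k then 2 else 3)" for k
    by (simp_all add: corner_vertex_face numeral_2_eq_2 numeral_3_eq_3)
  have R: "(\<Sum>k\<le>3. (-1) ^ k * triangle_cochain t (singular_face 3 k f)) = triangle_cochain t (singular_face 3 0 f) - triangle_cochain t (singular_face 3 1 f)
     + triangle_cochain t (singular_face 3 2 f) - triangle_cochain t (singular_face 3 3 f)"
    by (simp add: numeral_3_eq_3 numeral_2_eq_2)
  have p: "triangle_cochain t (singular_face 3 0 f) = (if {?b,?c,?d} = t then sg num ?b ?c * sg num ?c ?d * sg num ?b ?d else 0)"
    "triangle_cochain t (singular_face 3 1 f) = (if {?a,?c,?d} = t then sg num ?a ?c * sg num ?c ?d * sg num ?a ?d else 0)"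
    "triangle_cochain t (singular_face 3 2 f) = (if {?a,?b,?d} = t then sg num ?a ?b * sg num ?b ?d * sg num ?a ?d else 0)"
    "triangle_cochain t (singular_face 3 3 f) = (if {?a,?b,?c} = t then sg num ?a ?b * sg num ?b ?c * sg num ?a ?c else 0)"
    by (simp_all add: triangle_cochain_def f f[unfolded One_nat_def])
  have z: "sg num x x = (0::int)" for x by (simp add: sg_def)
  from eq show ?thesis unfolding R p
    by (elim disjE) (simp_all add: z insert_commute sg_antisym[of num ?b ?c, unfolded One_nat_def] sg_antisym[of num ?c ?d] sg_antisym[of num ?b ?d, unfolded One_nat_def])
qed

end

section \<open>Simplicial chains as singular chains\<close>

definition pair_seq :: "'a \<Rightarrow> 'a \<Rightarrow> nat \<Rightarrow> 'a" where "pair_seq a b = (\<lambda>i. if i = 0 then a else b)"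
definition triple_seq :: "'a \<Rightarrow> 'a \<Rightarrow> 'a \<Rightarrow> nat \<Rightarrow> 'a" where "triple_seq a b c = (\<lambda>i. if i = 0 then a else if i = 1 then b else c)"

lemma boundary_affine_edge: "chain_boundary 1 (frag_of (affine_simplex 1 (pair_seq a b))) = frag_of (affine_simplex 0 (\<lambda>_. b)) - frag_of (affine_simplex 0 (\<lambda>_. a))"
proof -
  have "singular_face 1 0 (affine_simplex 1 (pair_seq a b)) = affine_simplex 0 (\<lambda>_. b)" "singular_face 1 1 (affine_simplex 1 (pair_seq a b)) = affine_simplex 0 (\<lambda>_. a)"
    by (simp_all add: face_affine_simplex) (rule affine_simplex_cong, auto simp: pair_seq_def)+
  then show ?thesis by (simp add: chain_boundary_of)
qed

lemma boundary_affine_triangle: "chain_boundary 2 (frag_of (affine_simplex 2 (triple_seq a b c))) =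
   frag_of (affine_simplex 1 (pair_seq b c)) - frag_of (affine_simplex 1 (pair_seq a c)) + frag_of (affine_simplex 1 (pair_seq a b))"
proof -
  have "singular_face 2 0 (affine_simplex 2 (triple_seq a b c)) = affine_simplex 1 (pair_seq b c)" "singular_face 2 1 (affine_simplex 2 (triple_seq a b c)) = affine_simplex 1 (pair_seq a c)"
     "singular_face 2 2 (affine_simplex 2 (triple_seq a b c)) = affine_simplex 1 (pair_seq a b)"
    by (simp_all add: face_affine_simplex) (rule affine_simplex_cong, auto simp: triple_seq_def pair_seq_def le_Suc_eq)+
  then show ?thesis by (simp add: chain_boundary_of numeral_2_eq_2)
qed

context numbered_scomplex begin

text \<open>Subdividing an edge and mapping it back gives the edge again. All pieces lie in it, so
  the image is a multiple of it, and the factor is read off from the boundary at \<open>b\<close>,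
  which subdivision does not change.\<close>

lemma edge_identity:
  assumes "num a < num b" "{a,b} \<in> EE"
  shows "ext (edge_cochain e) (sdiv n 1 (frag_of (affine_simplex 1 (pair_seq a b)))) = (if e = {a,b} then 1 else 0)"
proof -
  have ab: "{a,b} \<in> vs ` K" "a \<in> VV" "b \<in> VV" using assms EE_TT_subset by (auto simp: EE_def)
  define \<tau> where "\<tau> = convex hull {a,b}"
  have \<tau>: "\<tau> \<in> K" "vs \<tau> = {a,b}" using hull_vs_image[OF subset_refl ab(1)] by (simp_all add: \<tau>_def)
  let ?c = "sdiv n 1 (frag_of (affine_simplex 1 (pair_seq a b)))"
  have s1: "singular_chain 1 (top_of_set \<tau>) (frag_of (affine_simplex 1 (pair_seq a b)))"
    unfolding singular_chain_of
    by (rule singular_simplex_affine_simplex) (auto simp: \<tau>_def pair_seq_def hull_inc)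
  have s2: "singular_chain 1 (top_of_set \<tau>) ?c" by (rule sdiv_chain[OF s1])
  have f: "corner_vertex f ` {..1} \<subseteq> {a,b} \<and> small 1 f" if "f \<in> Poly_Mapping.keys ?c" for f
    using small_if_in_simplex[of 1 \<tau> f] s2 that \<tau> by (auto simp: singular_chain_def)
  have ne: "a \<noteq> b" using assms by auto
  have other: "ext (edge_cochain e) ?c = 0" if "e \<noteq> {a,b}" for e
  proof -
    have "edge_cochain e f = 0" if "f \<in> Poly_Mapping.keys ?c" for f
    proof (cases "corner_vertex f 0 = corner_vertex f 1")
      case False
      have "corner_vertex f 0 \<in> {a,b}" "corner_vertex f 1 \<in> {a,b}" using f[OF that] by auto
      then have "{corner_vertex f 0, corner_vertex f 1} = {a,b}" using False by auto
      then show ?thesis using \<open>e \<noteq> {a,b}\<close> by (simp add: edge_cochain_def)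
    qed (simp add: edge_cochain_def sg_def)
    then show ?thesis by (simp add: ext_def)
  qed
  have "(\<Sum>e | e \<in> EE \<and> b \<in> e. sp num e b * ext (edge_cochain e) ?c) = ext (\<lambda>f. \<Sum>k\<le>1. (-1) ^ k * vertex_cochain b (singular_face 1 k f)) ?c"
    by (rule ext_lin[OF subset_refl]) (use boundary_edge_cochain f in blast)
  also have "\<dots> = ext (vertex_cochain b) (chain_boundary 1 ?c)" by (rule ext_boundary[symmetric]) simp
  also have "chain_boundary 1 ?c = sdiv n 0 (chain_boundary 1 (frag_of (affine_simplex 1 (pair_seq a b))))"
    using sdiv_boundary[OF s1] by simp
  also have "\<dots> = chain_boundary 1 (frag_of (affine_simplex 1 (pair_seq a b)))"
    by (rule sdiv_zero) (use singular_chain_boundary[OF s1] in simp)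
  also have "ext (vertex_cochain b) \<dots> = vertex_cochain b (affine_simplex 0 (\<lambda>_. b)) - vertex_cochain b (affine_simplex 0 (\<lambda>_. a))"
    by (simp only: boundary_affine_edge ext_diff ext_of)
  also have "\<dots> = 1" using ne by (simp add: vertex_cochain_def corner_vertex_def affine_simplex_unit_vector star_vertex_vertex ab)
  also have "(\<Sum>e | e \<in> EE \<and> b \<in> e. sp num e b * ext (edge_cochain e) ?c) = (\<Sum>e\<in>{{a,b}}. sp num e b * ext (edge_cochain e) ?c)"
    by (rule sum.mono_neutral_right) (use finite_EE assms other in auto)
  also have "\<dots> = sp num {a,b} b * ext (edge_cochain {a,b}) ?c" by simp
  also have "sp num {a,b} b = (1::int)" using sp_pair[of b a num] ne assms(1) by (simp add: insert_commute sg_def)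
  finally show ?thesis using other by auto
qed

text \<open>The same argument one dimension higher: the factor is read off from the boundary along
  \<open>{a,b}\<close>, by \<open>edge_identity\<close>.\<close>

lemma triangle_identity:
  assumes "num a < num b" "num b < num c" "{a,b,c} \<in> TT"
  shows "ext (triangle_cochain t) (sdiv n 2 (frag_of (affine_simplex 2 (triple_seq a b c)))) = (if t = {a,b,c} then 1 else 0)"
proof -
  have ab: "{a,b,c} \<in> vs ` K" using assms by (auto simp: TT_def)
  define \<tau> where "\<tau> = convex hull {a,b,c}"
  have \<tau>: "\<tau> \<in> K" "vs \<tau> = {a,b,c}" using hull_vs_image[OF subset_refl ab(1)] by (simp_all add: \<tau>_def)
  let ?c = "sdiv n 2 (frag_of (affine_simplex 2 (triple_seq a b c)))"
  have s1: "singular_chain 2 (top_of_set \<tau>) (frag_of (affine_simplex 2 (triple_seq a b c)))"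
    unfolding singular_chain_of
    by (rule singular_simplex_affine_simplex) (auto simp: \<tau>_def triple_seq_def hull_inc)
  have s2: "singular_chain 2 (top_of_set \<tau>) ?c" by (rule sdiv_chain[OF s1])
  have f: "corner_vertex f ` {..2} \<subseteq> {a,b,c} \<and> small 2 f" if "f \<in> Poly_Mapping.keys ?c" for f
    using small_if_in_simplex[of 2 \<tau> f] s2 that \<tau> by (auto simp: singular_chain_def)
  have ne: "a \<noteq> b" "b \<noteq> c" "a \<noteq> c" using assms by auto
  have other: "ext (triangle_cochain t) ?c = 0" if "t \<noteq> {a,b,c}" for t
  proof -
    have "triangle_cochain t f = 0" if "f \<in> Poly_Mapping.keys ?c" for f
    proof (cases "corner_vertex f 0 = corner_vertex f 1 \<or> corner_vertex f 1 = corner_vertex f 2 \<or> corner_vertex f 0 = corner_vertex f 2")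
      case False
      have h: "corner_vertex f i \<in> {a,b,c}" if "i \<le> 2" for i using f[OF \<open>f \<in> Poly_Mapping.keys ?c\<close>] that by blast
      have "corner_vertex f 0 \<in> {a,b,c}" "corner_vertex f 1 \<in> {a,b,c}" "corner_vertex f 2 \<in> {a,b,c}" by (rule h, simp)+
      then have "{corner_vertex f 0, corner_vertex f 1, corner_vertex f 2} = {a,b,c}" using False by auto
      then show ?thesis using \<open>t \<noteq> {a,b,c}\<close> by (simp add: triangle_cochain_def)
    qed (auto simp: triangle_cochain_def sg_def)
    then show ?thesis by (simp add: ext_def)
  qed
  have sub: "{a,b} \<in> EE" "{b,c} \<in> EE" "{a,c} \<in> EE"
  proof -
    have "{x,y} \<in> EE" if "{x,y} \<subseteq> {a,b,c}" "x \<noteq> y" for x y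
      using simplexD[OF ab that(1)] that(2) by (simp add: EE_def)
    then show "{a,b} \<in> EE" "{b,c} \<in> EE" "{a,c} \<in> EE" using ne by auto
  qed
  have "(\<Sum>t\<in>tri_at TT {a,b}. inc num t {a,b} * ext (triangle_cochain t) ?c) = ext (\<lambda>f. \<Sum>k\<le>2. (-1) ^ k * edge_cochain {a,b} (singular_face 2 k f)) ?c"
    by (rule ext_lin[OF subset_refl]) (use boundary_triangle_cochain sub f in blast)
  also have "\<dots> = ext (edge_cochain {a,b}) (chain_boundary 2 ?c)" by (rule ext_boundary[symmetric]) simp
  also have "chain_boundary 2 ?c = sdiv n 1 (chain_boundary 2 (frag_of (affine_simplex 2 (triple_seq a b c))))"
    using sdiv_boundary[OF s1] by simp
  also have "ext (edge_cochain {a,b}) \<dots> = (if {a,b} = {b,c} then 1 else 0) - (if {a,b} = {a,c} then 1 else 0) + (if {a,b} = {a,b} then 1 else 0)"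
    using assms sub by (simp only: boundary_affine_triangle sdiv_add sdiv_diff ext_add ext_diff edge_identity)
  also have "\<dots> = 1" using ne by (simp add: doubleton_eq_iff)
  also have "(\<Sum>t\<in>tri_at TT {a,b}. inc num t {a,b} * ext (triangle_cochain t) ?c) = (\<Sum>t\<in>{{a,b,c}}. inc num t {a,b} * ext (triangle_cochain t) ?c)"
    by (rule sum.mono_neutral_right) (use finite_TT assms other in \<open>auto simp: tri_at_def\<close>)
  also have "\<dots> = inc num {a,b,c} {a,b} * ext (triangle_cochain {a,b,c}) ?c" by simp
  also have "inc num {a,b,c} {a,b} = (1::int)" using inc_triple[OF ne, of num] assms by (simp add: sg_def)
  finally show ?thesis using other by auto
qed

definition "lo e = (SOME a. \<exists>b. e = {a,b} \<and> num a < num b)"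
definition "hi e = (SOME b. \<exists>a. e = {a,b} \<and> num a < num b)"

lemma lo_hi: "num a < num b \<Longrightarrow> lo {a,b} = a" "num a < num b \<Longrightarrow> hi {a,b} = b"
  unfolding lo_def hi_def by (rule some_equality; force simp: doubleton_eq_iff)+

lemma edge_sorted:
  assumes "e \<in> EE" obtains a b where "e = {a,b}" "num a < num b" "lo e = a" "hi e = b"
proof -
  obtain x y where "e = {x,y}" "x \<noteq> y" using assms by (auto simp: EE_def card_2_iff)
  moreover then have "num x \<noteq> num y" using num_neq EE_TT_subset assms by blast
  ultimately obtain a b where "e = {a,b}" "num a < num b" by (metis insert_commute linorder_neqE_nat)
  then show thesis using that lo_hi by metis
qed

lemma triangle_sorted:
  assumes "t \<in> TT" shows "\<exists>a b c. t = {a,b,c} \<and> num a < num b \<and> num b < num c"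
proof -
  have c3: "card t = 3" using assms by (simp add: TT_def)
  then obtain x where "x \<in> t" by fastforce
  obtain y z where t: "t = {x,y,z}" "x \<noteq> y" "y \<noteq> z" "x \<noteq> z" by (rule triple_through[OF c3 \<open>x \<in> t\<close>])
  then have "num x \<noteq> num y" "num y \<noteq> num z" "num x \<noteq> num z" using num_neq EE_TT_subset(2)[OF assms] by blast+
  then consider "num x < num y \<and> num y < num z" | "num x < num z \<and> num z < num y" | "num y < num x \<and> num x < num z"
    | "num y < num z \<and> num z < num x" | "num z < num x \<and> num x < num y" | "num z < num y \<and> num y < num x" by linarith
  moreover have "t = {x,z,y}" "t = {y,x,z}" "t = {y,z,x}" "t = {z,x,y}" "t = {z,y,x}" using t(1) by auto
  ultimately show ?thesis using t(1) by cases metis+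
qed

definition "edge_chain e = frag_of (affine_simplex 1 (pair_seq (lo e) (hi e)))"

lemma edge_chain_pair: "num a < num b \<Longrightarrow> edge_chain {a,b} = frag_of (affine_simplex 1 (pair_seq a b))"
  by (simp add: edge_chain_def lo_hi)

lemma edge_chain_in: "e \<in> EE \<Longrightarrow> singular_chain 1 (top_of_set X) (edge_chain e)"
proof -
  assume e: "e \<in> EE"
  then obtain a b where ab: "e = {a,b}" "num a < num b" "lo e = a" "hi e = b" by (rule edge_sorted)
  have "convex hull e \<in> K" using hull_vs_image[OF subset_refl, of e] e by (auto simp: EE_def)
  then have sub: "convex hull e \<subseteq> X" by (auto simp: X_def)
  have "singular_simplex 1 (top_of_set (convex hull e)) (affine_simplex 1 (pair_seq a b))"
    by (rule singular_simplex_affine_simplex) (auto simp: pair_seq_def ab hull_inc)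
  then have "singular_simplex 1 (top_of_set X) (affine_simplex 1 (pair_seq a b))" using sub by (rule singular_simplex_mono)
  then show ?thesis using ab by (simp add: edge_chain_def singular_chain_of)
qed

lemma edge_chain_identity: "e \<in> EE \<Longrightarrow> ext (edge_cochain e') (sdiv n 1 (edge_chain e)) = (if e' = e then 1 else 0)"
  using edge_identity edge_sorted[of e] by (metis edge_chain_def)

text \<open>Realize \<open>z\<close> by a singular cycle, bound it in \<open>X\<close>, subdivide
  the bounding chain until it is small, and map it back. The chain map returns the subdivided cycle
  to \<open>z\<close>.\<close>

lemma H1_simplicial:
  assumes ac: "acyclic_space X" and z: "\<And>v. v \<in> VV \<Longrightarrow> bnd1 num EE (z :: 'a set \<Rightarrow> int) v = 0"
  shows "\<exists>c. \<forall>e\<in>EE. z e = bnd num TT c e"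
proof -
  define c where "c = (\<Sum>e\<in>EE. frag_cmul (z e) (edge_chain e))"
  have sc: "singular_chain 1 (top_of_set X) c"
    unfolding c_def by (intro singular_chain_sum singular_chain_cmul edge_chain_in)
  have "chain_boundary 1 c = (\<Sum>e\<in>EE. frag_cmul (z e) (\<Sum>v | v \<in> VV \<and> v \<in> e. frag_cmul (sp num e v) (frag_of (affine_simplex 0 (\<lambda>_. v)))))"
    unfolding c_def chain_boundary_sum o_def chain_boundary_cmul
  proof (rule sum.cong[OF refl])
    fix e assume e: "e \<in> EE"
    then obtain a b where ab: "e = {a,b}" "num a < num b" by (rule edge_sorted)
    have vv: "{v. v \<in> VV \<and> v \<in> e} = {a,b}" using EE_TT_subset(1)[OF e] ab by auto
    have spab: "sp num {a,b} a = (-1::int)" "sp num {a,b} b = (1::int)"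
      using sp_pair[of a b num] sp_pair[of b a num] ab by (auto simp: insert_commute sg_def)
    have "(\<Sum>v | v \<in> VV \<and> v \<in> e. frag_cmul (sp num e v) (frag_of (affine_simplex 0 (\<lambda>_. v))))
        = frag_of (affine_simplex 0 (\<lambda>_. b)) - frag_of (affine_simplex 0 (\<lambda>_. a))"
    proof -
      have "a \<noteq> b" using ab(2) by auto
      then show ?thesis unfolding vv unfolding ab(1) by (simp add: spab)
    qed
    then show "frag_cmul (z e) (chain_boundary 1 (edge_chain e)) = frag_cmul (z e) (\<Sum>v | v \<in> VV \<and> v \<in> e. frag_cmul (sp num e v) (frag_of (affine_simplex 0 (\<lambda>_. v))))"
      using boundary_affine_edge[of a b] ab by (simp add: edge_chain_pair)
  qed
  also have "\<dots> = (\<Sum>e\<in>EE. \<Sum>v | v \<in> VV \<and> v \<in> e. frag_cmul (sp num e v * z e) (frag_of (affine_simplex 0 (\<lambda>_. v))))"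
    by (simp add: frag_cmul_sum mult.commute)
  also have "\<dots> = (\<Sum>v\<in>VV. \<Sum>e | e \<in> EE \<and> v \<in> e. frag_cmul (sp num e v * z e) (frag_of (affine_simplex 0 (\<lambda>_. v))))"
    by (rule sum.swap_restrict) (use finite_EE finite_VV in auto)
  also have "\<dots> = (\<Sum>v\<in>VV. frag_cmul (bnd1 num EE z v) (frag_of (affine_simplex 0 (\<lambda>_. v))))"
  proof (rule sum.cong[OF refl])
    fix v
    have "(\<Sum>e\<in>A. frag_cmul (k e) g) = frag_cmul (\<Sum>e\<in>A. k e) g" for A and k :: "'a set \<Rightarrow> int" and g :: "'a chain"
      by (induction A rule: infinite_finite_induct) (simp_all add: frag_cmul_distrib)
    then show "(\<Sum>e | e \<in> EE \<and> v \<in> e. frag_cmul (sp num e v * z e) (frag_of (affine_simplex 0 (\<lambda>_. v)))) = frag_cmul (bnd1 num EE z v) (frag_of (affine_simplex 0 (\<lambda>_. v)))"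
      by (simp add: bnd1_def)
  qed
  also have "\<dots> = 0" using z by simp
  finally obtain d where d: "singular_chain 2 (top_of_set X) d" "chain_boundary 2 d = c"
    using trivial_homology_boundary[OF ac _ sc] by (auto simp: numeral_2_eq_2)
  obtain n where n: "\<And>f. f \<in> Poly_Mapping.keys (sdiv n 2 d) \<Longrightarrow> small 2 f" using eventually_small[OF d(1)] by blast
  let ?y = "\<lambda>t. ext (triangle_cochain t) (sdiv n 2 d)"
  have "z e = bnd num TT ?y e" if e: "e \<in> EE" for e
  proof -
    have "bnd num TT ?y e = ext (\<lambda>f. \<Sum>k\<le>2. (-1) ^ k * edge_cochain e (singular_face 2 k f)) (sdiv n 2 d)"
      unfolding bnd_def by (rule ext_lin[OF subset_refl]) (use boundary_triangle_cochain e n in blast)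
    also have "\<dots> = ext (edge_cochain e) (chain_boundary 2 (sdiv n 2 d))" by (rule ext_boundary[symmetric]) simp
    also have "chain_boundary 2 (sdiv n 2 d) = sdiv n 1 c" using sdiv_boundary[OF d(1)] d(2) by simp
    also have "ext (edge_cochain e) (sdiv n 1 c) = (\<Sum>e'\<in>EE. z e' * (if e = e' then 1 else 0))"
      unfolding c_def sdiv_sum ext_sum sdiv_cmul ext_cmul by (rule sum.cong) (simp_all only: edge_chain_identity)
    also have "\<dots> = z e" using e finite_EE by (simp add: if_distrib[of "\<lambda>x. _ * x"] cong: if_cong)
    finally show ?thesis by simp
  qed
  then show ?thesis by blast
qed

text \<open>As before, \<open>z\<close> is the image of the boundary of a singular 3-chain; that
  image is 0 because \<open>K\<close> has no simplices of dimension 3.\<close>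

lemma H2_simplicial:
  assumes ac: "acyclic_space X" and z: "\<And>e. e \<in> EE \<Longrightarrow> bnd num TT (z :: 'a set \<Rightarrow> int) e = 0" and t: "t \<in> TT"
  shows "z t = 0"
proof -
  obtain fa fb fc where f: "\<And>t. t \<in> TT \<Longrightarrow> t = {fa t, fb t, fc t} \<and> num (fa t) < num (fb t) \<and> num (fb t) < num (fc t)"
    using triangle_sorted by metis
  define S where "S t = frag_of (affine_simplex 2 (triple_seq (fa t) (fb t) (fc t)))" for t
  define c where "c = (\<Sum>t\<in>TT. frag_cmul (z t) (S t))"
  have "singular_chain 2 (top_of_set X) (S t)" if t: "t \<in> TT" for t
  proof -
    have "convex hull t \<in> K" using hull_vs_image[OF subset_refl, of t] t by (auto simp: TT_def)
    then have sub: "convex hull t \<subseteq> X" by (auto simp: X_def)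
    have "fa t \<in> t" "fb t \<in> t" "fc t \<in> t" using f[OF t] by blast+
    then have "singular_simplex 2 (top_of_set (convex hull t)) (affine_simplex 2 (triple_seq (fa t) (fb t) (fc t)))"
      by (intro singular_simplex_affine_simplex) (auto simp: triple_seq_def hull_inc)
    then have "singular_simplex 2 (top_of_set X) (affine_simplex 2 (triple_seq (fa t) (fb t) (fc t)))" using sub by (rule singular_simplex_mono)
    then show ?thesis by (simp add: S_def singular_chain_of)
  qed
  then have sc: "singular_chain 2 (top_of_set X) c"
    unfolding c_def by (intro singular_chain_sum singular_chain_cmul)
  have "chain_boundary 2 c = (\<Sum>t\<in>TT. frag_cmul (z t) (\<Sum>e | e \<in> EE \<and> e \<subseteq> t. frag_cmul (inc num t e) (edge_chain e)))"
    unfolding c_def chain_boundary_sum o_def chain_boundary_cmul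
  proof (rule sum.cong[OF refl])
    fix t assume t: "t \<in> TT"
    obtain a b c where abc: "a = fa t" "b = fb t" "c = fc t" by simp
    then have tt: "t = {a,b,c}" and lt: "num a < num b" "num b < num c" "num a < num c" using f[OF t] by auto
    have ne: "a \<noteq> b" "b \<noteq> c" "a \<noteq> c" using lt by auto
    have "{e. e \<in> EE \<and> e \<subseteq> t} = {e. card e = 2 \<and> e \<subseteq> t}"
      using t edges_TT by (auto simp: edges_of_def EE_def)
    also have "\<dots> = {{a,b},{b,c},{a,c}}" unfolding tt by (rule card_2_subsets_triple) (use ne in auto)
    finally have E: "{e. e \<in> EE \<and> e \<subseteq> t} = {{a,b},{b,c},{a,c}}" .
    have dd: "{a,b} \<noteq> {b,c}" "{a,b} \<noteq> {a,c}" "{b,c} \<noteq> {a,c}" using ne by (auto simp: doubleton_eq_iff)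
    have "inc num {a,b,c} {a,b} = (1::int)" using inc_triple[OF ne, of num] lt by (simp add: sg_def)
    moreover have "inc num {b,c,a} {b,c} = (1::int)" using inc_triple[of b c a num] ne lt by (simp add: sg_def)
    moreover have "inc num {a,c,b} {a,c} = (-1::int)" using inc_triple[of a c b num] ne lt by (simp add: sg_def)
    moreover have "{b,c,a} = t" "{a,c,b} = t" using tt by auto
    ultimately have "(\<Sum>e | e \<in> EE \<and> e \<subseteq> t. frag_cmul (inc num t e) (edge_chain e)) =
       frag_of (affine_simplex 1 (pair_seq b c)) - frag_of (affine_simplex 1 (pair_seq a c)) + frag_of (affine_simplex 1 (pair_seq a b))"
      unfolding E using dd lt tt by (simp add: edge_chain_pair)
    then show "frag_cmul (z t) (chain_boundary 2 (S t)) = frag_cmul (z t) (\<Sum>e | e \<in> EE \<and> e \<subseteq> t. frag_cmul (inc num t e) (edge_chain e))"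
      using boundary_affine_triangle[of a b c] abc by (simp add: S_def)
  qed
  also have "\<dots> = (\<Sum>t\<in>TT. \<Sum>e | e \<in> EE \<and> e \<subseteq> t. frag_cmul (inc num t e * z t) (edge_chain e))"
    by (simp add: frag_cmul_sum mult.commute)
  also have "\<dots> = (\<Sum>e\<in>EE. \<Sum>t | t \<in> TT \<and> e \<subseteq> t. frag_cmul (inc num t e * z t) (edge_chain e))"
    by (rule sum.swap_restrict) (use finite_EE finite_TT in auto)
  also have "\<dots> = (\<Sum>e\<in>EE. frag_cmul (bnd num TT z e) (edge_chain e))"
  proof (rule sum.cong[OF refl])
    fix e
    have "(\<Sum>e\<in>A. frag_cmul (k e) g) = frag_cmul (\<Sum>e\<in>A. k e) g" for A and k :: "'a set \<Rightarrow> int" and g :: "'a chain"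
      by (induction A rule: infinite_finite_induct) (simp_all add: frag_cmul_distrib)
    then show "(\<Sum>t | t \<in> TT \<and> e \<subseteq> t. frag_cmul (inc num t e * z t) (edge_chain e)) = frag_cmul (bnd num TT z e) (edge_chain e)"
      by (simp add: bnd_def tri_at_def)
  qed
  also have "\<dots> = 0" using z by simp
  finally obtain d where d: "singular_chain 3 (top_of_set X) d" "chain_boundary 3 d = c"
    using trivial_homology_boundary[OF ac _ sc] by (auto simp: numeral_3_eq_3 numeral_2_eq_2)
  obtain n where n: "\<And>f. f \<in> Poly_Mapping.keys (sdiv n 3 d) \<Longrightarrow> small 3 f" using eventually_small[OF d(1)] by blast
  have "0 = ext (\<lambda>f. \<Sum>k\<le>3. (-1) ^ k * triangle_cochain t (singular_face 3 k f)) (sdiv n 3 d)"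
    using boundary_tetrahedron n by (simp add: ext_def)
  also have "\<dots> = ext (triangle_cochain t) (chain_boundary 3 (sdiv n 3 d))" by (rule ext_boundary[symmetric]) simp
  also have "chain_boundary 3 (sdiv n 3 d) = sdiv n 2 c" using sdiv_boundary[OF d(1)] d(2) by simp
  also have "ext (triangle_cochain t) (sdiv n 2 c) = (\<Sum>t'\<in>TT. z t' * (if t = t' then 1 else 0))"
    unfolding c_def sdiv_sum ext_sum sdiv_cmul ext_cmul
  proof (rule sum.cong[OF refl])
    fix t' assume t': "t' \<in> TT"
    have "ext (triangle_cochain t) (sdiv n 2 (S t')) = (if t = {fa t', fb t', fc t'} then 1 else 0)"
      unfolding S_def by (rule triangle_identity) (use f[OF t'] t' in auto)
    then show "z t' * ext (triangle_cochain t) (sdiv n 2 (S t')) = z t' * (if t = t' then 1 else 0)" using f[OF t'] by auto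
  qed
  also have "\<dots> = z t" using t finite_TT by (simp add: if_distrib[of "\<lambda>x. _ * x"] cong: if_cong)
  finally show ?thesis by simp
qed

text \<open>A set of vertices that no edge leaves would split \<open>X\<close> into two disjoint
  nonempty closed unions of simplices.\<close>

lemma cut_connected_EE:
  assumes "connected X" shows "cut_connected VV EE"
  unfolding cut_connected_def
proof (intro allI impI, rule ccontr)
  fix A assume A: "A \<subseteq> VV" "A \<noteq> {}" "A \<noteq> VV" and no: "\<not> (\<exists>e\<in>EE. e \<inter> A \<noteq> {} \<and> \<not> e \<subseteq> A)"
  have dich: "vs \<sigma> \<subseteq> A \<or> vs \<sigma> \<inter> A = {}" if "\<sigma> \<in> K" for \<sigma>
  proof (rule ccontr)
    assume "\<not> (vs \<sigma> \<subseteq> A \<or> vs \<sigma> \<inter> A = {})"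
    then obtain a b where ab: "a \<in> vs \<sigma>" "a \<in> A" "b \<in> vs \<sigma>" "b \<notin> A" by blast
    then have "a \<noteq> b" "{a,b} \<in> vs ` K" using simplexD[OF imageI[OF that], of "{a,b}"] by auto
    then have "{a,b} \<in> EE" by (simp add: EE_def)
    moreover have "{a,b} \<inter> A \<noteq> {} \<and> \<not> {a,b} \<subseteq> A" using ab by simp
    ultimately show False using no by (metis (lifting))
  qed
  define P where "P = \<Union>{\<sigma>\<in>K. vs \<sigma> \<subseteq> A}"
  define Q where "Q = \<Union>{\<sigma>\<in>K. vs \<sigma> \<inter> A = {}}"
  have cl: "closed P" "closed Q" unfolding P_def Q_def using fin_K closed_simplex by (auto intro!: closed_Union)
  have "X \<subseteq> P \<union> Q"
  proof
    fix x assume "x \<in> X"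
    then obtain \<sigma> where "\<sigma> \<in> K" "x \<in> \<sigma>" by (auto simp: X_def)
    then show "x \<in> P \<union> Q" using dich[of \<sigma>] unfolding P_def Q_def by blast
  qed
  moreover have "P \<inter> Q \<inter> X = {}"
  proof -
    have False if x: "x \<in> P" "x \<in> Q" for x
    proof -
      obtain \<sigma> \<tau> where st: "\<sigma> \<in> K" "\<tau> \<in> K" "x \<in> \<sigma>" "x \<in> \<tau>" "vs \<sigma> \<subseteq> A" "vs \<tau> \<inter> A = {}"
        using x unfolding P_def Q_def by blast
      have "vs (\<sigma> \<inter> \<tau>) = {}" using st vs_Int by blast
      then have "\<sigma> \<inter> \<tau> = {}" using simplex_vs(2)[OF Int_in[OF st(1,2)]] by simp
      then show False using st by blast
    qed
    then show ?thesis by blast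
  qed
  moreover have "P \<inter> X \<noteq> {}"
  proof -
    obtain a where "a \<in> A" using A by blast
    then have "{a} \<in> K" "vs {a} \<subseteq> A" using A vs_sing by (auto simp: VV_def)
    then show ?thesis by (auto simp: P_def X_def)
  qed
  moreover have "Q \<inter> X \<noteq> {}"
  proof -
    obtain a where "a \<in> VV" "a \<notin> A" using A by blast
    then have "{a} \<in> K" "vs {a} \<inter> A = {}" using vs_sing by (auto simp: VV_def)
    then show ?thesis by (auto simp: Q_def X_def)
  qed
  ultimately show False using assms cl unfolding connected_closed by blast
qed

lemma acyclic_complex2_if_acyclic_space:
  assumes "acyclic_space X"
  shows "acyclic_complex2 VV EE TT num"
proof
  show "finite VV" by (rule finite_VV)
  show "e \<subseteq> VV \<and> card e = 2" if "e \<in> EE" for e using that EE_TT_subset by (auto simp: EE_def)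
  show "t \<subseteq> VV \<and> card t = 3" if "t \<in> TT" for t using that EE_TT_subset by (auto simp: TT_def)
  show "cut_connected VV EE" using cut_connected_EE path_connected_imp_connected acyclic_path_connected(1)[OF assms] by blast
  obtain x where "x \<in> \<Union>K" using K_ne by blast
  then show "VV \<noteq> {}" using in_ostar_ex by blast
qed (use edges_TT inj_num H1_simplicial[OF assms] H2_simplicial[OF assms] in blast)+

end

section \<open>Books and planar points\<close>

text \<open>A family of half-discs glued along their common diameter, the pages of a book.\<close>

definition half_disc :: "real \<Rightarrow> (real \<times> real) set" where
  "half_disc \<epsilon> = {(s,u). \<bar>s\<bar> < \<epsilon> \<and> 0 \<le> u \<and> u < \<epsilon>}"

definition pages :: "'i set \<Rightarrow> real \<Rightarrow> ('i \<Rightarrow> real \<times> real \<Rightarrow> 'c::topological_space) \<Rightarrow> bool" where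
  "pages I \<epsilon> q \<longleftrightarrow> 0 < \<epsilon> \<and> (\<forall>i\<in>I. continuous_on (half_disc \<epsilon>) (q i)) \<and>
     (\<forall>i\<in>I. \<forall>j\<in>I. \<forall>s. \<bar>s\<bar> < \<epsilon> \<longrightarrow> q i (s,0) = q j (s,0)) \<and>
     (\<forall>i\<in>I. \<forall>j\<in>I. \<forall>z\<in>half_disc \<epsilon>. \<forall>w\<in>half_disc \<epsilon>. q i z = q j w \<longrightarrow> z = w \<and> (i = j \<or> snd z = 0))"

lemma zero_in_half_disc: "0 < \<epsilon> \<Longrightarrow> (0,0) \<in> half_disc \<epsilon>" by (simp add: half_disc_def)

lemma pagesI:
  assumes "0 < \<epsilon>" "\<And>i. i \<in> I \<Longrightarrow> continuous_on (half_disc \<epsilon>) (q i)"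
    "\<And>i j s. i \<in> I \<Longrightarrow> j \<in> I \<Longrightarrow> \<bar>s\<bar> < \<epsilon> \<Longrightarrow> q i (s,0) = q j (s,0)"
    "\<And>i j z w. i \<in> I \<Longrightarrow> j \<in> I \<Longrightarrow> z \<in> half_disc \<epsilon> \<Longrightarrow> w \<in> half_disc \<epsilon> \<Longrightarrow> q i z = q j w \<Longrightarrow>
       z = w \<and> (i = j \<or> snd z = 0)"
  shows "pages I \<epsilon> q"
  unfolding pages_def
proof (intro conjI)
  show "0 < \<epsilon>" by (rule assms(1))
  show "\<forall>i\<in>I. continuous_on (half_disc \<epsilon>) (q i)" by (intro ballI assms(2))
  show "\<forall>i\<in>I. \<forall>j\<in>I. \<forall>s. \<bar>s\<bar> < \<epsilon> \<longrightarrow> q i (s,0) = q j (s,0)" by (intro ballI allI impI assms(3))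
  show "\<forall>i\<in>I. \<forall>j\<in>I. \<forall>z\<in>half_disc \<epsilon>. \<forall>w\<in>half_disc \<epsilon>. q i z = q j w \<longrightarrow> z = w \<and> (i = j \<or> snd z = 0)"
    by (intro ballI impI assms(4))
qed

lemma pagesD:
  assumes "pages I \<epsilon> q"
  shows "0 < \<epsilon>" "\<And>i. i \<in> I \<Longrightarrow> continuous_on (half_disc \<epsilon>) (q i)"
    "\<And>i j s. i \<in> I \<Longrightarrow> j \<in> I \<Longrightarrow> \<bar>s\<bar> < \<epsilon> \<Longrightarrow> q i (s,0) = q j (s,0)"
    "\<And>i j z w. i \<in> I \<Longrightarrow> j \<in> I \<Longrightarrow> z \<in> half_disc \<epsilon> \<Longrightarrow> w \<in> half_disc \<epsilon> \<Longrightarrow> q i z = q j w \<Longrightarrow>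
       z = w \<and> (i = j \<or> snd z = 0)"
proof -
  note * = assms[unfolded pages_def]
  show "0 < \<epsilon>" by (rule *[THEN conjunct1])
  show "continuous_on (half_disc \<epsilon>) (q i)" if "i \<in> I" for i
    by (rule *[THEN conjunct2, THEN conjunct1, rule_format, OF that])
  show "q i (s,0) = q j (s,0)" if "i \<in> I" "j \<in> I" "\<bar>s\<bar> < \<epsilon>" for i j s
    by (rule *[THEN conjunct2, THEN conjunct2, THEN conjunct1, rule_format, OF that])
  show "z = w \<and> (i = j \<or> snd z = 0)"
    if "i \<in> I" "j \<in> I" "z \<in> half_disc \<epsilon>" "w \<in> half_disc \<epsilon>" "q i z = q j w" for i j z w
    by (rule *[THEN conjunct2, THEN conjunct2, THEN conjunct2, THEN bspec, THEN bspec, THEN bspec, THEN bspec, THEN mp, OF that])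
qed

lemma pages_subset:
  assumes p: "pages I \<epsilon> q" and J: "J \<subseteq> I" shows "pages J \<epsilon> q"
proof (rule pagesI)
  show "q i (s,0) = q j (s,0)" if "i \<in> J" "j \<in> J" "\<bar>s\<bar> < \<epsilon>" for i j s
    by (rule pagesD(3)[OF p subsetD[OF J] subsetD[OF J]]) fact+
  show "z = w \<and> (i = j \<or> snd z = 0)"
    if "i \<in> J" "j \<in> J" "z \<in> half_disc \<epsilon>" "w \<in> half_disc \<epsilon>" "q i z = q j w" for i j z w
    by (rule pagesD(4)[OF p subsetD[OF J] subsetD[OF J]]) fact+
  show "continuous_on (half_disc \<epsilon>) (q i)" if "i \<in> J" for i
    by (rule pagesD(2)[OF p subsetD[OF J that]])
qed (rule pagesD(1)[OF p])

lemma pages_compose: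
  assumes "pages I \<epsilon> q" "continuous_on U f" "inj_on f U" "\<And>i. i \<in> I \<Longrightarrow> q i ` half_disc \<epsilon> \<subseteq> U"
  shows "pages I \<epsilon> (\<lambda>i z. f (q i z))"
proof (rule pagesI)
  note D = pagesD[OF assms(1)]
  show "0 < \<epsilon>" by (rule D)
  show "continuous_on (half_disc \<epsilon>) (\<lambda>z. f (q i z))" if "i \<in> I" for i
    by (rule continuous_on_compose2[OF assms(2) D(2)[OF that] assms(4)[OF that]])
  show "f (q i (s,0)) = f (q j (s,0))" if "i \<in> I" "j \<in> I" "\<bar>s\<bar> < \<epsilon>" for i j s
    using D(3)[OF that] by simp
  show "z = w \<and> (i = j \<or> snd z = 0)" if *: "i \<in> I" "j \<in> I" "z \<in> half_disc \<epsilon>" "w \<in> half_disc \<epsilon>" "f (q i z) = f (q j w)" for i j z w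
  proof (rule D(4)[OF *(1-4)])
    show "q i z = q j w" by (rule inj_onD[OF assms(3) *(5)]) (use assms(4) * in blast)+
  qed
qed

lemma half_disc_mono: "\<delta> \<le> \<epsilon> \<Longrightarrow> half_disc \<delta> \<subseteq> half_disc \<epsilon>"
  by (auto simp: half_disc_def)

lemma pages_shrink:
  assumes "pages I \<epsilon> q" "0 < \<delta>" "\<delta> \<le> \<epsilon>" shows "pages I \<delta> q"
proof (rule pagesI)
  note D = pagesD[OF assms(1)]
  show "continuous_on (half_disc \<delta>) (q i)" if "i \<in> I" for i
    by (rule continuous_on_subset[OF D(2)[OF that] half_disc_mono[OF assms(3)]])
  show "q i (s,0) = q j (s,0)" if "i \<in> I" "j \<in> I" "\<bar>s\<bar> < \<delta>" for i j s
    using D(3)[OF that(1,2)] that(3) assms(3) by simp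
  show "z = w \<and> (i = j \<or> snd z = 0)" if *: "i \<in> I" "j \<in> I" "z \<in> half_disc \<delta>" "w \<in> half_disc \<delta>" "q i z = q j w" for i j z w
    by (rule D(4)[OF *(1,2) _ _ *(5)]) (use * half_disc_mono[OF assms(3)] in blast)+
qed (rule assms(2))

lemma pages_into_open:
  fixes q :: "'i \<Rightarrow> real \<times> real \<Rightarrow> 'c::metric_space"
  assumes "pages I \<epsilon> q" "finite I" "I \<noteq> {}" "openin (top_of_set X) U" "\<And>i. i \<in> I \<Longrightarrow> q i ` half_disc \<epsilon> \<subseteq> X"
    "\<And>i. i \<in> I \<Longrightarrow> q i (0,0) \<in> U"
  obtains \<delta> where "0 < \<delta>" "\<delta> \<le> \<epsilon>" "\<And>i. i \<in> I \<Longrightarrow> q i ` half_disc \<delta> \<subseteq> U"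
proof -
  have e: "0 < \<epsilon>" using assms(1) by (simp add: pages_def)
  have "\<exists>\<delta>. 0 < \<delta> \<and> \<delta> \<le> \<epsilon> \<and> q i ` half_disc \<delta> \<subseteq> U" if i: "i \<in> I" for i
  proof -
    obtain W where W: "open W" "U = X \<inter> W" using assms(4) by (auto simp: openin_open)
    have c: "continuous_on (half_disc \<epsilon>) (q i)" using assms(1) i by (auto simp: pages_def)
    have "q i (0,0) \<in> W" using assms(6)[OF i] W by blast
    then obtain r where r: "r > 0" "ball (q i (0,0)) r \<subseteq> W" using W(1) open_contains_ball by blast
    obtain d where d: "d > 0" "\<forall>z\<in>half_disc \<epsilon>. dist z (0,0) < d \<longrightarrow> dist (q i z) (q i (0,0)) < r"
      using c zero_in_half_disc[OF e] r(1) unfolding continuous_on_iff by metis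
    define \<delta> where "\<delta> = min \<epsilon> (d/2)"
    have "q i z \<in> U" if z: "z \<in> half_disc \<delta>" for z
    proof -
      obtain s u where su: "z = (s,u)" by fastforce
      have "dist z (0,0) \<le> \<bar>s\<bar> + \<bar>u\<bar>" unfolding su dist_Pair_Pair by (simp add: sqrt_sum_squares_le_sum_abs)
      also have "\<dots> < d" using z by (auto simp: half_disc_def su \<delta>_def)
      finally have "dist (q i z) (q i (0,0)) < r" using d z half_disc_mono[of \<delta> \<epsilon>] by (auto simp: \<delta>_def)
      then have "q i z \<in> W" using r(2) by (auto simp: dist_commute)
      moreover have "q i z \<in> X" using assms(5)[OF i] z half_disc_mono[of \<delta> \<epsilon>] by (auto simp: \<delta>_def)
      ultimately show ?thesis using W by blast
    qed
    then show ?thesis using e d(1) by (intro exI[of _ \<delta>]) (auto simp: \<delta>_def)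
  qed
  then obtain D where D: "\<And>i. i \<in> I \<Longrightarrow> 0 < D i \<and> D i \<le> \<epsilon> \<and> q i ` half_disc (D i) \<subseteq> U" by metis
  define \<delta> where "\<delta> = Min (D ` I)"
  have "\<delta> \<in> D ` I" unfolding \<delta>_def using assms by simp
  then have "0 < \<delta>" "\<delta> \<le> \<epsilon>" using D by auto
  moreover have "q i ` half_disc \<delta> \<subseteq> U" if "i \<in> I" for i
  proof -
    have "\<delta> \<le> D i" unfolding \<delta>_def using assms that by simp
    then show ?thesis using half_disc_mono[of \<delta> "D i"] D[OF that] by blast
  qed
  ultimately show thesis by (rule that)
qed

text \<open>Reflect one page and glue it to the other along the axis. This maps an open square
  injectively into the plane, and the image is open by invariance of domain.\<close>

lemma two_pages_open:
  fixes q :: "'i \<Rightarrow> real \<times> real \<Rightarrow> real \<times> real"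
  assumes p: "pages I \<epsilon> q" and ij: "i \<in> I" "j \<in> I" "i \<noteq> j"
  obtains W where "open W" "q i (0,0) \<in> W" "W \<subseteq> q i ` half_disc \<epsilon> \<union> q j ` half_disc \<epsilon>"
proof -
  have e: "0 < \<epsilon>" using p by (simp add: pages_def)
  define B where "B = {-\<epsilon><..<\<epsilon>} \<times> {-\<epsilon><..<\<epsilon>}"
  define r where "r z = (fst z, - snd z)" for z :: "real \<times> real"
  define G where "G z = (if snd z \<le> 0 then q j (r z) else q i z)" for z
  have mem: "z \<in> half_disc \<epsilon>" if "z \<in> B" "0 \<le> snd z" for z using that by (cases z) (auto simp: B_def half_disc_def)
  have memr: "r z \<in> half_disc \<epsilon>" if "z \<in> B" "snd z \<le> 0" for z using that by (cases z) (auto simp: B_def half_disc_def r_def)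
  have ax: "q j (s,0) = q i (s,0)" if "\<bar>s\<bar> < \<epsilon>" for s by (rule pagesD(3)[OF p ij(2,1) that])
  have inj: "z = w \<and> (a = b \<or> snd z = 0)" if "q a z = q b w" "a \<in> {i,j}" "b \<in> {i,j}" "z \<in> half_disc \<epsilon>" "w \<in> half_disc \<epsilon>" for a b z w
    by (rule pagesD(4)[OF p _ _ that(4,5,1)]) (use that(2,3) ij in auto)
  have "continuous_on B G"
    unfolding G_def
  proof (rule continuous_on_cases_le)
    show "continuous_on {z \<in> B. snd z \<le> 0} (\<lambda>z. q j (r z))"
    proof (rule continuous_on_compose2[of "half_disc \<epsilon>" "q j"])
      show "continuous_on (half_disc \<epsilon>) (q j)" using p ij by (simp add: pages_def)
      show "continuous_on {z \<in> B. snd z \<le> 0} r" unfolding r_def by (intro continuous_intros)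
    qed (use memr in auto)
    show "continuous_on {z \<in> B. 0 \<le> snd z} (q i)"
    proof (rule continuous_on_subset)
      show "continuous_on (half_disc \<epsilon>) (q i)" using p ij by (simp add: pages_def)
    qed (use mem in auto)
    show "continuous_on B (\<lambda>z. snd z)" by (intro continuous_intros)
    show "q j (r z) = q i z" if "z \<in> B" "snd z = 0" for z
      using ax[of "fst z"] that by (cases z) (auto simp: r_def B_def)
  qed
  moreover have "open B" unfolding B_def by (intro open_Times) auto
  moreover have "inj_on G B"
  proof (rule inj_onI)
    fix z w assume zw: "z \<in> B" "w \<in> B" "G z = G w"
    have rr: "z' = w'" if "r z' = r w'" for z' w' using that by (cases z', cases w') (auto simp: r_def)
    have r0: "r z' = z'" if "snd z' = 0" for z' using that by (cases z') (auto simp: r_def)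
    have sr: "snd (r z') = - snd z'" for z' by (simp add: r_def)
    consider "snd z \<le> 0" "snd w \<le> 0" | "snd z \<le> 0" "0 < snd w" | "0 < snd z" "snd w \<le> 0" | "0 < snd z" "0 < snd w" by linarith
    then show "z = w"
    proof cases
      case 1
      then have "r z = r w" using inj[of j "r z" j "r w"] zw memr by (simp add: G_def)
      then show ?thesis by (rule rr)
    next
      case 2
      have "r z = w \<and> (j = i \<or> snd (r z) = 0)"
        by (rule inj) (use zw 2 memr[of z] mem[of w] in \<open>auto simp: G_def\<close>)
      then have "snd w = 0" using ij(3) by metis
      then show ?thesis using 2 by simp
    next
      case 3
      have "z = r w \<and> (i = j \<or> snd z = 0)"
        by (rule inj) (use zw 3 memr[of w] mem[of z] in \<open>auto simp: G_def\<close>)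
      then have "snd z = 0" using ij(3) by metis
      then show ?thesis using 3 by simp
    next
      case 4
      then show ?thesis using inj[of i z i w] zw mem by (simp add: G_def)
    qed
  qed
  ultimately have "open (G ` B)" by (intro invariance_of_domain) auto
  moreover have "q i (0,0) \<in> G ` B"
  proof
    show "(0,0) \<in> B" using e by (simp add: B_def)
    show "q i (0,0) = G (0,0)" using ax[of 0] e by (simp add: G_def r_def)
  qed
  moreover have "G ` B \<subseteq> q i ` half_disc \<epsilon> \<union> q j ` half_disc \<epsilon>"
    unfolding G_def using mem memr by (auto split: if_splits)
  ultimately show thesis by (rule that)
qed

text \<open>Two pages already fill a neighbourhood of the centre, so the third would have to meet
  them off the axis.\<close>

lemma no_three_pages_in_plane:
  fixes q :: "'i \<Rightarrow> real \<times> real \<Rightarrow> real \<times> real"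
  assumes p: "pages I \<epsilon> q" and ijk: "i \<in> I" "j \<in> I" "k \<in> I" "i \<noteq> j" "j \<noteq> k" "i \<noteq> k"
  shows False
proof -
  have e: "0 < \<epsilon>" using p by (simp add: pages_def)
  obtain W where W: "open W" "q i (0,0) \<in> W" "W \<subseteq> q i ` half_disc \<epsilon> \<union> q j ` half_disc \<epsilon>"
    using two_pages_open[OF p ijk(1,2,4)] by blast
  have 0: "q k (0,0) = q i (0,0)" using pagesD(3)[OF p ijk(3,1), of 0] e by simp
  have pk: "pages {k} \<epsilon> q" using pages_subset[OF p] ijk by simp
  obtain \<delta> where d: "0 < \<delta>" "\<delta> \<le> \<epsilon>" "q k ` half_disc \<delta> \<subseteq> W"
    using pages_into_open[OF pk, of UNIV W] W 0 by (auto simp: openin_open)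
  have z: "(0,\<delta>/2) \<in> half_disc \<delta>" using d by (simp add: half_disc_def)
  then have z': "(0,\<delta>/2) \<in> half_disc \<epsilon>" using half_disc_mono d by blast
  have "q k (0,\<delta>/2) \<in> q i ` half_disc \<epsilon> \<union> q j ` half_disc \<epsilon>"
    using subsetD[OF W(3) subsetD[OF d(3) imageI[OF z]]] .
  then obtain a w where aw: "a = i \<or> a = j" "w \<in> half_disc \<epsilon>" "q k (0,\<delta>/2) = q a w"
    by (elim UnE imageE) (simp_all, metis+)
  then have "k = a \<or> snd (0::real,\<delta>/2) = 0" using pagesD(4)[OF p ijk(3) _ z' aw(2,3)] aw(1) ijk by auto
  then show False using aw ijk d by auto
qed

text \<open>Two pages fill a neighbourhood of the centre, and this reaches below a boundary line
  through the centre.\<close>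

lemma no_two_pages_in_half_plane:
  fixes q :: "'i \<Rightarrow> real \<times> real \<Rightarrow> real \<times> real"
  assumes p: "pages I \<epsilon> q" and ij: "i \<in> I" "j \<in> I" "i \<noteq> j"
    and half: "\<And>a z. a \<in> {i,j} \<Longrightarrow> z \<in> half_disc \<epsilon> \<Longrightarrow> 0 \<le> snd (q a z)" and 0: "snd (q i (0,0)) = 0"
  shows False
proof -
  obtain W where W: "open W" "q i (0,0) \<in> W" "W \<subseteq> q i ` half_disc \<epsilon> \<union> q j ` half_disc \<epsilon>"
    using two_pages_open[OF p ij] by blast
  obtain r where r: "r > 0" "ball (q i (0,0)) r \<subseteq> W" using W open_contains_ball by blast
  have "q i (0,0) - (0,r/2) \<in> ball (q i (0,0)) r" using r by (simp add: dist_norm norm_Pair)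
  then have "q i (0,0) - (0,r/2) \<in> q i ` half_disc \<epsilon> \<union> q j ` half_disc \<epsilon>"
    by (rule subsetD[OF W(3) subsetD[OF r(2)]])
  then have "0 \<le> snd (q i (0,0) - (0,r/2))"
  proof
    assume "q i (0,0) - (0,r/2) \<in> q i ` half_disc \<epsilon>"
    then obtain z where "z \<in> half_disc \<epsilon>" "q i (0,0) - (0,r/2) = q i z" by (rule imageE)
    then show ?thesis using half[of i z] by simp
  next
    assume "q i (0,0) - (0,r/2) \<in> q j ` half_disc \<epsilon>"
    then obtain z where "z \<in> half_disc \<epsilon>" "q i (0,0) - (0,r/2) = q j z" by (rule imageE)
    then show ?thesis using half[of j z] by simp
  qed
  then show False using 0 r by simp
qed

text \<open>The one-dimensional analogue: two legs fill a neighbourhood of the centre in the line,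
  so the third would have to meet them elsewhere.\<close>

lemma no_triod_in_line:
  fixes q :: "'i \<Rightarrow> real \<Rightarrow> real"
  assumes e: "0 < \<epsilon>" and ijk: "i \<in> I" "j \<in> I" "k \<in> I" "i \<noteq> j" "j \<noteq> k" "i \<noteq> k"
    and c: "\<And>a. a \<in> I \<Longrightarrow> continuous_on {0..<\<epsilon>} (q a)"
    and inj: "\<And>a b s t. \<lbrakk>a \<in> I; b \<in> I; s \<in> {0..<\<epsilon>}; t \<in> {0..<\<epsilon>}; q a s = q b t\<rbrakk> \<Longrightarrow> s = t \<and> (a = b \<or> s = 0)"
    and 0: "\<And>a b. a \<in> I \<Longrightarrow> b \<in> I \<Longrightarrow> q a 0 = q b 0"
  shows False
proof -
  define B where "B = {-\<epsilon><..<\<epsilon>}"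
  define G where "G s = (if s \<le> 0 then q j (- s) else q i s)" for s
  have "continuous_on B G" unfolding G_def
  proof (rule continuous_on_cases_le)
    show "continuous_on {s \<in> B. s \<le> 0} (\<lambda>s. q j (- s))"
      by (rule continuous_on_compose2[OF c[OF ijk(2)]]) (auto simp: B_def intro!: continuous_intros)
    show "continuous_on {s \<in> B. 0 \<le> s} (q i)"
      by (rule continuous_on_subset[OF c[OF ijk(1)]]) (auto simp: B_def)
  qed (auto simp: 0[OF ijk(1,2)] intro!: continuous_intros)
  moreover have "inj_on G B"
  proof (rule inj_onI)
    fix s t assume st: "s \<in> B" "t \<in> B" "G s = G t"
    consider "s \<le> 0" "t \<le> 0" | "s \<le> 0" "0 < t" | "0 < s" "t \<le> 0" | "0 < s" "0 < t" by linarith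
    then show "s = t"
    proof cases
      case 1 then show ?thesis using inj[of j j "-s" "-t"] st ijk by (simp add: G_def B_def)
    next
      case 2 then show ?thesis using inj[of j i "-s" "t"] st ijk by (simp add: G_def B_def)
    next
      case 3 then show ?thesis using inj[of i j "s" "-t"] st ijk by (simp add: G_def B_def)
    next
      case 4 then show ?thesis using inj[of i i s t] st ijk by (simp add: G_def B_def)
    qed
  qed
  ultimately have o: "open (G ` B)" by (intro invariance_of_domain) (auto simp: B_def)
  have "G 0 = q k 0" using 0[OF ijk(2,3)] by (simp add: G_def)
  moreover have "0 \<in> B" using e by (simp add: B_def)
  ultimately have "q k 0 \<in> G ` B" by (metis image_eqI)
  then obtain r where r: "r > 0" "ball (q k 0) r \<subseteq> G ` B" using o open_contains_ball by blast
  have "0 \<in> {0..<\<epsilon>}" using e by simp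
  then obtain d where d: "d > 0" "\<forall>s\<in>{0..<\<epsilon>}. dist s 0 < d \<longrightarrow> dist (q k s) (q k 0) < r"
    using c[OF ijk(3)] r(1) unfolding continuous_on_iff by metis
  define s where "s = min (\<epsilon>/2) (d/2)"
  have s: "0 < s" "s \<in> {0..<\<epsilon>}" "dist s 0 < d" using e d(1) by (auto simp: s_def dist_real_def)
  then have "dist (q k s) (q k 0) < r" using d(2) by blast
  then have "q k s \<in> G ` B" using r(2) by (auto simp: dist_commute)
  then obtain t where t: "t \<in> B" "q k s = G t" by blast
  show False
  proof (cases "t \<le> 0")
    case True
    then show ?thesis using inj[of k j s "-t"] t s ijk by (auto simp: G_def B_def)
  next
    case False
    then show ?thesis using inj[of k i s t] t s ijk by (auto simp: G_def B_def)
  qed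
qed

text \<open>A neighbourhood maps injectively into the plane, not necessarily onto an open set; so
  boundary points of surfaces count as planar too.\<close>

definition planar_at :: "'a::topological_space set \<Rightarrow> 'a \<Rightarrow> bool" where
  "planar_at X x \<longleftrightarrow> (\<exists>U (f :: 'a \<Rightarrow> real \<times> real). openin (top_of_set X) U \<and> x \<in> U \<and> continuous_on U f \<and> inj_on f U)"

lemma planar_atI:
  fixes f :: "'a::topological_space \<Rightarrow> real \<times> real"
  assumes "openin (top_of_set X) U" "x \<in> U" "continuous_on U f" "inj_on f U"
  shows "planar_at X x"
  using assms unfolding planar_at_def by blast

lemma planar_atE:
  assumes "planar_at X x"
  obtains U and f :: "'a::topological_space \<Rightarrow> real \<times> real" where "openin (top_of_set X) U" "x \<in> U" "continuous_on U f" "inj_on f U"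
  using assms unfolding planar_at_def by blast

lemma not_planar_at_pages:
  fixes q :: "'i \<Rightarrow> real \<times> real \<Rightarrow> 'c::metric_space"
  assumes p: "pages I \<epsilon> q" and ijk: "i \<in> I" "j \<in> I" "k \<in> I" "i \<noteq> j" "j \<noteq> k" "i \<noteq> k"
    and X: "\<And>a. a \<in> I \<Longrightarrow> q a ` half_disc \<epsilon> \<subseteq> X"
  shows "\<not> planar_at X (q i (0,0))"
proof
  assume "planar_at X (q i (0,0))"
  then obtain U and f :: "'c \<Rightarrow> real \<times> real" where U: "openin (top_of_set X) U" "q i (0,0) \<in> U" "continuous_on U f" "inj_on f U"
    by (rule planar_atE)
  let ?J = "{i,j,k}"
  have pJ: "pages ?J \<epsilon> q" using pages_subset[OF p] ijk by simp
  have qa: "q a (0,0) \<in> U" if "a \<in> ?J" for a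
  proof -
    have "q a (0,0) = q i (0,0)" using pagesD(3)[OF pJ that, of i 0] pagesD(1)[OF p] by simp
    then show ?thesis using U by simp
  qed
  obtain \<delta> where d: "0 < \<delta>" "\<delta> \<le> \<epsilon>" "\<And>a. a \<in> ?J \<Longrightarrow> q a ` half_disc \<delta> \<subseteq> U"
  proof (rule pages_into_open[OF pJ _ _ U(1)])
    show "q a ` half_disc \<epsilon> \<subseteq> X" if "a \<in> ?J" for a using X that ijk by auto
    show "q a (0,0) \<in> U" if "a \<in> ?J" for a by (rule qa[OF that])
  qed auto
  have "pages ?J \<delta> (\<lambda>i z. f (q i z))"
    by (rule pages_compose[OF pages_shrink[OF pJ d(1,2)] U(3,4) d(3)])
  then show False by (rule no_three_pages_in_plane[of _ _ _ i j k]) (use ijk in auto)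
qed

text \<open>Only the topology of the local model is kept. The open star of \<open>x\<close>, in the
  triangulation that defines the regular neighbourhood, is open in \<open>X\<close> and contained in
  that neighbourhood, so the PL homeomorphism restricts to a chart.\<close>

lemma modelled_on_chart:
  assumes "modelled_on X x M B"
  obtains U f g where "openin (top_of_set X) U" "x \<in> U" "homeomorphism U (f ` U) f g"
    "openin (top_of_set M) (f ` U)" "f x \<in> B"
proof -
  obtain N h where N: "regular_nbhd X x N" "pl_homeomorphism N M h" "h x \<in> B"
    using assms by (auto simp: modelled_on_def)
  obtain g where g: "homeomorphism N M h g" using N(2) by (auto simp: pl_homeomorphism_def)
  obtain K where K: "simplicial_complex K" "\<Union>K = X" "{x} \<in> K" "N = \<Union>{\<sigma>\<in>K. x \<in> \<sigma>}"
    using N(1) by (auto simp: regular_nbhd_def)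
  interpret scomplex K by unfold_locales (rule K)
  have U: "openin (top_of_set X) (ostar x)"
    using ostar_open[of x] K(2) by (auto simp: openin_open)
  have xU: "x \<in> ostar x" using K by (auto simp: ostar_def)
  have UN: "ostar x \<subseteq> N" using K by (auto simp: ostar_def)
  have NX: "N \<subseteq> X" using K by auto
  have "openin (top_of_set N) (ostar x)"
    using U UN NX by (meson openin_subset_trans)
  then have "openin (top_of_set M) (h ` ostar x)" using g homeomorphism_imp_open_map by blast
  moreover have "homeomorphism (ostar x) (h ` ostar x) h g"
    using g UN by (meson homeomorphism_of_subsets homeomorphism_image1 image_mono subset_refl order_refl image_subset_iff homeomorphism_def)
  ultimately show thesis using that U xU N(3) by blast
qed

lemma chart_restrict:
  assumes "homeomorphism U (f ` U) f g" "V \<subseteq> U"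
  shows "homeomorphism V (f ` V) f g"
  by (rule homeomorphism_of_subsets[OF assms(1,2)]) (use assms in auto)

lemma chart_openin:
  assumes "homeomorphism U (f ` U) f g" "openin (top_of_set M) (f ` U)" "openin (top_of_set X) V" "V \<subseteq> U" "U \<subseteq> X"
  shows "openin (top_of_set M) (f ` V)"
proof -
  have "openin (top_of_set U) V" using assms by (meson openin_subset_trans)
  then have "openin (top_of_set (f ` U)) (f ` V)" using assms(1) homeomorphism_imp_open_map by blast
  then show ?thesis using assms(2) openin_trans by blast
qed

lemma planar_at_if_surface:
  assumes "surface_point X x \<or> boundary_surface_point X x"
  shows "planar_at X x"
proof -
  obtain M :: "(real \<times> real) set" and B where "modelled_on X x M B"
    using assms unfolding surface_point_def boundary_surface_point_def by blast
  then obtain U f g where "openin (top_of_set X) U" "x \<in> U" "homeomorphism U (f ` U) f g"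
    "openin (top_of_set M) (f ` U)" "f x \<in> B"
    by (rule modelled_on_chart)
  then show ?thesis
    by (intro planar_atI[of X U x f]) (auto simp: homeomorphism_def intro: inj_on_inverseI)
qed

lemma Y_graph_iff: "y \<in> Y_graph \<longleftrightarrow> (\<exists>b\<in>Basis. \<exists>u. 0 \<le> u \<and> u \<le> 1 \<and> y = u *\<^sub>R b)"
  by (auto simp: Y_graph_def cone_from_def closed_segment_def)

text \<open>One notion for interior and boundary triple points. The endpoints 1 and -1 of the
  compact models are removed, so the axis has no artificial endpoints; in the half-open case it ends
  at \<open>x\<close> itself.\<close>

definition book_chart :: "'a::euclidean_space set \<Rightarrow> 'a \<Rightarrow> 'a set \<Rightarrow> ('a \<Rightarrow> (real^3) \<times> real) \<Rightarrow> ((real^3) \<times> real \<Rightarrow> 'a) \<Rightarrow> bool" where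
  "book_chart X x U f g \<longleftrightarrow> openin (top_of_set X) U \<and> x \<in> U \<and> f x = (0,0) \<and> homeomorphism U (f ` U) f g \<and>
     f ` U \<subseteq> Y_graph \<times> UNIV \<and>
     (openin (top_of_set (Y_graph \<times> {-1<..<1})) (f ` U) \<or> openin (top_of_set (Y_graph \<times> {0..<1})) (f ` U))"

lemma book_chart_if_triple:
  assumes "triple_point X x \<or> boundary_triple_point X x"
  obtains U f g where "book_chart X x U f g"
proof -
  obtain S :: "real set" where S: "S = {-1..1} \<or> S = {0..1}" "modelled_on X x (Y_graph \<times> S) {(0,0)}"
    using assms unfolding triple_point_def boundary_triple_point_def by blast
  obtain U f g where U: "openin (top_of_set X) U" "x \<in> U" "homeomorphism U (f ` U) f g"
    "openin (top_of_set (Y_graph \<times> S)) (f ` U)" "f x \<in> {(0,0)}"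
    using modelled_on_chart[OF S(2)] by blast
  define V where "V = {w\<in>U. snd (f w) \<in> {-1<..<1}}"
  define S' where "S' = S \<inter> {-1<..<1}"
  have S': "S' = {-1<..<1} \<or> S' = {0..<1}" using S(1) by (auto simp: S'_def)
  have VU: "V \<subseteq> U" by (auto simp: V_def)
  have UX: "U \<subseteq> X" using U(1) openin_imp_subset by blast
  have cf: "continuous_on U (\<lambda>w. snd (f w))" using U(3) by (auto simp: homeomorphism_def intro: continuous_on_snd)
  have "openin (top_of_set U) V"
    using continuous_openin_preimage_gen[OF cf open_greaterThanLessThan[of "-1" 1]] by (simp add: V_def vimage_def Int_def)
  then have V: "openin (top_of_set X) V" using U(1) openin_trans by blast
  have h: "homeomorphism V (f ` V) f g" by (rule chart_restrict[OF U(3) VU])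
  have o: "openin (top_of_set (Y_graph \<times> S)) (f ` V)" by (rule chart_openin[OF U(3,4) V VU UX])
  have "f ` V \<subseteq> Y_graph \<times> S'" using o openin_imp_subset[OF o] by (auto simp: V_def S'_def)
  moreover have "Y_graph \<times> S' \<subseteq> Y_graph \<times> S" by (auto simp: S'_def)
  ultimately have "openin (top_of_set (Y_graph \<times> S')) (f ` V)" using o by (meson openin_subset_trans)
  then have "book_chart X x V f g"
    unfolding book_chart_def using V U h S' \<open>f ` V \<subseteq> Y_graph \<times> S'\<close> by (auto simp: V_def)
  then show thesis by (rule that)
qed

lemma book_chartD:
  assumes "book_chart X x U f g"
  shows "openin (top_of_set X) U" "x \<in> U" "f x = (0,0)" "continuous_on U f" "inj_on f U" "homeomorphism U (f ` U) f g"
    "\<And>w. w \<in> U \<Longrightarrow> fst (f w) \<in> Y_graph"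
  using assms by (auto simp: book_chart_def homeomorphism_def intro: inj_on_inverseI)

text \<open>Near a point off the axis the chart stays on one page, where the coordinates along the
  axis and along the page are injective.\<close>

lemma planar_at_off_axis:
  assumes "book_chart X x U f g" "w \<in> U" "fst (f w) \<noteq> 0"
  shows "planar_at X w"
proof -
  note D = book_chartD[OF assms(1)]
  obtain b u where b: "b \<in> Basis" "0 \<le> u" "u \<le> 1" "fst (f w) = u *\<^sub>R b" using D(7)[OF assms(2)] Y_graph_iff by blast
  then have "u > 0" using assms(3) by (cases "u = 0") auto
  define V where "V = {z\<in>U. fst (f z) \<bullet> b \<in> {0<..}}"
  have c: "continuous_on U (\<lambda>z. fst (f z) \<bullet> b)" using D(4) by (intro continuous_intros)
  have "openin (top_of_set U) V"
    using continuous_openin_preimage_gen[OF c open_greaterThan[of 0]] by (simp add: V_def vimage_def Int_def)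
  then have V: "openin (top_of_set X) V" using D(1) openin_trans by blast
  have "fst (f z) = (fst (f z) \<bullet> b) *\<^sub>R b" if z: "z \<in> V" for z
  proof -
    obtain b' u' where b': "b' \<in> Basis" "0 \<le> u'" "fst (f z) = u' *\<^sub>R b'" using D(7)[of z] z Y_graph_iff by (auto simp: V_def)
    have "b' = b" using z b' b(1) by (auto simp: V_def inner_Basis split: if_splits)
    then show ?thesis using b' by simp
  qed
  then have "inj_on (\<lambda>z. (snd (f z), fst (f z) \<bullet> b)) V"
    using inj_onD[OF D(5)] by (intro inj_onI) (metis (no_types, lifting) V_def mem_Collect_eq prod.sel prod_eqI)
  moreover have "w \<in> V" using assms(2) b \<open>u > 0\<close> by (simp add: V_def)
  moreover have "continuous_on V (\<lambda>z. (snd (f z), fst (f z) \<bullet> b))"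
    using D(4) by (intro continuous_intros continuous_on_subset[OF D(4)]) (auto simp: V_def)
  ultimately show ?thesis using planar_atI[OF V] by blast
qed

lemma book_pages:
  assumes "\<epsilon> > 0"
  shows "pages (Basis :: (real^3) set) \<epsilon> (\<lambda>b (s,u). (u *\<^sub>R b, c + s))"
proof (rule pagesI)
  show "z = w \<and> (i = j \<or> snd z = 0)"
    if "i \<in> Basis" "j \<in> Basis" "z \<in> half_disc \<epsilon>" "w \<in> half_disc \<epsilon>" "(case z of (s,u) \<Rightarrow> (u *\<^sub>R i, c + s)) = (case w of (s,u) \<Rightarrow> (u *\<^sub>R j, c + s))" for i j :: "real^3" and z w
  proof -
    obtain s u where z: "z = (s,u)" by fastforce
    obtain s' u' where w: "w = (s',u')" by fastforce
    have ss: "s = s'" and uu: "u *\<^sub>R i = u' *\<^sub>R j" using that(5) by (auto simp: z w)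
    have "(u *\<^sub>R i) \<bullet> i = (u' *\<^sub>R j) \<bullet> i" "(u *\<^sub>R i) \<bullet> j = (u' *\<^sub>R j) \<bullet> j" using uu by simp_all
    then show ?thesis using that(1,2) ss z w by (auto simp: inner_Basis split: if_splits)
  qed
qed (use assms in \<open>auto simp: case_prod_unfold intro!: continuous_intros\<close>)

text \<open>A point of the axis other than \<open>x\<close> has room on both sides along the axis,
  even if the axis ends at \<open>x\<close>. So it is the centre of a book with three pages.\<close>

lemma not_planar_at_on_axis:
  assumes "book_chart X x U f g" "w \<in> U" "fst (f w) = 0" "w \<noteq> x"
  shows "\<not> planar_at X w"
proof -
  note D = book_chartD[OF assms(1)]
  define c where "c = snd (f w)"
  have fw: "f w = (0,c)" using assms(3) by (simp add: c_def prod_eq_iff)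
  have "c \<noteq> 0" using inj_onD[OF D(5), of w x] fw D(2,3) assms(2,4) by auto
  obtain S :: "real set" where S: "S = {-1<..<1} \<or> S = {0..<1}" "openin (top_of_set (Y_graph \<times> S)) (f ` U)"
    using assms(1) unfolding book_chart_def by blast
  have "f w \<in> Y_graph \<times> S" using openin_imp_subset[OF S(2)] assms(2) by blast
  then have cS: "c \<in> S" by (simp add: fw)
  obtain \<epsilon> where e: "\<epsilon> > 0" "\<And>s. \<bar>s\<bar> < \<epsilon> \<Longrightarrow> c + s \<in> S"
  proof (cases "S = {0..<1}")
    case True
    show thesis by (rule that[of "min (1 - c) c"]) (use True cS \<open>c \<noteq> 0\<close> in auto)
  next
    case False
    then have "S = {-1<..<1}" using S(1) by blast
    then show thesis using cS by (intro that[of "min (1 - c) (1 + c)"]) auto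
  qed
  let ?q = "\<lambda>b (s,u). (u *\<^sub>R b, c + s) :: (real^3) \<times> real"
  define \<epsilon>' where "\<epsilon>' = min \<epsilon> 1"
  have e': "\<epsilon>' > 0" "\<epsilon>' \<le> \<epsilon>" "\<epsilon>' \<le> 1" using e(1) by (auto simp: \<epsilon>'_def)
  have sub: "?q b ` half_disc \<epsilon>' \<subseteq> Y_graph \<times> S" if "b \<in> Basis" for b
  proof -
    have "u *\<^sub>R b \<in> Y_graph" if "0 \<le> u" "u < \<epsilon>'" for u
      using that e' \<open>b \<in> Basis\<close> by (auto simp: Y_graph_iff intro!: bexI[of _ b] exI[of _ u])
    moreover have "c + s \<in> S" if "\<bar>s\<bar> < \<epsilon>'" for s
      using that e' by (intro e(2)) simp
    ultimately show ?thesis by (auto simp: half_disc_def)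
  qed
  have "(Basis :: (real^3) set) \<noteq> {}" by simp
  then obtain \<delta> where d: "0 < \<delta>" "\<delta> \<le> \<epsilon>'" "\<And>b. b \<in> Basis \<Longrightarrow> ?q b ` half_disc \<delta> \<subseteq> f ` U"
  proof (rule pages_into_open[OF book_pages[OF e'(1)] finite_Basis _ S(2) sub])
    show "?q i (0,0) \<in> f ` U" for i using fw assms(2) by (auto simp: image_iff intro!: bexI[of _ w])
  qed auto
  have cg: "continuous_on (f ` U) g" "inj_on g (f ` U)" "g ` f ` U = U"
    using D(6) by (auto simp: homeomorphism_def intro: inj_on_inverseI)
  have p: "pages Basis \<delta> (\<lambda>b z. g (?q b z))"
    by (rule pages_compose[OF book_pages[OF d(1)] cg(1,2) d(3)])
  have c3: "card (Basis :: (real^3) set) = 3" by simp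
  then obtain i j k :: "real^3" where ijk: "Basis = {i,j,k}" "i \<noteq> j" "j \<noteq> k" "i \<noteq> k"
    using c3 unfolding card_3_iff by blast
  have "\<not> planar_at X (g (?q i (0,0)))"
  proof (rule not_planar_at_pages[OF p, of i j k])
    have "U \<subseteq> X" using D(1) openin_imp_subset by blast
    then show "(\<lambda>z. g (?q a z)) ` half_disc \<delta> \<subseteq> X" if "a \<in> Basis" for a
      using d(3)[OF that] cg(3) by blast
  qed (use ijk in auto)
  moreover have "g (?q i (0,0)) = w" using fw D(6) assms(2) by (auto simp: homeomorphism_def)
  ultimately show ?thesis by simp
qed

text \<open>The legs are connected, so the triod lies in a single circle. Removing a point of one
  leg turns the circle into a line, and the shortened triod contradicts
  \<open>no_triod_in_line\<close>.\<close>

lemma no_triod_in_circles: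
  fixes q :: "'i \<Rightarrow> real \<Rightarrow> 'a::euclidean_space"
  assumes S: "disjoint_union_of_circles S" and e: "0 < \<epsilon>"
    and ijk: "i \<in> I" "j \<in> I" "k \<in> I" "i \<noteq> j" "j \<noteq> k" "i \<noteq> k"
    and c: "\<And>a. a \<in> I \<Longrightarrow> continuous_on {0..<\<epsilon>} (q a)"
    and inj: "\<And>a b s t. \<lbrakk>a \<in> I; b \<in> I; s \<in> {0..<\<epsilon>}; t \<in> {0..<\<epsilon>}; q a s = q b t\<rbrakk> \<Longrightarrow> s = t \<and> (a = b \<or> s = 0)"
    and 0: "\<And>a b. a \<in> I \<Longrightarrow> b \<in> I \<Longrightarrow> q a 0 = q b 0"
    and sub: "\<And>a s. a \<in> I \<Longrightarrow> s \<in> {0..<\<epsilon>} \<Longrightarrow> q a s \<in> S"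
  shows False
proof -
  obtain \<C> where C: "finite \<C>" "pairwise disjnt \<C>" "\<Union>\<C> = S" "\<And>C. C \<in> \<C> \<Longrightarrow> C homeomorphic sphere (0::real^2) 1"
    using S unfolding disjoint_union_of_circles_def by blast
  have cl: "closed C" if "C \<in> \<C>" for C
    using C(4)[OF that] compact_sphere homeomorphic_compactness compact_imp_closed by blast
  obtain C0 where C0: "C0 \<in> \<C>" "q i 0 \<in> C0" using sub[OF ijk(1), of 0] e C(3) by auto
  have inC: "q a s \<in> C0" if a: "a \<in> I" and s: "s \<in> {0..<\<epsilon>}" for a s
  proof (rule ccontr)
    assume no: "q a s \<notin> C0"
    let ?A = "q a ` {0..<\<epsilon>}" and ?R = "\<Union>(\<C> - {C0})"
    have "connected ?A" by (intro connected_continuous_image c a) simp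
    moreover have "closed ?R" using C(1) cl by (intro closed_Union) auto
    moreover have "?A \<subseteq> C0 \<union> ?R" using sub[OF a] C(3) by auto
    moreover have "C0 \<inter> ?R \<inter> ?A = {}" using C(2) C0(1) by (auto simp: pairwise_def disjnt_def)
    moreover have "C0 \<inter> ?A \<noteq> {}"
    proof -
      have "q a 0 \<in> C0" using 0[OF a ijk(1)] C0 by simp
      moreover have "q a 0 \<in> ?A" using e by (intro imageI) simp
      ultimately show ?thesis by blast
    qed
    moreover have "?R \<inter> ?A \<noteq> {}"
    proof -
      have "q a s \<in> ?R" using sub[OF a s] C(3) no by auto
      then show ?thesis using s by blast
    qed
    ultimately show False using cl[OF C0(1)] unfolding connected_closed by (metis (no_types, lifting))
  qed
  obtain \<phi> \<phi>' where phi: "homeomorphism C0 (sphere (0::real^2) 1) \<phi> \<phi>'" using C(4)[OF C0(1)] by (auto simp: homeomorphic_def)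
  define \<delta> where "\<delta> = \<epsilon> / 2"
  have d: "0 < \<delta>" "\<delta> < \<epsilon>" using e by (auto simp: \<delta>_def)
  \<comment> \<open>The point to be removed; by injectivity no leg meets it at parameters below
    \<open>\<delta>\<close>.\<close>
  define p where "p = \<phi> (q i \<delta>)"
  have ph: "\<phi> ` C0 = sphere 0 1" "continuous_on C0 \<phi>" "inj_on \<phi> C0" using phi by (auto simp: homeomorphism_def intro: inj_on_inverseI)
  have pS: "p \<in> sphere 0 1" using inC[OF ijk(1), of \<delta>] d ph(1) by (auto simp: p_def)
  have "(sphere (0::real^2) 1 - {p}) homeomorphic (UNIV :: real set)"
    by (rule homeomorphic_punctured_sphere_affine) (use pS in \<open>auto simp: aff_dim_UNIV\<close>)
  then obtain \<psi> \<psi>' where psi: "homeomorphism (sphere (0::real^2) 1 - {p}) (UNIV :: real set) \<psi> \<psi>'" by (auto simp: homeomorphic_def)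
  then have ps: "continuous_on (sphere 0 1 - {p}) \<psi>" "inj_on \<psi> (sphere 0 1 - {p})" by (auto simp: homeomorphism_def intro: inj_on_inverseI)
  have in_p: "\<phi> (q a s) \<in> sphere 0 1 - {p}" if "a \<in> I" "s \<in> {0..<\<delta>}" for a s
  proof -
    have s: "s \<in> {0..<\<epsilon>}" using that d by auto
    have "\<phi> (q a s) \<noteq> p"
    proof
      assume "\<phi> (q a s) = p"
      then have "q a s = q i \<delta>" using inj_onD[OF ph(3)] inC[OF that(1) s] inC[OF ijk(1), of \<delta>] d by (simp add: p_def)
      then have "s = \<delta>" using inj[OF that(1) ijk(1) s, of \<delta>] d by simp
      then show False using that by simp
    qed
    then show ?thesis using inC[OF that(1) s] ph(1) by blast
  qed
  show False
  proof (rule no_triod_in_line[OF d(1) ijk, of "\<lambda>a s. \<psi> (\<phi> (q a s))"])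
    fix a assume a: "a \<in> I"
    have "continuous_on {0..<\<delta>} (q a)" by (rule continuous_on_subset[OF c[OF a]]) (use d in auto)
    then have "continuous_on {0..<\<delta>} (\<lambda>s. \<phi> (q a s))"
      by (rule continuous_on_compose2[OF ph(2)]) (use inC[OF a] d in auto)
    then show "continuous_on {0..<\<delta>} (\<lambda>s. \<psi> (\<phi> (q a s)))"
      by (rule continuous_on_compose2[OF ps(1)]) (use in_p[OF a] in blast)
  next
    fix a b s t assume *: "a \<in> I" "b \<in> I" "s \<in> {0..<\<delta>}" "t \<in> {0..<\<delta>}" "\<psi> (\<phi> (q a s)) = \<psi> (\<phi> (q b t))"
    have st: "s \<in> {0..<\<epsilon>}" "t \<in> {0..<\<epsilon>}" using * d by auto
    have "\<phi> (q a s) = \<phi> (q b t)" using inj_onD[OF ps(2) *(5)] in_p * by blast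
    then have "q a s = q b t" using inj_onD[OF ph(3)] inC * st by blast
    then show "s = t \<and> (a = b \<or> s = 0)" by (rule inj[OF *(1,2) st])
  next
    show "\<psi> (\<phi> (q a 0)) = \<psi> (\<phi> (q b 0))" if "a \<in> I" "b \<in> I" for a b using 0[OF that] by simp
  qed
qed

section \<open>Exclusion of true vertices\<close>

lemma in_cone_K4:
  assumes "b \<in> Basis" "b' \<in> Basis" "0 \<le> \<alpha>" "0 \<le> \<beta>" "\<alpha> + \<beta> \<le> 1"
  shows "\<alpha> *\<^sub>R b + \<beta> *\<^sub>R b' \<in> cone_from 0 K4_graph"
proof -
  \<comment> \<open>Cone coordinates: \<open>r\<close> is the height over the cone point and
    \<open>t\<close> the position on the edge from \<open>b\<close> to \<open>b'\<close>.\<close>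
  define r where "r = \<alpha> + \<beta>"
  define t where "t = (if r = 0 then 0 else \<beta> / r)"
  have t: "0 \<le> t" "t \<le> 1" using assms by (auto simp: t_def r_def divide_simps)
  have y: "(1 - t) *\<^sub>R b + t *\<^sub>R b' \<in> K4_graph"
    unfolding K4_graph_def closed_segment_def using assms(1,2) t by blast
  have "r * t = \<beta>"
  proof (cases "r = 0")
    case True then show ?thesis using assms by (simp add: r_def)
  next
    case False then show ?thesis by (simp add: t_def)
  qed
  moreover from this have "r * (1 - t) = \<alpha>" by (simp add: right_diff_distrib r_def)
  ultimately have rt: "r * t = \<beta>" "r * (1 - t) = \<alpha>" .
  have "\<alpha> *\<^sub>R b + \<beta> *\<^sub>R b' = (1 - r) *\<^sub>R 0 + r *\<^sub>R ((1 - t) *\<^sub>R b + t *\<^sub>R b')"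
    by (simp add: scaleR_add_right rt)
  moreover have "0 \<le> r" "r \<le> 1" using assms by (auto simp: r_def)
  ultimately have "\<alpha> *\<^sub>R b + \<beta> *\<^sub>R b' \<in> closed_segment 0 ((1 - t) *\<^sub>R b + t *\<^sub>R b')"
    unfolding closed_segment_def by blast
  then show ?thesis using y unfolding cone_from_def by blast
qed

text \<open>Near the cone point, each ray towards a vertex of the complete graph is the axis of
  three pages, one for each other vertex. So its points are not planar and belong to
  \<open>Sing X\<close>, and three of the four rays form a triod there.\<close>

lemma no_true_vertex:
  fixes X :: "'a::euclidean_space set"
  assumes simple: "simple_polyhedron X" and circ: "disjoint_union_of_circles (Sing X)" and x: "x \<in> X"
  shows "\<not> true_vertex X x"
proof
  assume tv: "true_vertex X x"
  let ?M = "cone_from 0 K4_graph"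
  obtain U f g where U: "openin (top_of_set X) U" "x \<in> U" "homeomorphism U (f ` U) f g" "openin (top_of_set ?M) (f ` U)" "f x \<in> {0}"
    using modelled_on_chart tv unfolding true_vertex_def by blast
  have UX: "U \<subseteq> X" using U(1) openin_imp_subset by blast
  have g: "continuous_on (f ` U) g" "inj_on g (f ` U)" "\<And>w. w \<in> U \<Longrightarrow> g (f w) = w" "g ` f ` U = U"
    using U(3) by (auto simp: homeomorphism_def intro: inj_on_inverseI)
  obtain W where W: "open W" "f ` U = ?M \<inter> W" using U(4) by (auto simp: openin_open)
  have "0 \<in> W" using U(2,5) W by auto
  then obtain \<rho>' where r': "\<rho>' > 0" "ball 0 \<rho>' \<subseteq> W" using W(1) open_contains_ball by blast
  define \<rho> where "\<rho> = min (\<rho>'/2) (1/2)"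
  have r: "\<rho> > 0" "\<rho> < \<rho>'" "\<rho> < 1" using r' by (auto simp: \<rho>_def)
  have inU: "s *\<^sub>R b \<in> f ` U" if "b \<in> Basis" "s \<in> {0..<\<rho>}" for b s
  proof -
    have "s *\<^sub>R b \<in> W" using that r r' by (intro subsetD[OF r'(2)]) simp
    moreover have "s *\<^sub>R b \<in> ?M" using in_cone_K4[OF that(1,1), of s 0] that r by simp
    ultimately show ?thesis using W by blast
  qed
  have np: "\<not> planar_at X (g (s *\<^sub>R b))" if b: "b \<in> Basis" and s: "0 < s" "s < \<rho>" for b s
  proof -
    let ?q = "\<lambda>b' (h,u). (s + h) *\<^sub>R b + u *\<^sub>R b' :: real^4"
    let ?I = "Basis - {b}"
    \<comment> \<open>Half of \<open>s\<close> keeps the coefficient of \<open>b\<close>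
      nonnegative, and half of \<open>1 - s\<close> keeps the total weight at most 1.\<close>
    define \<epsilon> where "\<epsilon> = min s (1 - s) / 2"
    have e: "\<epsilon> > 0" "\<epsilon> \<le> s/2" "\<epsilon> \<le> (1 - s)/2" using s r by (auto simp: \<epsilon>_def)
    have p: "pages ?I \<epsilon> ?q"
    proof (rule pagesI)
      show "z = w \<and> (i = j \<or> snd z = 0)"
        if *: "i \<in> ?I" "j \<in> ?I" "z \<in> half_disc \<epsilon>" "w \<in> half_disc \<epsilon>" "?q i z = ?q j w" for i j z w
      proof -
        obtain h u where z: "z = (h,u)" by fastforce
        obtain h' u' where w: "w = (h',u')" by fastforce
        have eq: "(s + h) *\<^sub>R b + u *\<^sub>R i = (s + h') *\<^sub>R b + u' *\<^sub>R j" using *(5) by (simp add: z w)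
        have "((s + h) *\<^sub>R b + u *\<^sub>R i) \<bullet> c = ((s + h') *\<^sub>R b + u' *\<^sub>R j) \<bullet> c" for c unfolding eq ..
        from this[of b] this[of i] this[of j] show ?thesis
          using *(1,2) b by (auto simp: z w inner_add_left inner_Basis split: if_splits)
      qed
    qed (use e in \<open>auto simp: case_prod_unfold intro!: continuous_intros\<close>)
    have qM: "?q i ` half_disc \<epsilon> \<subseteq> ?M" if "i \<in> ?I" for i
    proof clarsimp
      fix h u assume "(h,u) \<in> half_disc \<epsilon>"
      then show "(s + h) *\<^sub>R b + u *\<^sub>R i \<in> ?M" using that e s r by (intro in_cone_K4 b) (auto simp: half_disc_def)
    qed
    have I: "finite ?I" "card ?I = 3" using b by auto
    then obtain i j k where ijk: "?I = {i,j,k}" "i \<noteq> j" "j \<noteq> k" "i \<noteq> k"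
      using I(2) unfolding card_3_iff by blast
    have ne: "?I \<noteq> {}" using ijk by simp
    have q0: "?q a (0,0) = s *\<^sub>R b" for a by simp
    have q0U: "?q a (0,0) \<in> f ` U" for a unfolding q0 using inU[OF b, of s] s by simp
    obtain \<delta> where d: "0 < \<delta>" "\<delta> \<le> \<epsilon>" "\<And>a. a \<in> ?I \<Longrightarrow> ?q a ` half_disc \<delta> \<subseteq> f ` U"
      using pages_into_open[OF p I(1) ne U(4) qM q0U] by blast
    have "pages ?I \<delta> (\<lambda>a z. g (?q a z))"
      by (rule pages_compose[OF pages_shrink[OF p d(1,2)] g(1,2) d(3)])
    then have "\<not> planar_at X (g (?q i (0,0)))"
    proof (rule not_planar_at_pages[of _ _ _ i j k])
      show "(\<lambda>z. g (?q a z)) ` half_disc \<delta> \<subseteq> X" if "a \<in> ?I" for a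
        using d(3)[OF that] g(4) UX by blast
    qed (unfold ijk(1), use ijk in auto)
    then show ?thesis unfolding q0 .
  qed
  have sing: "g (s *\<^sub>R b) \<in> Sing X" if b: "b \<in> Basis" and s: "s \<in> {0..<\<rho>}" for b s
  proof (cases "s = 0")
    case True
    then have "g (s *\<^sub>R b) = x" using g(3)[OF U(2)] U(5) by simp
    then show ?thesis using tv x by (simp add: Sing_def)
  next
    case False
    have X: "g (s *\<^sub>R b) \<in> X" using inU[OF b s] g(4) UX by blast
    then show ?thesis using np[OF b, of s] False s planar_at_if_surface[of X "g (s *\<^sub>R b)"] simple
      unfolding simple_polyhedron_def Sing_def by auto
  qed
  obtain B :: "(real^4) set" where B: "B \<subseteq> Basis" "card B = 3"
    using obtain_subset_with_card_n[of 3 "Basis :: (real^4) set"] by auto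
  then obtain i j k where B': "B = {i,j,k}" "i \<noteq> j" "j \<noteq> k" "i \<noteq> k"
    unfolding card_3_iff by blast
  then have ijkl: "i \<in> Basis" "j \<in> Basis" "k \<in> Basis" "i \<noteq> j" "j \<noteq> k" "i \<noteq> k" using B(1) by auto
  show False
  proof (rule no_triod_in_circles[OF circ r(1), of i Basis j k "\<lambda>b s. g (s *\<^sub>R b)"])
    fix a :: "real^4" assume a: "a \<in> Basis"
    show "continuous_on {0..<\<rho>} (\<lambda>s. g (s *\<^sub>R a))"
      by (rule continuous_on_compose2[OF g(1)]) (use inU[OF a] in \<open>auto intro!: continuous_intros\<close>)
  next
    fix a b :: "real^4" and s t assume *: "a \<in> Basis" "b \<in> Basis" "s \<in> {0..<\<rho>}" "t \<in> {0..<\<rho>}" "g (s *\<^sub>R a) = g (t *\<^sub>R b)"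
    have eq: "s *\<^sub>R a = t *\<^sub>R b" using inj_onD[OF g(2) *(5)] inU * by blast
    have "(s *\<^sub>R a) \<bullet> c = (t *\<^sub>R b) \<bullet> c" for c unfolding eq ..
    from this[of a] this[of b] show "s = t \<and> (a = b \<or> s = 0)" using *(1,2) by (auto simp: inner_Basis split: if_splits)
  qed (use ijkl sing in auto)
qed

lemma simple_dichotomy:
  assumes "simple_polyhedron X" "disjoint_union_of_circles (Sing X)" "x \<in> X"
  shows "planar_at X x \<or> (\<exists>U f g. book_chart X x U f g)"
  using assms no_true_vertex[OF assms] planar_at_if_surface[of X x] book_chart_if_triple[of X x]
  unfolding simple_polyhedron_def by metis

text \<open>Flat points are dense because the interior of a convex model is dense in it. Later this
  forces all maximal simplices to be triangles.\<close>

lemma flat_dense_planar: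
  fixes X :: "'a::euclidean_space set" and M :: "(real \<times> real) set"
  assumes "modelled_on X x M B" "convex M" "interior M \<noteq> {}" "openin (top_of_set X) V" "x \<in> V" "closed M"
  shows "\<exists>V' (k :: 'a \<Rightarrow> real \<times> real) k'. V' \<subseteq> V \<and> V' \<noteq> {} \<and> openin (top_of_set X) V' \<and> homeomorphism V' (k ` V') k k' \<and> open (k ` V')"
proof -
  obtain U f g where U: "openin (top_of_set X) U" "x \<in> U" "homeomorphism U (f ` U) f g" "openin (top_of_set M) (f ` U)"
    using modelled_on_chart[OF assms(1)] by metis
  have UX: "U \<subseteq> X" using U(1) openin_imp_subset by blast
  define W where "W = U \<inter> V"
  have W: "openin (top_of_set X) W" "W \<subseteq> U" using U(1) assms(4) by (auto simp: W_def)
  have "openin (top_of_set M) (f ` W)" by (rule chart_openin[OF U(3,4) W UX])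
  then obtain G where G: "open G" "f ` W = M \<inter> G" by (auto simp: openin_open)
  have fx: "f x \<in> M \<inter> G" using U(2) assms(5) unfolding G(2)[symmetric] by (auto simp: W_def)
  have "closure (interior M) = M" using convex_closure_interior[OF assms(2,3)] assms(6) by simp
  then have "interior M \<inter> G \<noteq> {}" using fx G(1) by (metis IntD1 IntD2 disjoint_iff open_Int_closure_eq_empty Int_commute)
  define V' where "V' = {w\<in>W. f w \<in> interior M}"
  have cW: "continuous_on W f" using U(3) W(2) by (auto simp: homeomorphism_def intro: continuous_on_subset)
  have "openin (top_of_set W) V'"
    using continuous_openin_preimage_gen[OF cW open_interior] by (simp add: V'_def vimage_def Int_def)
  then have oV: "openin (top_of_set X) V'" using W(1) openin_trans by blast
  have fV: "f ` V' = interior M \<inter> G"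
  proof
    show "f ` V' \<subseteq> interior M \<inter> G" using G(2) by (auto simp: V'_def)
    show "interior M \<inter> G \<subseteq> f ` V'"
    proof
      fix y assume y: "y \<in> interior M \<inter> G"
      then have "y \<in> f ` W" unfolding G(2) using interior_subset by blast
      then show "y \<in> f ` V'" using y by (auto simp: V'_def)
    qed
  qed
  have "V' \<subseteq> U" "V' \<subseteq> V" by (auto simp: V'_def W_def)
  show ?thesis
  proof (intro exI[of _ V'] exI[of _ f] exI[of _ g] conjI)
    show "V' \<noteq> {}" using fV \<open>interior M \<inter> G \<noteq> {}\<close> by blast
    show "open (f ` V')" unfolding fV using G(1) by (intro open_Int open_interior)
    show "homeomorphism V' (f ` V') f g" by (rule chart_restrict[OF U(3) \<open>V' \<subseteq> U\<close>])
  qed (fact \<open>V' \<subseteq> V\<close> oV)+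
qed

text \<open>At a triple point the flat set is taken in the interior of one page, close to the image
  of \<open>x\<close>.\<close>

lemma flat_dense_book:
  fixes X :: "'a::euclidean_space set"
  assumes "book_chart X x U f g" "openin (top_of_set X) V" "x \<in> V"
  shows "\<exists>V' (k :: 'a \<Rightarrow> real \<times> real) k'. V' \<subseteq> V \<and> V' \<noteq> {} \<and> openin (top_of_set X) V' \<and> homeomorphism V' (k ` V') k k' \<and> open (k ` V')"
proof -
  note D = book_chartD[OF assms(1)]
  obtain S :: "real set" where S: "S = {-1<..<1} \<or> S = {0..<1}" "openin (top_of_set (Y_graph \<times> S)) (f ` U)"
    using assms(1) unfolding book_chart_def by blast
  have UX: "U \<subseteq> X" using D(1) openin_imp_subset by blast
  define W where "W = U \<inter> V"
  have W: "openin (top_of_set X) W" "W \<subseteq> U" using D(1) assms(2) by (auto simp: W_def)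
  have "openin (top_of_set (Y_graph \<times> S)) (f ` W)" by (rule chart_openin[OF D(6) S(2) W UX])
  then obtain G where G: "open G" "f ` W = (Y_graph \<times> S) \<inter> G" by (auto simp: openin_open)
  have "f x \<in> f ` W" using D(2) assms(3) by (auto simp: W_def)
  then have G0: "(0,0) \<in> G" using D(3) unfolding G(2) by simp
  obtain b :: "real^3" where b: "b \<in> Basis" using nonempty_Basis by blast
  let ?m = "\<lambda>z :: real \<times> real. (snd z *\<^sub>R b, fst z)"
  define Q where "Q = ({0<..<1} \<times> {0<..<1}) \<inter> ?m -` G"
  have oQ: "open Q" unfolding Q_def
    by (intro open_Int open_Times open_vimage G(1) continuous_intros)
  have Qne: "Q \<noteq> {}"
  proof -
    have "open (?m -` G)" by (intro open_vimage G(1) continuous_intros)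
    moreover have "(0,0) \<in> ?m -` G" using G0 by simp
    ultimately obtain r where r: "r > 0" "ball (0,0) r \<subseteq> ?m -` G" using open_contains_ball by blast
    \<comment> \<open>The bound \<open>r/4\<close> keeps \<open>(t,t)\<close> in the ball, and
      \<open>1/2\<close> keeps it in the open unit square.\<close>
    define t where "t = min (r/4) (1/2)"
    have t: "0 < t" "t < 1" "2 * t < r" using r(1) by (auto simp: t_def)
    have "dist (0,0) (t,t) \<le> \<bar>dist 0 t\<bar> + \<bar>dist 0 t\<bar>" unfolding dist_Pair_Pair by (rule sqrt_sum_squares_le_sum_abs)
    then have "(t,t) \<in> ball (0,0) r" using t by (simp add: dist_real_def)
    then have "(t,t) \<in> Q" using r(2) t by (auto simp: Q_def)
    then show ?thesis by blast
  qed
  define k where "k w = (snd (f w), fst (f w) \<bullet> b)" for w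
  define V' where "V' = {w\<in>W. k w \<in> {0<..<1} \<times> {0<..<1}}"
  have ck: "continuous_on U k" unfolding k_def using D(4) by (intro continuous_intros)
  have "openin (top_of_set W) V'"
    using continuous_openin_preimage_gen[OF continuous_on_subset[OF ck W(2)] open_Times[OF open_greaterThanLessThan[of 0 1] open_greaterThanLessThan[of 0 1]]]
    by (simp add: V'_def vimage_def Int_def)
  then have oV: "openin (top_of_set X) V'" using W(1) openin_trans by blast
  have fk: "f w = ?m (k w)" if "w \<in> V'" for w
  proof -
    have w: "w \<in> U" "fst (f w) \<bullet> b > 0" using that W(2) by (auto simp: V'_def k_def)
    obtain b' u' where b': "b' \<in> Basis" "0 \<le> u'" "fst (f w) = u' *\<^sub>R b'" using D(7)[OF w(1)] Y_graph_iff by blast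
    have "b' = b" using w(2) b' b by (auto simp: inner_Basis split: if_splits)
    then show ?thesis using b' b by (simp add: k_def prod_eq_iff)
  qed
  have kV: "k ` V' = Q"
  proof
    show "k ` V' \<subseteq> Q"
    proof
      fix z assume "z \<in> k ` V'"
      then obtain w where w: "w \<in> V'" "z = k w" by blast
      have "f w \<in> G" using w(1) G(2) by (auto simp: V'_def)
      then show "z \<in> Q" using w fk[OF w(1)] by (auto simp: Q_def V'_def)
    qed
    show "Q \<subseteq> k ` V'"
    proof
      fix z assume z: "z \<in> Q"
      have "snd z *\<^sub>R b \<in> Y_graph" using z b by (auto simp: Q_def Y_graph_iff intro!: bexI[of _ b] exI[of _ "snd z"])
      moreover have "fst z \<in> S" using z S(1) by (auto simp: Q_def)
      ultimately have "?m z \<in> f ` W" using z unfolding G(2) by (simp add: Q_def)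
      then obtain w where w: "w \<in> W" "?m z = f w" by blast
      then have "k w = (snd (?m z), fst (?m z) \<bullet> b)" by (simp only: k_def)
      then have "k w = z" using b by (simp add: prod_eq_iff)
      then show "z \<in> k ` V'" using z w by (auto simp: V'_def Q_def)
    qed
  qed
  have VU: "V' \<subseteq> U" "V' \<subseteq> V" by (auto simp: V'_def W_def)
  have gk: "g (?m (k w)) = w" if "w \<in> V'" for w
  proof -
    have "w \<in> U" using that VU(1) by blast
    then have "g (f w) = w" using D(6) by (simp add: homeomorphism_def)
    then show ?thesis using fk[OF that] by simp
  qed
  have "homeomorphism V' (k ` V') k (\<lambda>z. g (?m z))"
    unfolding homeomorphism_def
  proof (intro conjI ballI)
    show "continuous_on V' k" using ck VU(1) continuous_on_subset by blast
    show "(\<lambda>z. g (?m z)) ` k ` V' = V'" using gk by (auto simp: image_image)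
    show "continuous_on (k ` V') (\<lambda>z. g (?m z))"
    proof (rule continuous_on_compose2[of "f ` U" g])
      show "continuous_on (f ` U) g" using D(6) by (simp add: homeomorphism_def)
      show "?m ` k ` V' \<subseteq> f ` U"
      proof
        fix p assume "p \<in> ?m ` k ` V'"
        then obtain w where w: "w \<in> V'" "p = ?m (k w)" by blast
        then show "p \<in> f ` U" using fk[OF w(1)] VU(1) by (metis image_eqI subsetD)
      qed
    qed (intro continuous_intros)
  qed (use gk in auto)
  then show ?thesis using oV kV Qne oQ VU(2) by (intro exI[of _ V'] exI[of _ k] exI[of _ "\<lambda>z. g (?m z)"]) auto
qed

lemma flat_dense:
  fixes X :: "'a::euclidean_space set"
  assumes "simple_polyhedron X" "disjoint_union_of_circles (Sing X)" "x \<in> X" "openin (top_of_set X) V" "x \<in> V"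
  shows "\<exists>V' (k :: 'a \<Rightarrow> real \<times> real) k'. V' \<subseteq> V \<and> V' \<noteq> {} \<and> openin (top_of_set X) V' \<and> homeomorphism V' (k ` V') k k' \<and> open (k ` V')"
proof -
  have box: "{-1..1} \<times> {-1..1} = cbox (-1,-1) (1::real,1::real)" "{-1..1} \<times> {0..1} = cbox (-1,0) (1::real,1::real)"
    by (auto simp: cbox_Pair_eq box_real)
  have "triple_point X x \<or> boundary_triple_point X x \<or> surface_point X x \<or> boundary_surface_point X x"
    using assms no_true_vertex[OF assms(1-3)] unfolding simple_polyhedron_def by blast
  then consider "triple_point X x \<or> boundary_triple_point X x" | "surface_point X x" | "boundary_surface_point X x" by blast
  then show ?thesis
  proof cases
    case 1 then show ?thesis using book_chart_if_triple flat_dense_book[OF _ assms(4,5)] by metis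
  next
    case 2
    then show ?thesis unfolding surface_point_def
      by (rule flat_dense_planar[OF _ _ _ assms(4,5)]) (unfold box, auto simp: interior_cbox box_ne_empty Basis_prod_def)
  next
    case 3
    then show ?thesis unfolding boundary_surface_point_def
      by (rule flat_dense_planar[OF _ _ _ assms(4,5)]) (unfold box, auto simp: interior_cbox box_ne_empty Basis_prod_def)
  qed
qed

section \<open>Links in the triangulation\<close>

lemma continuous_on_linear_diff:
  fixes F :: "'a::euclidean_space \<Rightarrow> 'b::real_normed_vector"
  assumes "linear F" shows "continuous_on S (\<lambda>x. F (x - a))"
  using linear_continuous_on_compose[of S "\<lambda>x. x - a" F] assms by (simp add: continuous_on_diff)

lemma triangle_coordinates:
  fixes a b c :: "'a::euclidean_space"
  assumes "\<not> affine_dependent {a,b,c}" "a \<noteq> b" "b \<noteq> c" "a \<noteq> c"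
  obtains F :: "'a \<Rightarrow> real \<times> real" where "linear F" "F (b - a) = (1,0)" "F (c - a) = (0,1)"
proof -
  have "{a,b,c} - {a} = {b,c}" using assms by auto
  then have "independent ((\<lambda>x. x - a) ` {b,c})"
    using assms(1) affine_dependent_iff_dependent2[of a "{a,b,c}"] by (simp add: image_image[symmetric])
  then have ind: "independent {b - a, c - a}" by simp
  obtain F :: "'a \<Rightarrow> real \<times> real" where F: "linear F" "\<forall>x\<in>{b - a, c - a}. F x = (if x = b - a then (1,0) else (0,1))"
    using linear_independent_extend[OF ind, of "\<lambda>x. if x = b - a then (1,0) else (0,1)"] by auto
  have "c - a \<noteq> b - a" using assms by simp
  then show thesis using that[OF F(1)] F(2) by auto
qed

lemma rel_interior_triangle:
  fixes a b c :: "'a::euclidean_space"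
  assumes "\<not> affine_dependent {a,b,c}" "a \<noteq> b" "b \<noteq> c" "a \<noteq> c" "0 < \<alpha>" "0 < \<beta>" "0 < \<gamma>" "\<alpha> + \<beta> + \<gamma> = 1"
  shows "\<alpha> *\<^sub>R a + \<beta> *\<^sub>R b + \<gamma> *\<^sub>R c \<in> rel_interior (convex hull {a,b,c})"
proof -
  let ?u = "\<lambda>x. if x = a then \<alpha> else if x = b then \<beta> else \<gamma>"
  have "(\<forall>x\<in>{a,b,c}. 0 < ?u x) \<and> sum ?u {a,b,c} = 1 \<and> (\<Sum>x\<in>{a,b,c}. ?u x *\<^sub>R x) = \<alpha> *\<^sub>R a + \<beta> *\<^sub>R b + \<gamma> *\<^sub>R c"
    using assms by (auto simp: add.assoc)
  then show ?thesis unfolding rel_interior_convex_hull_explicit[OF assms(1)] by (intro CollectI exI[of _ ?u])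
qed

lemma rel_interior_edge:
  fixes a b :: "'a::euclidean_space"
  assumes "a \<noteq> b" "0 < \<mu>" "\<mu> < 1"
  shows "a + \<mu> *\<^sub>R (b - a) \<in> rel_interior (convex hull {a,b})"
proof -
  have "a + \<mu> *\<^sub>R (b - a) \<in> open_segment a b"
    using assms by (auto simp: in_segment algebra_simps intro!: exI[of _ \<mu>])
  then show ?thesis using assms(1) by (simp add: segment_convex_hull[symmetric] rel_interior_closed_segment)
qed

text \<open>The local analysis of the triangulation uses \<open>X\<close> only through these two
  facts, so PL charts and true vertices do not appear again.\<close>

locale book_complex = scomplex +
  assumes dich: "x \<in> \<Union>K \<Longrightarrow> planar_at (\<Union>K) x \<or> (\<exists>U f g. book_chart (\<Union>K) x U f g)"
    and flat: "x \<in> \<Union>K \<Longrightarrow> openin (top_of_set (\<Union>K)) V \<Longrightarrow> x \<in> V \<Longrightarrow>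
      \<exists>V' (k :: 'a \<Rightarrow> real \<times> real) k'. V' \<subseteq> V \<and> V' \<noteq> {} \<and> openin (top_of_set (\<Union>K)) V' \<and>
        homeomorphism V' (k ` V') k k' \<and> open (k ` V')"
begin

definition fstar :: "'a set \<Rightarrow> 'a set" where "fstar \<sigma> = {x \<in> \<Union>K. \<forall>\<tau>\<in>K. x \<in> \<tau> \<longrightarrow> \<sigma> \<subseteq> \<tau>}"

lemma fstar_open: "openin (top_of_set (\<Union>K)) (fstar \<sigma>)"
proof -
  have "open (- \<Union>{\<tau>\<in>K. \<not> \<sigma> \<subseteq> \<tau>})" using fin_K closed_simplex by (intro open_Compl closed_Union) auto
  moreover have "fstar \<sigma> = \<Union>K \<inter> - \<Union>{\<tau>\<in>K. \<not> \<sigma> \<subseteq> \<tau>}" by (auto simp: fstar_def)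
  ultimately show ?thesis by (auto simp: openin_open)
qed

lemma rel_interior_in_fstar: "\<sigma> \<in> K \<Longrightarrow> x \<in> rel_interior \<sigma> \<Longrightarrow> x \<in> fstar \<sigma>"
  using rel_interior_subset_simplex rel_interior_subset[of \<sigma>] unfolding fstar_def by blast

text \<open>The open star of a maximal simplex lies in the simplex and contains a flat open subset
  of \<open>X\<close>. Invariance of dimension, applied to the flat chart and to its inverse,
  compares the simplex with the plane.\<close>

lemma maximal_aff_dim:
  assumes s: "\<sigma> \<in> K" "\<sigma> \<noteq> {}" and max: "\<And>\<tau>. \<tau> \<in> K \<Longrightarrow> \<sigma> \<subseteq> \<tau> \<Longrightarrow> \<tau> = \<sigma>"
  shows "aff_dim \<sigma> = 2"
proof -
  have conv: "convex \<sigma>" using closed_simplex s by blast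
  obtain x where x: "x \<in> rel_interior \<sigma>" using rel_interior_eq_empty[OF conv] s by blast
  have xf: "x \<in> fstar \<sigma>" by (rule rel_interior_in_fstar[OF s(1) x])
  then have "x \<in> \<Union>K" by (simp add: fstar_def)
  then obtain V' k k' where V': "V' \<subseteq> fstar \<sigma>" "V' \<noteq> {}" "openin (top_of_set (\<Union>K)) V'"
     "homeomorphism V' (k ` V') k k'" "open (k ` V' :: (real \<times> real) set)"
    using flat[OF _ fstar_open xf] by blast
  have V's: "V' \<subseteq> \<sigma>"
  proof
    fix y assume "y \<in> V'"
    then have y: "y \<in> fstar \<sigma>" using V' by blast
    then obtain \<tau> where "\<tau> \<in> K" "y \<in> \<tau>" "\<sigma> \<subseteq> \<tau>" by (auto simp: fstar_def)
    then show "y \<in> \<sigma>" using max by blast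
  qed
  have h: "continuous_on V' k" "inj_on k V'" "continuous_on (k ` V') k'" "inj_on k' (k ` V')" "k' ` k ` V' = V'"
    using V'(4) by (auto simp: homeomorphism_def intro: inj_on_inverseI)
  have "aff_dim (UNIV :: (real \<times> real) set) \<le> aff_dim (affine hull \<sigma>)"
  proof (rule Further_Topology.invariance_of_dimension_affine_sets[of UNIV "k ` V'" "affine hull \<sigma>" k'])
    show "openin (top_of_set UNIV) (k ` V')" using V'(5) by (simp add: open_openin[symmetric] subtopology_UNIV)
    show "k' \<in> k ` V' \<rightarrow> affine hull \<sigma>"
    proof
      fix z assume "z \<in> k ` V'"
      then have "k' z \<in> V'" using h(5) by blast
      then show "k' z \<in> affine hull \<sigma>" using V's hull_subset[of \<sigma> affine] by blast
    qed
    show "k ` V' \<noteq> {}" using V'(2) by simp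
  qed (fact h affine_UNIV affine_affine_hull)+
  then have ge: "2 \<le> aff_dim \<sigma>" by (simp add: aff_dim_UNIV)
  obtain W where W: "open W" "V' = \<Union>K \<inter> W" using V'(3) by (auto simp: openin_open)
  obtain y where "y \<in> V'" using V'(2) by blast
  then have "y \<in> closure (rel_interior \<sigma>)" "y \<in> W"
    using V's W convex_closure_rel_interior[OF conv] closure_subset[of \<sigma>] by auto
  then have ne: "rel_interior \<sigma> \<inter> W \<noteq> {}" using W(1) by (metis IntI disjoint_iff open_Int_closure_eq_empty inf_commute)
  have sub: "rel_interior \<sigma> \<inter> W \<subseteq> V'" using W s(1) rel_interior_subset[of \<sigma>] by blast
  have "openin (top_of_set (affine hull \<sigma>)) (rel_interior \<sigma> \<inter> W)"
    using openin_rel_interior[of \<sigma>] W(1) by (metis openin_Int_open)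
  then have "aff_dim (affine hull \<sigma>) \<le> aff_dim (UNIV :: (real \<times> real) set)"
  proof (rule Further_Topology.invariance_of_dimension_affine_sets[of _ _ _ k])
    show "continuous_on (rel_interior \<sigma> \<inter> W) k" by (rule continuous_on_subset[OF h(1) sub])
    show "inj_on k (rel_interior \<sigma> \<inter> W)" by (rule inj_on_subset[OF h(2) sub])
  qed (simp_all add: ne)
  then show ?thesis using ge by (simp add: aff_dim_UNIV)
qed

lemma maximal_exists:
  assumes "\<sigma> \<in> K"
  shows "\<exists>\<tau>\<in>K. \<sigma> \<subseteq> \<tau> \<and> (\<forall>\<rho>\<in>K. \<tau> \<subseteq> \<rho> \<longrightarrow> \<tau> = \<rho>)"
  using finite_has_maximal2[OF fin_K assms] by auto

lemma card_vs_le: "\<sigma> \<in> K \<Longrightarrow> card (vs \<sigma>) \<le> 3"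
proof -
  assume s: "\<sigma> \<in> K"
  show ?thesis
  proof (cases "\<sigma> = {}")
    case True then show ?thesis by (simp add: vs_def)
  next
    case False
    obtain \<tau> where t: "\<tau> \<in> K" "\<sigma> \<subseteq> \<tau>" "\<forall>\<rho>\<in>K. \<tau> \<subseteq> \<rho> \<longrightarrow> \<tau> = \<rho>" using maximal_exists[OF s] by blast
    then have "aff_dim \<tau> = 2" using False by (intro maximal_aff_dim) auto
    then have "card (vs \<tau>) = 3" using aff_dim_vs[OF t(1)] by simp
    then show ?thesis using card_mono[OF finite_vs[OF t(1)] vs_mono[OF t(2)]] by simp
  qed
qed

lemma TT_nonempty:
  assumes "\<Union>K \<noteq> {}" shows "TT \<noteq> {}"
proof -
  obtain \<sigma> where s: "\<sigma> \<in> K" "\<sigma> \<noteq> {}" using assms by blast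
  obtain \<tau> where t: "\<tau> \<in> K" "\<sigma> \<subseteq> \<tau>" "\<forall>\<rho>\<in>K. \<tau> \<subseteq> \<rho> \<longrightarrow> \<tau> = \<rho>" using maximal_exists[OF s(1)] by blast
  then have "aff_dim \<tau> = 2" using s by (intro maximal_aff_dim) auto
  then have "card (vs \<tau>) = 3" using aff_dim_vs[OF t(1)] by simp
  then show ?thesis using t(1) by (auto simp: TT_def)
qed

lemma TTD:
  assumes "t \<in> TT"
  shows "convex hull t \<in> K" "vs (convex hull t) = t" "\<not> affine_dependent t" "card t = 3" "convex hull t \<subseteq> \<Union>K"
proof -
  show *: "convex hull t \<in> K" "vs (convex hull t) = t"
    using hull_vs_image[OF subset_refl, of t] assms by (auto simp: TT_def)
  then show "convex hull t \<subseteq> \<Union>K" by blast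
  show "\<not> affine_dependent t" using simplex_vs(1)[OF *(1)] *(2) by simp
  show "card t = 3" using assms by (simp add: TT_def)
qed

lemma EED:
  assumes "e \<in> EE"
  shows "convex hull e \<in> K" "vs (convex hull e) = e" "card e = 2"
  using hull_vs_image[OF subset_refl, of e] assms by (auto simp: EE_def)

lemma TT_maximal:
  assumes "t \<in> TT" "\<tau> \<in> K" "convex hull t \<subseteq> \<tau>" shows "\<tau> = convex hull t"
proof -
  have "t \<subseteq> vs \<tau>" using vs_mono[OF assms(3)] TTD(2)[OF assms(1)] by simp
  then have "t = vs \<tau>" using card_seteq[OF finite_vs[OF assms(2)]] card_vs_le[OF assms(2)] TTD(4)[OF assms(1)] by simp
  then show ?thesis using simplex_vs(2)[OF assms(2)] by simp
qed

lemma planar_at_triangle: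
  assumes t: "t \<in> TT" and x: "x \<in> rel_interior (convex hull t)"
  shows "planar_at (\<Union>K) x"
proof -
  have "t \<noteq> {}" using TTD(4)[OF t] by auto
  then obtain a where "a \<in> t" by blast
  obtain b c where abc: "t = {a,b,c}" "a \<noteq> b" "b \<noteq> c" "a \<noteq> c" by (rule triple_through[OF TTD(4)[OF t] \<open>a \<in> t\<close>])
  obtain F :: "'a \<Rightarrow> real \<times> real" where F: "linear F" "F (b - a) = (1,0)" "F (c - a) = (0,1)"
    using triangle_coordinates[of a b c] TTD(3)[OF t] abc by metis
  have Fx: "F (a + u *\<^sub>R (b - a) + v *\<^sub>R (c - a) - a) = (u,v)" for u v
    using F by (simp add: linear_add linear_scale)
  let ?V = "fstar (convex hull t)"
  have V: "?V \<subseteq> convex hull t" using TT_maximal[OF t] unfolding fstar_def by blast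
  show ?thesis
  proof (rule planar_atI[OF fstar_open rel_interior_in_fstar[OF TTD(1)[OF t] x]])
    show "continuous_on ?V (\<lambda>x. F (x - a))"
      by (rule continuous_on_linear_diff[OF F(1)])
    show "inj_on (\<lambda>x. F (x - a)) ?V"
    proof (rule inj_onI)
      fix y z assume "y \<in> ?V" "z \<in> ?V" and eq: "F (y - a) = F (z - a)"
      then have yz: "y \<in> convex hull {a,b,c}" "z \<in> convex hull {a,b,c}" using V abc(1) by auto
      then obtain u v u' v' where "y = a + u *\<^sub>R (b - a) + v *\<^sub>R (c - a)" "z = a + u' *\<^sub>R (b - a) + v' *\<^sub>R (c - a)"
        unfolding convex_hull_3_alt by blast
      then show "y = z" using eq Fx by simp
    qed
  qed
qed

lemma tri_at_apex:
  assumes "t \<in> tri_at TT {a,b}" "a \<noteq> b"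
  obtains c where "t = {a,b,c}" "b \<noteq> c" "a \<noteq> c" "the_elem (t - {a,b}) = c"
proof -
  have t: "t \<in> TT" "{a,b} \<subseteq> t" using assms(1) by (auto simp: tri_at_def)
  have "a \<in> t" using t by blast
  obtain x y where xy: "t = {a,x,y}" "a \<noteq> x" "x \<noteq> y" "a \<noteq> y" by (rule triple_through[OF TTD(4)[OF t(1)] \<open>a \<in> t\<close>])
  then obtain c where c: "t = {a,b,c}" "b \<noteq> c" "a \<noteq> c" using t(2) assms(2) by auto
  moreover have "t - {a,b} = {c}" using c by auto
  ultimately show thesis using that by simp
qed

lemma triangles_at_edge_meet:
  assumes "t \<in> tri_at TT e" "t' \<in> tri_at TT e" "t \<noteq> t'" "e \<in> EE"
  shows "convex hull t \<inter> convex hull t' = convex hull e"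
proof -
  have t: "t \<in> TT" "t' \<in> TT" "e \<subseteq> t" "e \<subseteq> t'" using assms by (auto simp: tri_at_def)
  have K: "convex hull t \<inter> convex hull t' \<in> K" using Int_in TTD(1) t by blast
  have "vs (convex hull t \<inter> convex hull t') = t \<inter> t'" using vs_Int TTD(2) t by simp
  moreover have "t \<inter> t' = e"
  proof -
    have fin: "finite t" "finite t'" using TTD(4) t by (metis card.infinite zero_neq_numeral)+
    have "t \<inter> t' \<noteq> t"
    proof
      assume "t \<inter> t' = t"
      then have "t \<subseteq> t'" by blast
      then have "t = t'" by (rule card_seteq[OF fin(2)]) (simp add: TTD(4) t)
      then show False using assms(3) by simp
    qed
    then have "t \<inter> t' \<subset> t" by blast
    then have "card (t \<inter> t') < 3" using psubset_card_mono[OF fin(1)] TTD(4)[OF t(1)] by metis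
    then show ?thesis using card_seteq[of "t \<inter> t'" e] fin(1) t(3,4) EED(3)[OF assms(4)] by auto
  qed
  ultimately show ?thesis using simplex_vs(2)[OF K] by simp
qed

text \<open>The page of the triangle \<open>t\<close> at the point \<open>y\<close> of an edge:
  \<open>s\<close> runs along the edge and \<open>u\<close> towards the apex, the only element of
  \<open>t - {a,b}\<close>.\<close>

definition epage :: "'a \<Rightarrow> 'a \<Rightarrow> 'a \<Rightarrow> 'a set \<Rightarrow> real \<times> real \<Rightarrow> 'a" where
  "epage a b y t = (\<lambda>(s,u). y + s *\<^sub>R (b - a) + u *\<^sub>R (the_elem (t - {a,b}) - y))"

text \<open>Different triangles at an edge meet only in that edge, so the half-discs around one of
  its inner points form a book with its axis on the edge.\<close>

lemma epage_props:
  assumes ab: "a \<noteq> b" "{a,b} \<in> EE" and l: "0 < \<mu>" "\<mu> < 1" and y: "y = a + \<mu> *\<^sub>R (b - a)"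
  obtains \<epsilon> where "pages (tri_at TT {a,b}) \<epsilon> (epage a b y)"
    "\<And>t. t \<in> tri_at TT {a,b} \<Longrightarrow> epage a b y t ` half_disc \<epsilon> \<subseteq> convex hull t"
    "\<And>t s u. t \<in> tri_at TT {a,b} \<Longrightarrow> (s,u) \<in> half_disc \<epsilon> \<Longrightarrow> 0 < u \<Longrightarrow> epage a b y t (s,u) \<in> rel_interior (convex hull t)"
    "\<And>t s. (s,0) \<in> half_disc \<epsilon> \<Longrightarrow> epage a b y t (s,0) \<in> rel_interior (convex hull {a,b})"
proof -
  \<comment> \<open>This keeps the weights of \<open>a\<close> and \<open>b\<close> positive:
    \<open>u < 1/2\<close> leaves more than half of \<open>1 - \<mu>\<close> and of
    \<open>\<mu>\<close>, and \<open>s\<close> is in absolute value smaller than either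
    half.\<close>
  define \<epsilon> where "\<epsilon> = min \<mu> (1 - \<mu>) / 2"
  have e: "0 < \<epsilon>" "2 * \<epsilon> \<le> \<mu>" "2 * \<epsilon> \<le> 1 - \<mu>" using l by (auto simp: \<epsilon>_def)
  have pos: "0 < (1 - \<mu>) * (1 - u) - s" "0 < \<mu> * (1 - u) + s" "u < 1" if "(s,u) \<in> half_disc \<epsilon>" for s u
  proof -
    have su: "\<bar>s\<bar> < \<epsilon>" "0 \<le> u" "u < \<epsilon>" using that by (auto simp: half_disc_def)
    then show "u < 1" using e l by linarith
    have "u < 1/2" using su e l by linarith
    then have m: "(1 - \<mu>) * (1/2) \<le> (1 - \<mu>) * (1 - u)" "\<mu> * (1/2) \<le> \<mu> * (1 - u)" using l by (intro mult_left_mono; simp)+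
    have "s < (1 - \<mu>) * (1/2)" "- s < \<mu> * (1/2)" using su e by (simp_all add: field_simps)
    then show "0 < (1 - \<mu>) * (1 - u) - s" "0 < \<mu> * (1 - u) + s"
      using less_le_trans[OF _ m(1), of s] less_le_trans[OF _ m(2), of "- s"] by simp_all
  qed
  have form: "epage a b y t (s,u) = ((1 - \<mu>) * (1 - u) - s) *\<^sub>R a + (\<mu> * (1 - u) + s) *\<^sub>R b + u *\<^sub>R c"
    if "the_elem (t - {a,b}) = c" for t s u c
    unfolding epage_def that y by (simp add: algebra_simps)
  have form2: "epage a b y t (s,u) = a + (\<mu> * (1 - u) + s) *\<^sub>R (b - a) + u *\<^sub>R (c - a)"
    if "the_elem (t - {a,b}) = c" for t s u c
    unfolding epage_def that y by (simp add: algebra_simps)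
  have edge: "epage a b y t (s,0) \<in> rel_interior (convex hull {a,b})" if "(s,0) \<in> half_disc \<epsilon>" for t s
  proof -
    have "epage a b y t (s,0) = a + (\<mu> + s) *\<^sub>R (b - a)" unfolding epage_def y by (simp add: algebra_simps)
    moreover have "0 < \<mu> + s" "\<mu> + s < 1" using pos[OF that] by simp_all
    ultimately show ?thesis using rel_interior_edge[OF ab(1)] by simp
  qed
  have inter: "epage a b y t (s,u) \<in> rel_interior (convex hull t)" if t: "t \<in> tri_at TT {a,b}" and su: "(s,u) \<in> half_disc \<epsilon>" "0 < u" for t s u
  proof -
    obtain c where c: "t = {a,b,c}" "b \<noteq> c" "a \<noteq> c" "the_elem (t - {a,b}) = c" by (rule tri_at_apex[OF t ab(1)])
    have "\<not> affine_dependent {a,b,c}" using TTD(3)[of t] t c(1) by (auto simp: tri_at_def)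
    from rel_interior_triangle[OF this ab(1) c(2,3) pos(1,2)[OF su(1)] su(2)]
    have "epage a b y t (s,u) \<in> rel_interior (convex hull {a,b,c})" unfolding form[OF c(4)] by (simp add: algebra_simps)
    then show ?thesis unfolding c(1)[symmetric] .
  qed
  have hull: "epage a b y t ` half_disc \<epsilon> \<subseteq> convex hull t" if t: "t \<in> tri_at TT {a,b}" for t
  proof clarify
    fix s u assume su: "(s,u) \<in> half_disc \<epsilon>"
    show "epage a b y t (s,u) \<in> convex hull t"
    proof (cases "u = 0")
      case True
      have "convex hull {a,b} \<subseteq> convex hull t" using t by (intro hull_mono) (auto simp: tri_at_def)
      then show ?thesis using edge[of s t] su True rel_interior_subset[of "convex hull {a,b}"] by blast
    next
      case False
      then have "0 < u" using su by (simp add: half_disc_def)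
      then show ?thesis using inter[OF t su] rel_interior_subset[of "convex hull t"] by blast
    qed
  qed
  have u0: "u = 0" if t: "t \<in> tri_at TT {a,b}" and su: "(s,u) \<in> half_disc \<epsilon>" and h: "epage a b y t (s,u) \<in> convex hull {a,b}" for t s u
  proof (rule ccontr)
    assume "u \<noteq> 0"
    then have "0 < u" using su by (simp add: half_disc_def)
    have tT: "t \<in> TT" using t by (simp add: tri_at_def)
    have "convex hull t \<subseteq> convex hull {a,b}"
      by (rule rel_interior_subset_simplex[OF TTD(1)[OF tT] EED(1)[OF ab(2)] inter[OF t su \<open>0 < u\<close>] h])
    then have "convex hull {a,b} = convex hull t" by (rule TT_maximal[OF tT EED(1)[OF ab(2)]])
    then have "t = {a,b}" using TTD(2)[OF tT] EED(2)[OF ab(2)] by simp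
    then show False using TTD(4)[OF tT] EED(3)[OF ab(2)] by simp
  qed
  have "pages (tri_at TT {a,b}) \<epsilon> (epage a b y)"
  proof (rule pagesI)
    show "continuous_on (half_disc \<epsilon>) (epage a b y t)" for t
      unfolding epage_def case_prod_unfold by (intro continuous_intros)
    show "epage a b y t (s,0) = epage a b y t' (s,0)" for t t' s by (simp add: epage_def)
    fix t t' z w assume *: "t \<in> tri_at TT {a,b}" "t' \<in> tri_at TT {a,b}" "z \<in> half_disc \<epsilon>" "w \<in> half_disc \<epsilon>"
      "epage a b y t z = epage a b y t' w"
    obtain s u where z: "z = (s,u)" by fastforce
    obtain s' u' where w: "w = (s',u')" by fastforce
    show "z = w \<and> (t = t' \<or> snd z = 0)"
    proof (cases "t = t'")
      case True
      obtain c where c: "t = {a,b,c}" "b \<noteq> c" "a \<noteq> c" "the_elem (t - {a,b}) = c" by (rule tri_at_apex[OF *(1) ab(1)])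
      have "\<not> affine_dependent {a,b,c}" using TTD(3)[of t] *(1) c(1) by (auto simp: tri_at_def)
      then obtain F :: "'a \<Rightarrow> real \<times> real" where F: "linear F" "F (b - a) = (1,0)" "F (c - a) = (0,1)"
        using triangle_coordinates[of a b c] ab(1) c by metis
      have "F (p *\<^sub>R (b - a) + q *\<^sub>R (c - a)) = (p,q)" for p q using F by (simp add: linear_add linear_scale)
      moreover have "(\<mu> * (1 - u) + s) *\<^sub>R (b - a) + u *\<^sub>R (c - a) = (\<mu> * (1 - u') + s') *\<^sub>R (b - a) + u' *\<^sub>R (c - a)"
        using *(5) unfolding z w True[symmetric] form2[OF c(4)] by (simp add: add.assoc)
      ultimately have "(\<mu> * (1 - u) + s, u) = (\<mu> * (1 - u') + s', u')" by metis
      then have "u = u'" "\<mu> * (1 - u) + s = \<mu> * (1 - u') + s'" by blast+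
      then have "u = u'" "s = s'" by simp_all
      then show ?thesis using True z w by simp
    next
      case False
      have "epage a b y t z \<in> convex hull t" "epage a b y t z \<in> convex hull t'"
        using hull[OF *(1)] hull[OF *(2)] *(3-5) by (auto simp del: Union_iff)
      then have h: "epage a b y t z \<in> convex hull {a,b}"
        using triangles_at_edge_meet[OF *(1,2) False ab(2)] by blast
      have "u = 0" using u0[OF *(1), of s u] *(3) h by (simp add: z)
      moreover have "u' = 0" using u0[OF *(2), of s' u'] *(4,5) h by (simp add: w)
      moreover have "s = s'" using *(5) ab(1) calculation by (simp add: z w epage_def)
      ultimately show ?thesis by (simp add: z w)
    qed
  qed (rule e)
  then show thesis using hull inter edge by (rule that)
qed

lemma epage_center: "epage a b y t (0,0) = y" by (simp add: epage_def)

lemma finite_TT: "finite TT" using fin_K by (simp add: TT_def)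

lemma three_of: "3 \<le> card A \<Longrightarrow> \<exists>i j k. i \<in> A \<and> j \<in> A \<and> k \<in> A \<and> i \<noteq> j \<and> j \<noteq> k \<and> i \<noteq> k"
proof -
  assume "3 \<le> card A"
  then obtain B where "B \<subseteq> A" "card B = 3" by (metis obtain_subset_with_card_n)
  then show ?thesis unfolding card_3_iff by blast
qed

lemma edge_sub: "\<lbrakk>a \<noteq> b; {a,b} \<in> EE; 0 < \<mu>; \<mu> < 1\<rbrakk> \<Longrightarrow> a + \<mu> *\<^sub>R (b - a) \<in> \<Union>K"
  using rel_interior_edge[of a b \<mu>] rel_interior_subset[of "convex hull {a,b}"] EED(1)[of "{a,b}"] by blast

lemma not_planar_at_edge:
  assumes ab: "a \<noteq> b" "{a,b} \<in> EE" and l: "0 < \<mu>" "\<mu> < 1" and d: "3 \<le> card (tri_at TT {a,b})"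
  shows "\<not> planar_at (\<Union>K) (a + \<mu> *\<^sub>R (b - a))"
proof -
  let ?y = "a + \<mu> *\<^sub>R (b - a)"
  obtain \<epsilon> where e: "pages (tri_at TT {a,b}) \<epsilon> (epage a b ?y)"
    "\<And>t. t \<in> tri_at TT {a,b} \<Longrightarrow> epage a b ?y t ` half_disc \<epsilon> \<subseteq> convex hull t"
    using epage_props[OF ab l refl] by metis
  obtain i j k where ijk: "i \<in> tri_at TT {a,b}" "j \<in> tri_at TT {a,b}" "k \<in> tri_at TT {a,b}" "i \<noteq> j" "j \<noteq> k" "i \<noteq> k"
    using three_of[OF d] by metis
  have "\<not> planar_at (\<Union>K) (epage a b ?y i (0,0))"
  proof (rule not_planar_at_pages[OF e(1) ijk])
    show "epage a b ?y t ` half_disc \<epsilon> \<subseteq> \<Union>K" if "t \<in> tri_at TT {a,b}" for t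
      using e(2)[OF that] TTD(5)[of t] that by (auto simp: tri_at_def)
  qed
  then show ?thesis unfolding epage_center .
qed

lemma rel_interior_edge_obtain:
  fixes a b :: 'a
  assumes "a \<noteq> b" "z \<in> rel_interior (convex hull {a,b})"
  obtains \<mu> where "0 < \<mu>" "\<mu> < 1" "z = a + \<mu> *\<^sub>R (b - a)"
proof -
  have "rel_interior (closed_segment a b) = (if a = b then {a} else open_segment a b)" by (rule rel_interior_closed_segment)
  then have "rel_interior (closed_segment a b) = open_segment a b" using assms(1) by (simp only: if_False)
  then have "z \<in> open_segment a b" using assms(2) by (simp only: segment_convex_hull)
  then obtain u where "0 < u" "u < 1" "z = (1 - u) *\<^sub>R a + u *\<^sub>R b" by (auto simp: in_segment)
  then show thesis using that[of u] by (simp add: algebra_simps)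
qed

text \<open>Otherwise the half-discs of two triangles around a point of the edge would embed in a
  half-plane, with their common diameter on its boundary line.\<close>

lemma same_page_False:
  assumes ch: "book_chart (\<Union>K) x U f g" and ab: "a \<noteq> b" "{a,b} \<in> EE" and l: "0 < \<mu>" "\<mu> < 1"
    and y: "y = a + \<mu> *\<^sub>R (b - a)" "y \<in> U"
    and d: "3 \<le> card (tri_at TT {a,b})" and t: "t \<in> tri_at TT {a,b}" "t' \<in> tri_at TT {a,b}" "t \<noteq> t'"
    and \<delta>: "0 < \<delta>" and i0: "i0 \<in> Basis"
    and pg: "\<And>w. w \<in> rel_interior (convex hull t) \<union> rel_interior (convex hull t') \<Longrightarrow> dist y w < \<delta> \<Longrightarrow> w \<in> U \<and> 0 < fst (f w) \<bullet> i0"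
  shows False
proof -
  note D = book_chartD[OF ch]
  obtain \<epsilon> where e: "pages (tri_at TT {a,b}) \<epsilon> (epage a b y)"
    "\<And>t. t \<in> tri_at TT {a,b} \<Longrightarrow> epage a b y t ` half_disc \<epsilon> \<subseteq> convex hull t"
    "\<And>t s u. t \<in> tri_at TT {a,b} \<Longrightarrow> (s,u) \<in> half_disc \<epsilon> \<Longrightarrow> 0 < u \<Longrightarrow> epage a b y t (s,u) \<in> rel_interior (convex hull t)"
    "\<And>t s. (s,0) \<in> half_disc \<epsilon> \<Longrightarrow> epage a b y t (s,0) \<in> rel_interior (convex hull {a,b})"
    using epage_props[OF ab l y(1)] by metis
  have p: "pages {t,t'} \<epsilon> (epage a b y)" by (rule pages_subset[OF e(1)]) (use t in auto)
  let ?V = "U \<inter> ball y \<delta>"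
  have V: "openin (top_of_set (\<Union>K)) ?V" using D(1) by (simp add: openin_Int_open)
  have inK: "epage a b y s ` half_disc \<epsilon> \<subseteq> \<Union>K" if "s \<in> {t,t'}" for s
    using e(2)[of s] TTD(5)[of s] that t by (auto simp: tri_at_def)
  have cV: "epage a b y s (0,0) \<in> ?V" for s unfolding epage_center using y(2) \<delta> by simp
  obtain \<eta> where eta: "0 < \<eta>" "\<eta> \<le> \<epsilon>" "\<And>s. s \<in> {t,t'} \<Longrightarrow> epage a b y s ` half_disc \<eta> \<subseteq> ?V"
    using pages_into_open[OF p _ _ V inK cV] by auto
  \<comment> \<open>The page \<open>i0\<close> in the chart, together with the axis.\<close>
  define D0 where "D0 = {w\<in>U. fst (f w) = (fst (f w) \<bullet> i0) *\<^sub>R i0}"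
  have onpage: "w \<in> D0" if w: "w \<in> U" "fst (f w) = 0 \<or> 0 < fst (f w) \<bullet> i0" for w
  proof (cases "fst (f w) = 0")
    case False
    obtain b' u' where b': "b' \<in> Basis" "0 \<le> u'" "fst (f w) = u' *\<^sub>R b'" using D(7)[OF w(1)] Y_graph_iff by blast
    have "b' = i0" using w(2) False b' i0 by (auto simp: inner_Basis split: if_splits)
    then show ?thesis using b' w(1) i0 by (simp add: D0_def)
  qed (use w in \<open>simp add: D0_def\<close>)
  have qD: "epage a b y s ` half_disc \<eta> \<subseteq> D0" if s: "s \<in> {t,t'}" for s
  proof clarify
    fix r u assume ru: "(r,u) \<in> half_disc \<eta>"
    let ?w = "epage a b y s (r,u)"
    have wV: "?w \<in> U" "dist y ?w < \<delta>" using eta(3)[OF s] ru by auto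
    have ru': "(r,u) \<in> half_disc \<epsilon>" using ru half_disc_mono[OF eta(2)] by blast
    have st: "s \<in> tri_at TT {a,b}" using s t by auto
    show "?w \<in> D0"
    proof (cases "u = 0")
      case True
      \<comment> \<open>Inner points of the edge are not planar, so they lie on the axis.\<close>
      have "?w \<in> rel_interior (convex hull {a,b})" using e(4)[of r s] ru' True by simp
      then obtain \<mu>' where "0 < \<mu>'" "\<mu>' < 1" "?w = a + \<mu>' *\<^sub>R (b - a)" by (rule rel_interior_edge_obtain[OF ab(1)])
      then have "\<not> planar_at (\<Union>K) ?w" using not_planar_at_edge[OF ab _ _ d] by simp
      then have "fst (f ?w) = 0" using planar_at_off_axis[OF ch wV(1)] by blast
      then show ?thesis using onpage wV(1) by simp
    next
      case False
      then have "0 < u" using ru by (simp add: half_disc_def)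
      then have "?w \<in> rel_interior (convex hull s)" by (rule e(3)[OF st ru'])
      then have "0 < fst (f ?w) \<bullet> i0" using pg[OF _ wV(2)] s by blast
      then show ?thesis using onpage wV(1) by simp
    qed
  qed
  let ?k = "\<lambda>w. (snd (f w), fst (f w) \<bullet> i0)"
  have ck: "continuous_on D0 ?k"
    using D(4) by (intro continuous_intros continuous_on_subset[OF D(4)]) (auto simp: D0_def)
  have ik: "inj_on ?k D0"
  proof (rule inj_onI)
    fix w w' assume w: "w \<in> D0" "w' \<in> D0" "?k w = ?k w'"
    have fw: "fst (f w) = (fst (f w) \<bullet> i0) *\<^sub>R i0" "fst (f w') = (fst (f w') \<bullet> i0) *\<^sub>R i0"
      using w(1,2) unfolding D0_def by blast+
    have eq: "snd (f w) = snd (f w')" "fst (f w) \<bullet> i0 = fst (f w') \<bullet> i0" using w(3) by (simp_all only: prod.inject)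
    have "fst (f w) = fst (f w')" using fw(1) unfolding eq(2) fw(2)[symmetric] .
    then have "f w = f w'" using eq(1) by (rule prod_eqI)
    moreover have "w \<in> U" "w' \<in> U" using w(1,2) unfolding D0_def by blast+
    ultimately show "w = w'" by (rule inj_onD[OF D(5)])
  qed
  have "pages {t,t'} \<eta> (\<lambda>s z. ?k (epage a b y s z))"
    by (rule pages_compose[OF pages_shrink[OF p eta(1,2)] ck ik qD])
  then show False
  proof (rule no_two_pages_in_half_plane[of _ _ _ t t'])
    show "0 \<le> snd (?k (epage a b y s z))" if "s \<in> {t,t'}" "z \<in> half_disc \<eta>" for s z
    proof -
      have "epage a b y s z \<in> U" using qD that unfolding D0_def by blast
      then obtain b' u' where "b' \<in> Basis" "0 \<le> u'" "fst (f (epage a b y s z)) = u' *\<^sub>R b'" using D(7) Y_graph_iff by blast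
      then show ?thesis using i0 by (simp add: inner_Basis)
    qed
    have "fst (f y) = 0" using planar_at_off_axis[OF ch y(2)] not_planar_at_edge[OF ab l d] y(1) by blast
    then show "snd (?k (epage a b y t (0,0))) = 0" unfolding epage_center by simp
  qed (use t in auto)
qed

end

section \<open>Triangles around a point and the pages of its chart\<close>

context book_complex begin

text \<open>Off the axis the chart falls into disjoint open pages, and a connected set cannot meet
  two of them.\<close>

lemma page_of_connected:
  assumes ch: "book_chart (\<Union>K) x U f g" and S: "connected S" "S \<subseteq> U" "S \<noteq> {}"
    and off: "\<And>w. w \<in> S \<Longrightarrow> fst (f w) \<noteq> 0"
  obtains b where "b \<in> Basis" "\<And>w. w \<in> S \<Longrightarrow> 0 < fst (f w) \<bullet> b"
proof -
  note D = book_chartD[OF ch]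
  have pg: "\<exists>b\<in>Basis. 0 < fst (f w) \<bullet> b \<and> (\<forall>b'\<in>Basis. b' \<noteq> b \<longrightarrow> fst (f w) \<bullet> b' = 0)" if w: "w \<in> S" for w
  proof -
    obtain b u where b: "b \<in> Basis" "0 \<le> u" "fst (f w) = u *\<^sub>R b" using D(7)[OF subsetD[OF S(2) w]] Y_graph_iff by blast
    then have "0 < u" using off[OF w] by (cases "u = 0") auto
    then show ?thesis using b by (intro bexI[of _ b]) (auto simp: inner_Basis)
  qed
  obtain w0 where w0: "w0 \<in> S" using S(3) by blast
  obtain b where b: "b \<in> Basis" "0 < fst (f w0) \<bullet> b" using pg[OF w0] by blast
  have c: "continuous_on S (\<lambda>w. fst (f w) \<bullet> b')" for b'
    using continuous_on_subset[OF D(4) S(2)] by (intro continuous_intros)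
  have o: "openin (top_of_set S) (S \<inter> (\<lambda>w. fst (f w) \<bullet> b') -` {0<..})" for b'
    by (rule continuous_openin_preimage_gen[OF c open_greaterThan])
  let ?A = "S \<inter> (\<lambda>w. fst (f w) \<bullet> b) -` {0<..}"
  let ?B = "\<Union>b'\<in>Basis - {b}. S \<inter> (\<lambda>w. fst (f w) \<bullet> b') -` {0<..}"
  have oB: "openin (top_of_set S) ?B" using o by (intro openin_Union) auto
  have cov: "S \<subseteq> ?A \<union> ?B"
  proof
    fix w assume w: "w \<in> S"
    obtain b' where "b' \<in> Basis" "0 < fst (f w) \<bullet> b'" using pg[OF w] by blast
    then show "w \<in> ?A \<union> ?B" using w by (cases "b' = b") auto
  qed
  have dis: "?A \<inter> ?B = {}"
  proof (rule ccontr)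
    assume "?A \<inter> ?B \<noteq> {}"
    then obtain w b' where w: "w \<in> S" "0 < fst (f w) \<bullet> b" "b' \<in> Basis" "b' \<noteq> b" "0 < fst (f w) \<bullet> b'" by auto
    obtain c where c: "\<forall>b'\<in>Basis. b' \<noteq> c \<longrightarrow> fst (f w) \<bullet> b' = 0" using pg[OF w(1)] by blast
    have "b = c" "b' = c" using c b(1) w by force+
    then show False using w(4) by simp
  qed
  have A: "?A \<noteq> {}" using w0 b(2) by auto
  have "?B = {}"
  proof (rule ccontr)
    assume "?B \<noteq> {}"
    then have "\<not> connected S"
      unfolding connected_openin not_not using o[of b] oB cov dis A by (intro exI[of _ ?A] exI[of _ ?B] conjI)
    then show False using S(1) by simp
  qed
  then have "0 < fst (f w) \<bullet> b" if "w \<in> S" for w using subsetD[OF cov that] \<open>?B = {}\<close> by auto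
  then show thesis by (rule that[OF b(1)])
qed

lemma ball_in_chart:
  assumes "book_chart (\<Union>K) x U f g" "y \<in> U"
  obtains \<delta> where "0 < \<delta>" "\<And>w. w \<in> \<Union>K \<Longrightarrow> dist y w < \<delta> \<Longrightarrow> w \<in> U"
proof -
  obtain W where W: "open W" "U = \<Union>K \<inter> W" using book_chartD(1)[OF assms(1)] unfolding openin_open by blast
  have "y \<in> W" using W(2) assms(2) by blast
  then obtain r where r: "r > 0" "ball y r \<subseteq> W" using W(1) open_contains_ball by blast
  show thesis
  proof (rule that[OF r(1)])
    fix w assume w: "w \<in> \<Union>K" "dist y w < r"
    then have "w \<in> W" using r(2) by (intro subsetD[OF r(2)]) simp
    then show "w \<in> U" unfolding W(2) using w(1) by (rule IntI[rotated])
  qed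
qed

text \<open>Inner points of a triangle are planar, while axis points other than \<open>x\<close> are
  not. So the part of the open triangle near \<open>y\<close> misses the axis; being convex, it lies
  on one page.\<close>

lemma sector:
  assumes ch: "book_chart (\<Union>K) x U f g" and t: "t \<in> TT" and x: "x \<notin> rel_interior (convex hull t)"
    and y: "y \<in> convex hull t" and \<delta>: "0 < \<delta>" "\<And>w. w \<in> \<Union>K \<Longrightarrow> dist y w < \<delta> \<Longrightarrow> w \<in> U"
  shows "rel_interior (convex hull t) \<inter> ball y \<delta> \<noteq> {}"
    "\<exists>b\<in>Basis. \<forall>w\<in>rel_interior (convex hull t) \<inter> ball y \<delta>. w \<in> U \<and> 0 < fst (f w) \<bullet> b"
proof -
  let ?S = "rel_interior (convex hull t) \<inter> ball y \<delta>"
  have "y \<in> closure (rel_interior (convex hull t))"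
    using y convex_closure_rel_interior[of "convex hull t"] closure_subset[of "convex hull t"] by auto
  then obtain w where "w \<in> rel_interior (convex hull t)" "dist w y < \<delta>" using \<delta>(1) unfolding closure_approachable by blast
  then show ne: "?S \<noteq> {}" by (auto simp: dist_commute)
  have SU: "?S \<subseteq> U"
  proof
    fix w assume w: "w \<in> ?S"
    then have "w \<in> \<Union>K" using TTD(5)[OF t] rel_interior_subset[of "convex hull t"] by blast
    then show "w \<in> U" using w by (intro \<delta>(2)) auto
  qed
  have "convex ?S" by (intro convex_Int convex_rel_interior convex_ball convex_convex_hull)
  moreover have "fst (f w) \<noteq> 0" if w: "w \<in> ?S" for w
  proof
    assume "fst (f w) = 0"
    moreover have "w \<in> U" "w \<noteq> x" using w SU x by auto
    ultimately have "\<not> planar_at (\<Union>K) w" using not_planar_at_on_axis[OF ch] by blast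
    then show False using planar_at_triangle[OF t] w by blast
  qed
  ultimately obtain b where "b \<in> Basis" "\<And>w. w \<in> ?S \<Longrightarrow> 0 < fst (f w) \<bullet> b"
    using page_of_connected[OF ch convex_connected SU ne] by blast
  then show "\<exists>b\<in>Basis. \<forall>w\<in>?S. w \<in> U \<and> 0 < fst (f w) \<bullet> b" using SU by blast
qed

lemma edge_pair:
  assumes "e \<in> EE" "v \<in> e"
  obtains u where "e = {v,u}" "v \<noteq> u"
  using card_2_other[OF EED(3)[OF assms(1)] assms(2)] by metis

lemma edge_not_in_rel_interior:
  assumes t: "t \<in> TT" and e: "e \<in> EE" and z: "z \<in> convex hull e"
  shows "z \<notin> rel_interior (convex hull t)"
proof
  assume "z \<in> rel_interior (convex hull t)"
  then have "convex hull t \<subseteq> convex hull e"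
    by (rule rel_interior_subset_simplex[OF TTD(1)[OF t] EED(1)[OF e] _ z])
  then have "convex hull e = convex hull t" by (rule TT_maximal[OF t EED(1)[OF e]])
  then have "t = e" using TTD(2)[OF t] EED(2)[OF e] by simp
  then show False using TTD(4)[OF t] EED(3)[OF e] by simp
qed

text \<open>A chart at the midpoint of the edge has only three pages. Of four triangles two would
  share a page, against \<open>same_page_False\<close>.\<close>

lemma card_tri_at_le:
  assumes e: "e \<in> EE" shows "card (tri_at TT e) \<le> 3"
proof (rule ccontr)
  assume four: "\<not> card (tri_at TT e) \<le> 3"
  have "e \<noteq> {}" using EED(3)[OF e] by auto
  then obtain a where "a \<in> e" by blast
  then obtain b where ab: "e = {a,b}" "a \<noteq> b" by (rule edge_pair[OF e])
  define y where "y = a + (1/2) *\<^sub>R (b - a)"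
  have E: "{a,b} \<in> EE" using e ab by simp
  have d3: "3 \<le> card (tri_at TT {a,b})" using four ab by simp
  have yK: "y \<in> \<Union>K" unfolding y_def by (rule edge_sub[OF ab(2) E]) auto
  have np: "\<not> planar_at (\<Union>K) y" unfolding y_def by (rule not_planar_at_edge[OF ab(2) E _ _ d3]) auto
  obtain U f g where ch: "book_chart (\<Union>K) y U f g" using dich[OF yK] np by blast
  note D = book_chartD[OF ch]
  obtain \<delta> where d: "0 < \<delta>" "\<And>w. w \<in> \<Union>K \<Longrightarrow> dist y w < \<delta> \<Longrightarrow> w \<in> U" using ball_in_chart[OF ch D(2)] by blast
  have "y \<in> rel_interior (convex hull {a,b})" unfolding y_def by (rule rel_interior_edge[OF ab(2)]) auto
  then have ye: "y \<in> convex hull {a,b}" using rel_interior_subset by blast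
  have "\<exists>b0\<in>Basis. \<forall>w\<in>rel_interior (convex hull t) \<inter> ball y \<delta>. w \<in> U \<and> 0 < fst (f w) \<bullet> b0" if t: "t \<in> tri_at TT {a,b}" for t
  proof -
    have tT: "t \<in> TT" "{a,b} \<subseteq> t" using t by (auto simp: tri_at_def)
    show ?thesis
      by (rule sector(2)[OF ch tT(1) edge_not_in_rel_interior[OF tT(1) E ye] _ d])
         (use ye hull_mono[OF tT(2), of convex] in blast)
  qed
  then obtain P where P: "\<And>t. t \<in> tri_at TT {a,b} \<Longrightarrow> P t \<in> Basis"
    "\<And>t w. t \<in> tri_at TT {a,b} \<Longrightarrow> w \<in> rel_interior (convex hull t) \<inter> ball y \<delta> \<Longrightarrow> w \<in> U \<and> 0 < fst (f w) \<bullet> P t"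
    by metis
  have "\<not> inj_on P (tri_at TT {a,b})"
  proof
    assume "inj_on P (tri_at TT {a,b})"
    then have "card (tri_at TT {a,b}) \<le> card (Basis :: (real^3) set)" using P(1) by (intro card_inj_on_le) auto
    then show False using four ab by simp
  qed
  then obtain t t' where t: "t \<in> tri_at TT {a,b}" "t' \<in> tri_at TT {a,b}" "P t = P t'" "t \<noteq> t'" unfolding inj_on_def by blast
  show False
  proof (rule same_page_False[OF ch ab(2) E _ _ y_def D(2) d3 t(1,2,4) d(1) P(1)[OF t(1)]])
    show "w \<in> U \<and> 0 < fst (f w) \<bullet> P t" if "w \<in> rel_interior (convex hull t) \<union> rel_interior (convex hull t')" "dist y w < \<delta>" for w
      using that P(2)[OF t(1), of w] P(2)[OF t(2), of w] t(3) by auto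
  qed auto
qed

text \<open>Planarity holds on an open set, so it would pass from \<open>v\<close> to nearby points
  of the edge.\<close>

lemma not_planar_at_vertex:
  assumes e: "{v,u} \<in> EE" "v \<noteq> u" and d: "3 \<le> card (tri_at TT {v,u})"
  shows "\<not> planar_at (\<Union>K) v"
proof
  assume "planar_at (\<Union>K) v"
  then obtain V and f :: "'a \<Rightarrow> real \<times> real" where V: "openin (top_of_set (\<Union>K)) V" "v \<in> V" "continuous_on V f" "inj_on f V"
    by (rule planar_atE)
  obtain W where W: "open W" "V = \<Union>K \<inter> W" using V(1) by (auto simp: openin_open)
  obtain r where r: "r > 0" "ball v r \<subseteq> W" using W V(2) open_contains_ball by blast
  define \<mu> where "\<mu> = min (1/2) (r / (2 * norm (u - v)))"
  have n: "norm (u - v) > 0" using e(2) by simp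
  have l: "0 < \<mu>" "\<mu> < 1" using r(1) n by (auto simp: \<mu>_def)
  have "\<mu> * norm (u - v) \<le> (r / (2 * norm (u - v))) * norm (u - v)" by (intro mult_right_mono) (auto simp: \<mu>_def)
  also have "\<dots> < r" using n r(1) by simp
  finally have "v + \<mu> *\<^sub>R (u - v) \<in> ball v r" using l by (simp add: dist_norm)
  then have "v + \<mu> *\<^sub>R (u - v) \<in> V" using r(2) W(2) edge_sub[OF e(2,1) l] by blast
  then have "planar_at (\<Union>K) (v + \<mu> *\<^sub>R (u - v))" using planar_atI[OF V(1) _ V(3,4)] by blast
  then show False using not_planar_at_edge[OF e(2,1) l d] by blast
qed

lemma vertex_in_K: "e \<in> EE \<Longrightarrow> v \<in> e \<Longrightarrow> v \<in> \<Union>K"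
  using EED(1)[of e] hull_inc[of v e convex] by blast

lemma edges_meet:
  assumes "{v,u} \<in> EE" "{v,u'} \<in> EE" "v \<noteq> u" "v \<noteq> u'" "u \<noteq> u'"
  shows "convex hull {v,u} \<inter> convex hull {v,u'} = {v}"
proof -
  have K: "convex hull {v,u} \<inter> convex hull {v,u'} \<in> K" using Int_in EED(1) assms by blast
  have "{v,u} \<inter> {v,u'} = {v}" using assms(3-5) by auto
  then have "vs (convex hull {v,u} \<inter> convex hull {v,u'}) = {v}"
    unfolding vs_Int EED(2)[OF assms(1)] EED(2)[OF assms(2)] .
  then show ?thesis using simplex_vs(2)[OF K] by simp
qed

text \<open>Inner points of the triple edges at \<open>v\<close> are not planar, so they lie on the
  axis of the chart at \<open>v\<close>. Three such edges would put a triod into a line.\<close>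

lemma few_triple_edges:
  "card {e\<in>EE. v \<in> e \<and> card (tri_at TT e) = 3} \<le> 2"
proof (rule ccontr)
  let ?B = "{e\<in>EE. v \<in> e \<and> card (tri_at TT e) = 3}"
  assume "\<not> card ?B \<le> 2"
  then have "3 \<le> card ?B" by simp
  then obtain e1 e2 e3 where e123: "e1 \<in> ?B" "e2 \<in> ?B" "e3 \<in> ?B" "e1 \<noteq> e2" "e2 \<noteq> e3" "e1 \<noteq> e3"
    using three_of by meson
  define I where "I = {u. v \<noteq> u \<and> {v,u} \<in> ?B}"
  have other: "\<exists>u\<in>I. e = {v,u}" if e: "e \<in> ?B" for e
  proof -
    obtain u where u: "e = {v,u}" "v \<noteq> u" by (rule edge_pair[of e v]) (use e in auto)
    then have "u \<in> I" using e unfolding I_def by blast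
    then show ?thesis using u(1) by blast
  qed
  obtain i where i: "i \<in> I" "e1 = {v,i}" using other[OF e123(1)] by blast
  obtain j where j: "j \<in> I" "e2 = {v,j}" using other[OF e123(2)] by blast
  obtain k where k: "k \<in> I" "e3 = {v,k}" using other[OF e123(3)] by blast
  note ijk = i(1) j(1) k(1) i(2) j(2) k(2)
  have ne: "i \<noteq> j" "j \<noteq> k" "i \<noteq> k" using e123(4-6) unfolding i(2) j(2) k(2) by blast+
  have I: "v \<noteq> u" "{v,u} \<in> EE" "3 \<le> card (tri_at TT {v,u})" if "u \<in> I" for u using that by (auto simp: I_def)
  have "v \<in> \<Union>K" using vertex_in_K[OF I(2)[OF ijk(1)]] by simp
  then obtain U f g where ch: "book_chart (\<Union>K) v U f g"
    using dich not_planar_at_vertex[OF I(2)[OF ijk(1)] I(1)[OF ijk(1)] I(3)[OF ijk(1)]] by blast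
  note D = book_chartD[OF ch]
  obtain \<delta> where d: "0 < \<delta>" "\<And>w. w \<in> \<Union>K \<Longrightarrow> dist v w < \<delta> \<Longrightarrow> w \<in> U" using ball_in_chart[OF ch D(2)] by blast
  let ?J = "{i,j,k}"
  have JI: "?J \<subseteq> I" using ijk by simp
  define N where "N = norm (i - v) + norm (j - v) + norm (k - v)"
  have N: "norm (u - v) \<le> N" if "u \<in> ?J" for u using that by (auto simp: N_def)
  have "0 < norm (i - v)" using I(1)[OF ijk(1)] by simp
  then have N0: "0 < N" using norm_ge_zero[of "j - v"] norm_ge_zero[of "k - v"] unfolding N_def by linarith
  \<comment> \<open>Division by the total length \<open>N\<close> keeps all three legs in the ball
    of radius \<open>\<delta>\<close>.\<close>
  define \<eta> where "\<eta> = min 1 (\<delta> / N)"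
  have eta: "0 < \<eta>" "\<eta> \<le> 1" using d(1) N0 by (auto simp: \<eta>_def)
  let ?p = "\<lambda>u s. v + s *\<^sub>R (u - v)"
  have inhull: "?p u s \<in> convex hull {v,u}" if "s \<in> {0..<\<eta>}" for u s
  proof -
    have "?p u s \<in> closed_segment v u" using that eta(2) by (auto simp: in_segment algebra_simps intro!: exI[of _ s])
    then show ?thesis by (simp add: segment_convex_hull)
  qed
  have inU: "?p u s \<in> U" if u: "u \<in> ?J" and s: "s \<in> {0..<\<eta>}" for u s
  proof (rule d(2))
    show "?p u s \<in> \<Union>K" using inhull[OF s, of u] EED(1)[OF I(2)] JI u by blast
    have "s * norm (u - v) \<le> s * N" using N[OF u] s by (intro mult_left_mono) auto
    also have "\<dots> < \<delta>"
    proof -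
      have "s < \<delta> / N" using s by (simp add: \<eta>_def)
      then show ?thesis using N0 by (simp add: pos_less_divide_eq)
    qed
    finally show "dist v (?p u s) < \<delta>" using s by (simp add: dist_norm)
  qed
  have ax: "fst (f (?p u s)) = 0" if u: "u \<in> ?J" and s: "s \<in> {0..<\<eta>}" for u s
  proof (cases "s = 0")
    case False
    have uI: "u \<in> I" using u JI by blast
    have "\<not> planar_at (\<Union>K) (?p u s)"
      by (rule not_planar_at_edge[OF I(1)[OF uI] I(2)[OF uI] _ _ I(3)[OF uI]]) (use s False eta in auto)
    then show ?thesis using planar_at_off_axis[OF ch inU[OF u s]] by blast
  qed (simp add: D(3))
  show False
  proof (rule no_triod_in_line[OF eta(1), of i ?J j k "\<lambda>u s. snd (f (?p u s))"])
    fix u assume u: "u \<in> ?J"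
    have "continuous_on {0..<\<eta>} (\<lambda>s. f (?p u s))"
      by (rule continuous_on_compose2[OF D(4)]) (use inU[OF u] in \<open>auto intro!: continuous_intros\<close>)
    then show "continuous_on {0..<\<eta>} (\<lambda>s. snd (f (?p u s)))" by (rule continuous_on_snd)
  next
    fix u u' s s' assume *: "u \<in> ?J" "u' \<in> ?J" "s \<in> {0..<\<eta>}" "s' \<in> {0..<\<eta>}" "snd (f (?p u s)) = snd (f (?p u' s'))"
    have "f (?p u s) = f (?p u' s')" using *(5) ax[OF *(1,3)] ax[OF *(2,4)] by (simp add: prod_eq_iff)
    then have eq: "?p u s = ?p u' s'" by (rule inj_onD[OF D(5) _ inU[OF *(1,3)] inU[OF *(2,4)]])
    have uI: "u \<in> I" "u' \<in> I" using *(1,2) JI by blast+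
    show "s = s' \<and> (u = u' \<or> s = 0)"
    proof (cases "u = u'")
      case True
      then show ?thesis using eq I(1)[OF uI(1)] by simp
    next
      case False
      have "?p u s \<in> convex hull {v,u} \<inter> convex hull {v,u'}"
        using inhull[OF *(3), of u] inhull[OF *(4), of u'] eq by simp
      then have "?p u s = v"
        unfolding edges_meet[OF I(2)[OF uI(1)] I(2)[OF uI(2)] I(1)[OF uI(1)] I(1)[OF uI(2)] False] by simp
      then have "s = 0" "s' = 0" using eq I(1)[OF uI(1)] I(1)[OF uI(2)] by auto
      then show ?thesis by simp
    qed
  qed (use ne in auto)
qed

text \<open>Unfold the two triangles into the upper and the lower half-plane, matched along the
  edge. Near an inner point of the edge there is nothing else in the complex.\<close>

lemma planar_at_double_edge:
  assumes ab: "{a,b} \<in> EE" "a \<noteq> b" and d: "card (tri_at TT {a,b}) = 2" and y: "y \<in> rel_interior (convex hull {a,b})"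
  shows "planar_at (\<Union>K) y"
proof -
  obtain t1 t2 where t: "tri_at TT {a,b} = {t1,t2}" "t1 \<noteq> t2" using d by (auto simp: card_2_iff)
  have t1: "t1 \<in> tri_at TT {a,b}" and t2: "t2 \<in> tri_at TT {a,b}" using t by auto
  obtain c1 where c1: "t1 = {a,b,c1}" "b \<noteq> c1" "a \<noteq> c1" by (rule tri_at_apex[OF t1 ab(2)])
  obtain c2 where c2: "t2 = {a,b,c2}" "b \<noteq> c2" "a \<noteq> c2" by (rule tri_at_apex[OF t2 ab(2)])
  have T: "t1 \<in> TT" "t2 \<in> TT" using t1 t2 by (auto simp: tri_at_def)
  obtain F1 :: "'a \<Rightarrow> real \<times> real" where F1: "linear F1" "F1 (b - a) = (1,0)" "F1 (c1 - a) = (0,1)"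
    using triangle_coordinates[of a b c1] TTD(3)[OF T(1)] c1 ab by metis
  obtain F2 :: "'a \<Rightarrow> real \<times> real" where F2: "linear F2" "F2 (b - a) = (1,0)" "F2 (c2 - a) = (0,1)"
    using triangle_coordinates[of a b c2] TTD(3)[OF T(2)] c2 ab by metis
  let ?H1 = "convex hull t1" and ?H2 = "convex hull t2"
  define G where "G x = (if x \<in> ?H1 then F1 (x - a) else (fst (F2 (x - a)), - snd (F2 (x - a))))" for x
  have coord: "\<exists>u v. 0 \<le> v \<and> x = a + u *\<^sub>R (b - a) + v *\<^sub>R (c - a) \<and> F (x - a) = (u,v)"
    if x: "x \<in> convex hull {a,b,c}" and F: "linear F" "F (b - a) = (1,0)" "F (c - a) = (0,1)"
    for x c and F :: "'a \<Rightarrow> real \<times> real"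
  proof -
    have "\<exists>u v. x = a + u *\<^sub>R (b - a) + v *\<^sub>R (c - a) \<and> 0 \<le> u \<and> 0 \<le> v \<and> u + v \<le> 1"
      using x unfolding convex_hull_3_alt by (simp only: mem_Collect_eq)
    then obtain u v where uv: "0 \<le> v" "x = a + u *\<^sub>R (b - a) + v *\<^sub>R (c - a)" by (elim exE conjE)
    have "x - a = u *\<^sub>R (b - a) + v *\<^sub>R (c - a)" unfolding uv(2) by (simp add: add.assoc)
    then have "F (x - a) = (u,v)" using F by (simp only: linear_add linear_scale) simp
    then show ?thesis using uv by (intro exI conjI)
  qed
  note x1 = coord[OF _ F1, folded c1(1)] and x2 = coord[OF _ F2, folded c2(1)]
  have meet: "?H1 \<inter> ?H2 = convex hull {a,b}" by (rule triangles_at_edge_meet[OF t1 t2 t(2) ab(1)])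
  have on_edge: "\<exists>u. x = a + u *\<^sub>R (b - a)" if "x \<in> convex hull {a,b}" for x
  proof -
    have "x \<in> closed_segment a b" using that by (simp add: segment_convex_hull)
    then obtain u where "x = (1 - u) *\<^sub>R a + u *\<^sub>R b" by (auto simp: in_segment)
    then show ?thesis by (intro exI[of _ u]) (simp add: algebra_simps)
  qed
  have agree: "F1 (x - a) = (fst (F2 (x - a)), - snd (F2 (x - a)))" if x: "x \<in> ?H1" "x \<in> ?H2" for x
  proof -
    have "x \<in> convex hull {a,b}" using x unfolding meet[symmetric] by blast
    then obtain u where u: "x = a + u *\<^sub>R (b - a)" using on_edge by blast
    have "F1 (x - a) = u *\<^sub>R (1,0)" "F2 (x - a) = u *\<^sub>R (1,0)" unfolding u using F1 F2 by (simp_all add: linear_scale)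
    then show ?thesis by simp
  qed
  have cH: "closed ?H1" "closed ?H2" using closed_simplex(1) TTD(1) T by blast+
  have cont: "continuous_on (?H1 \<union> ?H2) G"
    unfolding G_def
  proof (rule continuous_on_cases[OF cH])
    show "continuous_on ?H1 (\<lambda>x. F1 (x - a))" by (rule continuous_on_linear_diff[OF F1(1)])
    show "continuous_on ?H2 (\<lambda>x. (fst (F2 (x - a)), - snd (F2 (x - a))))"
      by (intro continuous_on_Pair continuous_on_minus continuous_on_fst continuous_on_snd continuous_on_linear_diff[OF F2(1)])
  qed (use agree in auto)
  have G2: "G x = (fst (F2 (x - a)), - snd (F2 (x - a)))" if "x \<in> ?H2" for x using agree that by (auto simp: G_def)
  have inj: "inj_on G (?H1 \<union> ?H2)"
  proof (rule inj_onI)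
    have cross: "p = q" if p: "p \<in> ?H1" and q: "q \<in> ?H2" and eq: "G p = G q" for p q
    proof -
      obtain u v where uv: "0 \<le> v" "p = a + u *\<^sub>R (b - a) + v *\<^sub>R (c1 - a)" "F1 (p - a) = (u,v)" using x1[OF p] by blast
      obtain u' v' where uv': "0 \<le> v'" "q = a + u' *\<^sub>R (b - a) + v' *\<^sub>R (c2 - a)" "F2 (q - a) = (u',v')" using x2[OF q] by blast
      have "(u,v) = (u',-v')" using eq p G2[OF q] uv(3) uv'(3) by (simp add: G_def)
      then have "u = u'" "v = 0" "v' = 0" using uv(1) uv'(1) by auto
      then show ?thesis using uv(2) uv'(2) by simp
    qed
    fix p q assume pq: "p \<in> ?H1 \<union> ?H2" "q \<in> ?H1 \<union> ?H2" "G p = G q"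
    consider "p \<in> ?H1" "q \<in> ?H1" | "p \<in> ?H2" "q \<in> ?H2" | "p \<in> ?H1" "q \<in> ?H2" | "p \<in> ?H2" "q \<in> ?H1" using pq by blast
    then show "p = q"
    proof cases
      case 1
      then have "F1 (p - a) = F1 (q - a)" using pq(3) by (simp add: G_def)
      then show ?thesis using x1[OF 1(1)] x1[OF 1(2)] by auto
    next
      case 2
      then have "F2 (p - a) = F2 (q - a)" using pq(3) G2 by (simp add: prod_eq_iff)
      then show ?thesis using x2[OF 2(1)] x2[OF 2(2)] by auto
    next
      case 3 then show ?thesis using cross pq(3) by blast
    next
      case 4 then show ?thesis using cross[of q p] pq(3) by simp
    qed
  qed
  let ?V = "fstar (convex hull {a,b})"
  have V: "?V \<subseteq> ?H1 \<union> ?H2"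
  proof
    fix x assume "x \<in> ?V"
    then obtain \<tau> where \<tau>: "\<tau> \<in> K" "x \<in> \<tau>" "convex hull {a,b} \<subseteq> \<tau>" unfolding fstar_def by blast
    have sub: "{a,b} \<subseteq> vs \<tau>" using vs_mono[OF \<tau>(3)] EED(2)[OF ab(1)] by simp
    have "card (vs \<tau>) \<le> 3" "finite (vs \<tau>)" using card_vs_le[OF \<tau>(1)] finite_vs[OF \<tau>(1)] .
    then have c: "card (vs \<tau>) = 2 \<or> card (vs \<tau>) = 3" using card_mono[OF _ sub] ab(2) by fastforce
    show "x \<in> ?H1 \<union> ?H2"
    proof (cases "card (vs \<tau>) = 3")
      case True
      then have "vs \<tau> \<in> tri_at TT {a,b}" using \<tau>(1) sub by (auto simp: tri_at_def TT_def)
      then have "vs \<tau> = t1 \<or> vs \<tau> = t2" using t(1) by blast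
      then show ?thesis using simplex_vs(2)[OF \<tau>(1)] \<tau>(2) by auto
    next
      case False
      then have "vs \<tau> = {a,b}" using c card_subset_eq[OF \<open>finite (vs \<tau>)\<close> sub] ab(2) by simp
      then have "x \<in> convex hull {a,b}" using simplex_vs(2)[OF \<tau>(1)] \<tau>(2) by simp
      then show ?thesis using meet by blast
    qed
  qed
  show ?thesis
    by (rule planar_atI[OF fstar_open rel_interior_in_fstar[OF EED(1)[OF ab(1)] y] continuous_on_subset[OF cont V] inj_on_subset[OF inj V]])
qed

text \<open>Near \<open>v\<close> each triangle lies on one page. Crossing a double edge does not
  change the page, because inner points of that edge are planar and hence off the axis. So
  \<open>t\<close> and \<open>t'\<close> would share a page at points of \<open>e\<close> near
  \<open>v\<close>, against \<open>same_page_False\<close>.\<close>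

lemma separating_triple:
  assumes e: "e \<in> EE" "card (tri_at TT e) = 3" "v \<in> e" and t: "t \<in> tri_at TT e" "t' \<in> tri_at TT e"
    and path: "(t,t') \<in> (adj_across TT {e\<in>EE. card (tri_at TT e) = 2 \<and> v \<in> e})\<^sup>*"
  shows "t = t'"
proof (rule ccontr)
  assume tt: "t \<noteq> t'"
  obtain u where u: "e = {v,u}" "v \<noteq> u" by (rule edge_pair[OF e(1,3)])
  have E: "{v,u} \<in> EE" and d3: "3 \<le> card (tri_at TT {v,u})" using e u by auto
  have vK: "v \<in> \<Union>K" by (rule vertex_in_K[OF e(1,3)])
  obtain U f g where ch: "book_chart (\<Union>K) v U f g"
    using dich[OF vK] not_planar_at_vertex[OF E u(2) d3] by blast
  note D = book_chartD[OF ch]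
  obtain \<delta> where d: "0 < \<delta>" "\<And>w. w \<in> \<Union>K \<Longrightarrow> dist v w < \<delta> \<Longrightarrow> w \<in> U" using ball_in_chart[OF ch D(2)] by blast
  let ?O = "\<lambda>s. rel_interior (convex hull s) \<inter> ball v \<delta>"
  have vin: "v \<in> convex hull s" if "v \<in> s" for s using that by (rule hull_inc)
  have vE: "v \<in> convex hull {v,u}" by (rule hull_inc) simp
  have sec: "?O s \<noteq> {}" "\<exists>b\<in>Basis. \<forall>w\<in>?O s. w \<in> U \<and> 0 < fst (f w) \<bullet> b" if s: "s \<in> TT" "v \<in> s" for s
    using sector[OF ch s(1) edge_not_in_rel_interior[OF s(1) E vE] vin[OF s(2)] d] by blast+
  have on: "b = b'" if w: "w \<in> U" "b \<in> Basis" "b' \<in> Basis" "0 < fst (f w) \<bullet> b" "0 < fst (f w) \<bullet> b'" for w b b'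
  proof -
    obtain b'' u'' where b'': "b'' \<in> Basis" "0 \<le> u''" "fst (f w) = u'' *\<^sub>R b''" using D(7)[OF w(1)] unfolding Y_graph_iff by blast
    then have "b'' = b" "b'' = b'" using w by (auto simp: inner_Basis split: if_splits)
    then show ?thesis by simp
  qed
  have tv: "v \<in> t" "t \<in> TT" using t(1) e(3) by (auto simp: tri_at_def)
  obtain b where b: "b \<in> Basis" "\<forall>w\<in>?O t. w \<in> U \<and> 0 < fst (f w) \<bullet> b" using sec(2)[OF tv(2,1)] by blast
  \<comment> \<open>The page of a point \<open>z\<close> off the axis decides the page of every
    adjacent triangle: the page coordinate stays positive at inner points close to
    \<open>z\<close>.\<close>
  have page_eq: "b' = b0"
    if s: "s \<in> TT" and z: "z \<in> convex hull s" "z \<in> U" "dist v z < \<delta>" "0 < fst (f z) \<bullet> b0" "b0 \<in> Basis" "b' \<in> Basis"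
      and b': "\<forall>w\<in>?O s. w \<in> U \<and> 0 < fst (f w) \<bullet> b'" for s z b' b0
  proof -
    have c: "continuous_on U (\<lambda>w. fst (f w) \<bullet> b0)" using D(4) by (intro continuous_intros)
    then obtain r where r: "0 < r" "\<forall>w\<in>U. dist w z < r \<longrightarrow> dist (fst (f w) \<bullet> b0) (fst (f z) \<bullet> b0) < fst (f z) \<bullet> b0"
      using z(2,4) unfolding continuous_on_iff by blast
    have "z \<in> closure (rel_interior (convex hull s))"
      using z(1) convex_closure_rel_interior[of "convex hull s"] closure_subset[of "convex hull s"] by auto
    moreover have "0 < min r (\<delta> - dist v z)" using r(1) z(3) by simp
    ultimately obtain w where w: "w \<in> rel_interior (convex hull s)" "dist w z < min r (\<delta> - dist v z)"
      unfolding closure_approachable by blast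
    have "dist v w < \<delta>" using w(2) dist_triangle[of v w z] by (simp add: dist_commute)
    then have wU: "w \<in> U" "0 < fst (f w) \<bullet> b'" using b' w(1) by auto
    have "dist (fst (f w) \<bullet> b0) (fst (f z) \<bullet> b0) < fst (f z) \<bullet> b0" using r(2) wU(1) w(2) by simp
    then have "0 < fst (f w) \<bullet> b0" by (simp add: dist_real_def abs_if split: if_splits)
    then show ?thesis using on[OF wU(1) z(6,5) wU(2)] by simp
  qed
  have "(\<forall>w\<in>?O t'. w \<in> U \<and> 0 < fst (f w) \<bullet> b) \<and> t' \<in> TT \<and> v \<in> t'"
    using path
  proof (induction rule: rtrancl_induct)
    case base
    show ?case using b(2) tv by blast
  next
    case (step s s')
    then obtain e' where e': "e' \<in> EE" "card (tri_at TT e') = 2" "v \<in> e'" "e' \<subseteq> s" "e' \<subseteq> s'" "s \<in> TT" "s' \<in> TT"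
      by (auto simp: adj_across_def)
    obtain u' where u': "e' = {v,u'}" "v \<noteq> u'" by (rule edge_pair[OF e'(1,3)])
    have s': "v \<in> s'" using e' by blast
    obtain b' where b': "b' \<in> Basis" "\<forall>w\<in>?O s'. w \<in> U \<and> 0 < fst (f w) \<bullet> b'" using sec(2)[OF e'(7) s'] by blast
    define \<mu> where "\<mu> = min (1/2) (\<delta> / (2 * norm (u' - v)))"
    have n: "norm (u' - v) > 0" using u'(2) by simp
    have l: "0 < \<mu>" "\<mu> < 1" using d(1) n by (auto simp: \<mu>_def)
    define z where "z = v + \<mu> *\<^sub>R (u' - v)"
    have "\<mu> * norm (u' - v) \<le> (\<delta> / (2 * norm (u' - v))) * norm (u' - v)" by (intro mult_right_mono) (auto simp: \<mu>_def)
    also have "\<dots> < \<delta>" using n d(1) by simp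
    finally have zd: "dist v z < \<delta>" using l by (simp add: dist_norm z_def)
    have E': "{v,u'} \<in> EE" using e' u' by simp
    have zr: "z \<in> rel_interior (convex hull {v,u'})" unfolding z_def by (rule rel_interior_edge[OF u'(2) l])
    have "z \<in> \<Union>K" unfolding z_def by (rule edge_sub[OF u'(2) E' l])
    then have zU: "z \<in> U" using d(2) zd by blast
    have "planar_at (\<Union>K) z" using planar_at_double_edge[OF E' u'(2) _ zr] e'(2) u'(1) by simp
    moreover have "z \<noteq> v" using l n by (simp add: z_def)
    ultimately have "fst (f z) \<noteq> 0" using not_planar_at_on_axis[OF ch zU] by blast
    moreover obtain b0 u0 where b0: "b0 \<in> Basis" "0 \<le> u0" "fst (f z) = u0 *\<^sub>R b0" using D(7)[OF zU] Y_graph_iff by blast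
    ultimately have pos: "0 < fst (f z) \<bullet> b0" by (cases "u0 = 0") auto
    have "z \<in> convex hull {v,u'}" using zr rel_interior_subset by blast
    then have zs: "z \<in> convex hull s" "z \<in> convex hull s'"
      using hull_mono[of "{v,u'}" s convex] hull_mono[of "{v,u'}" s' convex] e'(4,5) u'(1) by blast+
    have "b = b0" by (rule page_eq[OF e'(6) zs(1) zU zd pos b0(1) b(1)]) (use step.IH in blast)
    moreover have "b' = b0" by (rule page_eq[OF e'(7) zs(2) zU zd pos b0(1) b'(1) b'(2)])
    ultimately show ?case using b'(2) e'(7) s' by simp
  qed
  then have pt': "\<forall>w\<in>?O t'. w \<in> U \<and> 0 < fst (f w) \<bullet> b" by blast
  define \<mu> where "\<mu> = min (1/2) (\<delta> / (2 * norm (u - v)))"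
  have n: "norm (u - v) > 0" using u(2) by simp
  have l: "0 < \<mu>" "\<mu> < 1" using d(1) n by (auto simp: \<mu>_def)
  define y where "y = v + \<mu> *\<^sub>R (u - v)"
  have "\<mu> * norm (u - v) \<le> (\<delta> / (2 * norm (u - v))) * norm (u - v)" by (intro mult_right_mono) (auto simp: \<mu>_def)
  also have "\<dots> < \<delta>" using n d(1) by simp
  finally have yd: "dist v y < \<delta>" using l by (simp add: dist_norm y_def)
  have "y \<in> \<Union>K" unfolding y_def by (rule edge_sub[OF u(2) E l])
  then have yU: "y \<in> U" using d(2) yd by blast
  show False
  proof (rule same_page_False[OF ch u(2) E l y_def yU d3 t[unfolded u(1)] tt _ b(1)])
    \<comment> \<open>The pages are known only in the ball around \<open>v\<close>, so the radius
      available at \<open>y\<close> is what remains of it.\<close>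
    show "0 < \<delta> - dist v y" using yd by simp
    fix w assume w: "w \<in> rel_interior (convex hull t) \<union> rel_interior (convex hull t')" "dist y w < \<delta> - dist v y"
    have "dist v w < \<delta>" using w(2) dist_triangle[of v w y] by simp
    then show "w \<in> U \<and> 0 < fst (f w) \<bullet> b" using w(1) b(2) pt' by auto
  qed
qed

end

theorem theorem2:
  fixes X :: "'a::euclidean_space set"
  assumes "simple_polyhedron X"
    and "acyclic_space X"
    and "disjoint_union_of_circles (Sing X)"
  shows "\<exists>D. collapses_onto X D \<and> D homeomorphic cball (0::real^2) 1"
proof -
  obtain K where K: "simplicial_complex K" "\<Union>K = X"
    using assms(1) by (auto simp: simple_polyhedron_def polyhedral_space_def)
  interpret book_complex K
  proof
    show "simplicial_complex K" by (rule K)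
    show "planar_at (\<Union>K) x \<or> (\<exists>U f g. book_chart (\<Union>K) x U f g)" if "x \<in> \<Union>K" for x
      using simple_dichotomy[OF assms(1,3)] that K(2) by simp
    show "\<exists>V' (k :: 'a \<Rightarrow> real \<times> real) k'. V' \<subseteq> V \<and> V' \<noteq> {} \<and> openin (top_of_set (\<Union>K)) V' \<and>
        homeomorphism V' (k ` V') k k' \<and> open (k ` V')"
      if "x \<in> \<Union>K" "openin (top_of_set (\<Union>K)) V" "x \<in> V" for x V
      using flat_dense[OF assms(1,3)] that unfolding K(2) by blast
  qed
  have ne: "\<Union>K \<noteq> {}" using acyclic_path_connected(2)[OF assms(2)] K(2) by simp
  obtain num :: "'a \<Rightarrow> nat" where num: "inj_on num VV"
    using finite_imp_inj_to_nat_seg[OF finite_VV] by blast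
  interpret numbered_scomplex K num
    by unfold_locales (use num card_vs_le ne in auto)
  interpret acyclic_complex2 VV EE TT num
    by (rule acyclic_complex2_if_acyclic_space) (use assms(2) K(2) in \<open>simp add: X_def\<close>)
  interpret locally_simple VV EE TT num
  proof
    show "card (tri_at TT e) \<le> 3" if "e \<in> EE" for e by (rule card_tri_at_le[OF that])
    show "card {e\<in>EE. v \<in> e \<and> card (tri_at TT e) = 3} \<le> 2" for v by (rule few_triple_edges)
    show "t = t'"
      if "e \<in> EE" "card (tri_at TT e) = 3" "v \<in> e" "t \<in> tri_at TT e" "t' \<in> tri_at TT e"
        "(t,t') \<in> (adj_across TT {e\<in>EE. card (tri_at TT e) = 2 \<and> v \<in> e})\<^sup>*" for e v t t'
      by (rule separating_triple[OF that])
  qed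
  obtain t where t: "t \<in> TT" "abs_collapse\<^sup>*\<^sup>* (cells VV EE TT) (Pow t)"
    using collapses_to_triangle[OF TT_nonempty[OF ne]] by blast
  have "vs ` K = cells VV EE TT" by (rule cells_eq[OF card_vs_le]) (use ne in blast)+
  then have "\<exists>D. collapses_onto (\<Union>K) D \<and> D homeomorphic cball (0::real^2) 1"
    using collapses_onto_abs[of t] t TTD(4)[OF t(1)] by simp
  then show ?thesis unfolding K(2) .
qed

end
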